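(* Let $\varrho(N)$, $N\in\mathbb{N}$, be a sequence of probability measures on $\hat U(N)$ and let $(a_k)_{k\ge 0},(b_k)_{k\ge0}$ be real numbers such that for every $k\in\mathbb{N}$, every fixed index $i_0$, and every fixed indices $i_1,\dots,i_m$ with $|\{i_1,\dots,i_m\}|\ge2$, \[ \lim_{N\to\infty}\big(\partial_{i_0}^k\log S_{\varrho(N)}(1^N)-N a_k\big)=b_k,\qquad \lim_{N\to\infty}\partial_{i_1}\cdots\partial_{i_m}\log S_{\varrho(N)}(1^N)=0, \] and such that $\Psi(z)=\sum_{k\ge0}a_k\frac{(z-1)^k}{k!}$ and $\Phi(z)=\sum_{k\ge0}b_k\frac{(z-1)^k}{k!}$ converge in a neighborhood of $1$. For $q\in[-1,1]$ define the linear functionals $\varphi^{(q)}_N(P)=\mathbb{E}_{\lambda\sim\varrho(N)}\big[\int P(t)\,m_{N,PP(q)}[\lambda](dt)\big]$ on $\mathbb{C}[t]$. Then for every $q\in[-1,1]$ the limits $\varphi_q(P)=\lim_N\varphi^{(q)}_N(P)$ and $\varphi'_q(P)=\lim_N N(\varphi^{(q)}_N(P)-\varphi_q(P))$ exist for all polynomials $P$, with \[ \varphi_q(t^k)=\sum_{m=0}^k\binom km\frac1{(m+1)!}\frac{d^m}{du^m}\big(u^{k-q}(\Psi'(u))^{k-m}\big)\Big|_{u=1}, \] \[ \varphi'_q(t^k)=\sum_{m=0}^{k-1}\binom k{m+1}\frac1{m!}\frac{d^m}{du^m}\Big(u^{k-q}\Big(\Phi'(u)-\frac{1-q}{2u}\Big)(\Psi'(u))^{k-m-1}\Big)\Big|_{u=1}.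 \] Moreover, writing $\mu^{(q)}_k=\varphi_q(t^k)$ and $\mu^{(q)\prime}_k=\varphi'_q(t^k)$, one has the identity of formal power series \[ \exp\Big(q\sum_{k\ge0}\mu^{(0)}_kz^{k+1}\Big)\sum_{k\ge0}\mu^{(q)\prime}_kz^{k+1}=\sum_{k\ge0}\mu^{(0)\prime}_kz^{k+1}+\frac q2\sum_{k\ge0}(k+1)\mu^{(0)}_kz^{k+2}. \]
   Context: A signature of length $N$ is a tuple $\lambda=(\lambda_1\ge\dots\ge\lambda_N)\in\mathbb{Z}^N$; $\hat U(N)$ denotes the set of signatures of length $N$. For $\lambda\in\hat U(N)$, $\chi^{\lambda}(u_1,\dots,u_N)=\det(u_i^{\lambda_j+N-j})_{i,j}/\prod_{i<j}(u_i-u_j)$ is the rational Schur function. For a probability measure $\varrho(N)$ on $\hat U(N)$, the Schur generating function is $S_{\varrho(N)}(u_1,\dots,u_N)=\sum_{\lambda\in\hat U(N)}\varrho(N)[\lambda]\,\chi^\lambda(u_1,\dots,u_N)/\chi^\lambda(1^N)$, where $1^N=(1,\dots,1)$; it is assumed that this series converges uniformly in a neighborhood of $1^N$. $\partial_i$ denotes the partial derivative in $u_i$. For $q\in[-1,1]$ and $\lambda\in\hat U(N)$ the $q$-deformed Perelomov–Popov measure is \[ m_{N,PP(q)}[\lambda]=\frac1N\sum_{i=1}^N\Big(\prod_{j\ne i}\frac{(\lambda_i-i)-(\lambda_j-j)-q}{(\lambda_i-i)-(\lambda_j-j)}\Big)\delta\Big(\frac{\lambda_i+N-i}{N}\Big).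 \] *)

theory Defs
  imports "HOL-Analysis.Analysis"
          "HOL-Probability.Probability_Mass_Function"
          "HOL-Computational_Algebra.Formal_Power_Series"
          "HOL-Computational_Algebra.Polynomial"
begin

text \<open>Signatures of length N: non-increasing integer lists of length N;
  the list entry at position i-1 is lambda_i.\<close>
definition sigs :: "nat \<Rightarrow> int list set" where
  "sigs N = {l. length l = N \<and> sorted_wrt (\<ge>) l}"

text \<open>Points u = (u_1,...,u_N) are functions nat => real; only u 1, ..., u N matter.
  The all-ones point 1^N.\<close>
definition ones :: "nat \<Rightarrow> real" where "ones = (\<lambda>_. 1)"

definition detN :: "nat \<Rightarrow> (nat \<Rightarrow> nat \<Rightarrow> real) \<Rightarrow> real" where
  "detN N M = (\<Sum>p | p permutes {1..N}. of_int (sign p) * (\<Prod>i\<in>{1..N}. M i (p i)))"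

definition schur_ratio :: "nat \<Rightarrow> int list \<Rightarrow> (nat \<Rightarrow> real) \<Rightarrow> real" where
  "schur_ratio N l u =
     detN N (\<lambda>i j. u i powi (l ! (j - 1) + int N - int j)) /
     (\<Prod>i\<in>{1..N}. \<Prod>j\<in>{i<..N}. (u i - u j))"

definition distinct_pts :: "nat \<Rightarrow> (nat \<Rightarrow> real) set" where
  "distinct_pts N = {u. \<forall>i\<in>{1..N}. \<forall>j\<in>{1..N}. i \<noteq> j \<longrightarrow> u i \<noteq> u j}"

definition schur :: "nat \<Rightarrow> int list \<Rightarrow> (nat \<Rightarrow> real) \<Rightarrow> real" where
  "schur N l u = (if u \<in> distinct_pts N then schur_ratio N l u
                  else Lim (at u within distinct_pts N) (schur_ratio N l))"

definition schur_term :: "nat \<Rightarrow> int list pmf \<Rightarrow> (nat \<Rightarrow> real) \<Rightarrow> int list \<Rightarrow> real" where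
  "schur_term N rho u l = pmf rho l * schur N l u / schur N l ones"

definition SGF :: "nat \<Rightarrow> int list pmf \<Rightarrow> (nat \<Rightarrow> real) \<Rightarrow> real" where
  "SGF N rho u = (\<Sum>\<^sub>\<infinity>l\<in>sigs N. schur_term N rho u l)"

definition SGF_unif_conv :: "nat \<Rightarrow> int list pmf \<Rightarrow> bool" where
  "SGF_unif_conv N rho \<longleftrightarrow> (\<exists>e>0.
     uniform_limit {u. \<forall>i\<in>{1..N}. \<bar>u i - 1\<bar> < e}
       (\<lambda>F u. \<Sum>l\<in>F. schur_term N rho u l) (SGF N rho) (finite_subsets_at_top (sigs N)))"

definition pderiv_i :: "nat \<Rightarrow> ((nat \<Rightarrow> real) \<Rightarrow> real) \<Rightarrow> (nat \<Rightarrow> real) \<Rightarrow> real" where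
  "pderiv_i i f = (\<lambda>x. deriv (\<lambda>t. f (x(i := t))) (x i))"

fun pderivs :: "nat list \<Rightarrow> ((nat \<Rightarrow> real) \<Rightarrow> real) \<Rightarrow> (nat \<Rightarrow> real) \<Rightarrow> real" where
  "pderivs [] f = f"
| "pderivs (i # is) f = pderiv_i i (pderivs is f)"

definition pp_weight :: "nat \<Rightarrow> real \<Rightarrow> int list \<Rightarrow> nat \<Rightarrow> real" where
  "pp_weight N q l i = (1 / real N) *
     (\<Prod>j\<in>{1..N} - {i}.
        ((of_int (l ! (i - 1)) - real i) - (of_int (l ! (j - 1)) - real j) - q) /
        ((of_int (l ! (i - 1)) - real i) - (of_int (l ! (j - 1)) - real j)))"

definition pp_atom :: "nat \<Rightarrow> int list \<Rightarrow> nat \<Rightarrow> real" where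
  "pp_atom N l i = (of_int (l ! (i - 1)) + real N - real i) / real N"

definition pp_integral :: "nat \<Rightarrow> real \<Rightarrow> int list \<Rightarrow> complex poly \<Rightarrow> complex" where
  "pp_integral N q l P = (\<Sum>i\<in>{1..N}. of_real (pp_weight N q l i) * poly P (of_real (pp_atom N l i)))"

definition phiN :: "(nat \<Rightarrow> int list pmf) \<Rightarrow> real \<Rightarrow> nat \<Rightarrow> complex poly \<Rightarrow> complex" where
  "phiN rho q N P = measure_pmf.expectation (rho N) (\<lambda>l. pp_integral N q l P)"

definition egf_at1 :: "(nat \<Rightarrow> real) \<Rightarrow> real \<Rightarrow> real" where
  "egf_at1 c z = (\<Sum>k. c k * (z - 1) ^ k / fact k)"

end

theory Submission
  imports Defs "Jordan_Normal_Form.Determinant" "HOL-Probability.Probability"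
begin

text \<open>
  Write \<open>l\<^sub>j = \<lambda>\<^sub>j + N - j\<close>. Shifting one row \<open>l\<^sub>j\<close> of the alternant by \<open>- q\<close> and letting
  \<open>u = 1 + \<epsilon> x\<close> tend to \<open>1\<close> turns the ratio of alternants into the Perelomov--Popov weight of \<open>l\<^sub>j\<close>, so
  \<open>\<Sum>j. w\<^sub>j (l\<^sub>j choose k)\<close> is a limit of alternants. Expanding the normalised Schur function into Laurent
  monomials with nonnegative weights rewrites that limit as a sum over \<open>m \<le> k\<close> of \<open>N choose (m + 1)\<close> times
  a divided difference in \<open>m + 1\<close> of the variables, that is, a coefficient of the jet of
  the Schur generating function \<open>S\<close> along the line \<open>1 + \<epsilon> (1, \<dots>, m + 1, 0, \<dots>)\<close>. The number of variables
  involved does not depend on \<open>N\<close>.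

  The jets of the derivatives of \<open>S = exp (ln S)\<close> are determined by those of \<open>ln S\<close> through the recursion for
  the exponential; the hypotheses say that the latter are \<open>N \<Psi> + \<Phi> + o(1)\<close> with separated variables, which gives
  the first two orders of the factorial moments and hence of the power moments. The generating function
  identity follows from Lagrange inversion for \<open>X / ((1 + X) (1 + X \<Psi>'(1 + X)))\<close>.
\<close>

subsection \<open>Lagrange inversion and the generating function identity\<close>

text \<open>The operator needs pairwise distinct variables, whereas the hypotheses only see the germ
  at \<open>ones\<close> in boundedly many directions. The bridge is that the limit of a symmetrised
  divided difference depends neither on the chosen set of m + 1 variables nor on the direction of
  approach; so these variables may run along 1 + e, ..., 1 + (m + 1) e while all others are put
  equal to 1. The mere existence of that limit has a second use: it forces the coefficients below
  the m-th to vanish, so the m-th one is unchanged when the jet of S, whose constant term is 1, is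
  divided out. What remains are quotients of derivatives of S by S, which the recursion computes
  from ln S. The correction of order 1/N has three sources: the second term of N choose (m + 1), the
  second term of the exponential recursion, and the passage from factorial to power moments. An
  integration by parts on coefficients merges them, and (k - 1)/2 - (k - q)/2 is the origin of the
  constant -(1 - q)/2.\<close>

definition mom :: "real fps \<Rightarrow> real \<Rightarrow> nat \<Rightarrow> real" where
  "mom P q k = (\<Sum>m\<le>k. real (k choose m) / real (m + 1) *
     fps_nth (fps_binomial (real k - q) * P ^ (k - m)) m)"

text \<open>\<open>mom\<close> and \<open>mom'\<close> are the two limit formulas with every m-th
  derivative at 1 written as m! times a coefficient in u = 1 + X. P and Q stand for the expansions
  of \<Psi>' and \<Phi>', and \<open>fps_binomial (-1)\<close> for 1/u.\<close>

definition mom' :: "real fps \<Rightarrow> real fps \<Rightarrow> real \<Rightarrow> nat \<Rightarrow> real" where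
  "mom' P Q q k = (\<Sum>m<k. real (k choose (m + 1)) *
     fps_nth (fps_binomial (real k - q) * (Q - fps_const ((1 - q) / 2) * fps_binomial (-1)) * P ^ (k - m - 1)) m)"

lemma fps_nth_mult_one_plus_X_power:
  fixes F P :: "real fps"
  shows "fps_nth (F * (1 + fps_X * P) ^ n) d =
    (\<Sum>m\<le>d. real (n choose (d - m)) * fps_nth (F * P ^ (d - m)) m)"
proof -
  have exp: "(1 + fps_X * P) ^ n = (\<Sum>j\<le>n. of_nat (n choose j) * (fps_X * P) ^ j)"
    using binomial_ring[of "fps_X * P" 1 n] by (simp add: add.commute)
  have "fps_nth (F * (1 + fps_X * P) ^ n) d =
      (\<Sum>j\<le>n. fps_nth (fps_X ^ j * (of_nat (n choose j) * (F * P ^ j))) d)"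
    by (simp add: exp sum_distrib_left fps_sum_nth power_mult_distrib algebra_simps)
  also have "\<dots> = (\<Sum>j\<le>n. if d < j then 0 else real (n choose j) * fps_nth (F * P ^ j) (d - j))"
    by (intro sum.cong refl) (simp add: fps_X_power_mult_nth fps_of_nat [symmetric])
  also have "\<dots> = (\<Sum>j\<le>d. real (n choose j) * fps_nth (F * P ^ j) (d - j))"
    by (rule sum.mono_neutral_cong) auto
  also have "\<dots> = (\<Sum>m\<le>d. real (n choose (d - m)) * fps_nth (F * P ^ (d - m)) m)"
    by (rule sum.reindex_bij_witness[where i="\<lambda>m. d - m" and j="\<lambda>m. d - m"]) auto
  finally show ?thesis .
qed

lemma one_plus_X_power: "(1 + fps_X) ^ n = fps_binomial (real n)"
  by (simp add: fps_binomial_of_nat)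

text \<open>The factor (1 + X)^(k + 1) merges with (1 + X)^(-1 - q), and (k + 1)/(m + 1) times k
  choose m is the binomial coefficient in the expansion of (1 + X P)^(k + 1). The result has the
  shape [X^k] h H^(k + 1) that Lagrange inversion sums over k.\<close>

lemma mom_residue:
  "real (k + 1) * mom P q k =
     fps_nth (fps_binomial (-1 - q) * ((1 + fps_X) * (1 + fps_X * P)) ^ (k + 1)) k"
proof -
  have "fps_nth (fps_binomial (-1 - q) * ((1 + fps_X) * (1 + fps_X * P)) ^ (k + 1)) k
     = fps_nth ((fps_binomial (-1 - q) * fps_binomial (real (k + 1))) * (1 + fps_X * P) ^ (k + 1)) k"
    by (simp only: power_mult_distrib one_plus_X_power mult.assoc)
  also have "fps_binomial (-1 - q) * fps_binomial (real (k + 1)) = fps_binomial (real k - q)"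
    by (simp add: fps_binomial_add_mult[symmetric])
  also have "fps_nth (fps_binomial (real k - q) * (1 + fps_X * P) ^ (k + 1)) k =
    (\<Sum>m\<le>k. real ((k + 1) choose (k - m)) * fps_nth (fps_binomial (real k - q) * P ^ (k - m)) m)"
    by (rule fps_nth_mult_one_plus_X_power)
  also have "\<dots> = (\<Sum>m\<le>k. real (k + 1) * (real (k choose m) / real (m + 1) *
     fps_nth (fps_binomial (real k - q) * P ^ (k - m)) m))"
  proof (rule sum.cong[OF refl])
    fix m assume m: "m \<in> {..k}"
    have "(k + 1) choose (k - m) = Suc k choose Suc m"
      using m binomial_symmetric[of "k - m" "k + 1"] by (simp add: Suc_diff_le)
    moreover have "real (Suc m) * real (Suc k choose Suc m) = real (Suc k) * real (k choose m)"
      using Suc_times_binomial_eq[of k m] by (metis mult.commute of_nat_mult)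
    ultimately have "real ((k + 1) choose (k - m)) = real (k + 1) * (real (k choose m) / real (m + 1))"
      by (simp add: field_simps)
    then show "real ((k + 1) choose (k - m)) * fps_nth (fps_binomial (real k - q) * P ^ (k - m)) m =
       real (k + 1) * (real (k choose m) / real (m + 1) *
         fps_nth (fps_binomial (real k - q) * P ^ (k - m)) m)" by simp
  qed
  finally show ?thesis by (simp add: mom_def sum_distrib_left)
qed

text \<open>The exponent k + 1 - q splits into k + 1, which goes into the same power as in
  \<open>mom_residue\<close>, and - q. No factor appears in front because the binomial coefficient
  is already that of exponent k + 1.\<close>

lemma mom'_residue:
  "mom' P Q q (Suc k) = fps_nth (fps_binomial (-q) * (Q - fps_const ((1 - q) / 2) * fps_binomial (-1)) *
     ((1 + fps_X) * (1 + fps_X * P)) ^ (k + 1)) k"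
proof -
  let ?R = "Q - fps_const ((1 - q) / 2) * fps_binomial (-1)"
  have "fps_nth (fps_binomial (-q) * ?R * ((1 + fps_X) * (1 + fps_X * P)) ^ (k + 1)) k
     = fps_nth (((fps_binomial (-q) * fps_binomial (real (k + 1))) * ?R) * (1 + fps_X * P) ^ (k + 1)) k"
    by (simp only: power_mult_distrib one_plus_X_power mult_ac)
  also have "fps_binomial (-q) * fps_binomial (real (k + 1)) = fps_binomial (real (Suc k) - q)"
    by (simp add: fps_binomial_add_mult[symmetric])
  also have "fps_nth ((fps_binomial (real (Suc k) - q) * ?R) * (1 + fps_X * P) ^ (k + 1)) k =
    (\<Sum>m\<le>k. real ((k + 1) choose (k - m)) * fps_nth ((fps_binomial (real (Suc k) - q) * ?R) * P ^ (k - m)) m)"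
    by (rule fps_nth_mult_one_plus_X_power)
  also have "\<dots> = (\<Sum>m<Suc k. real (Suc k choose (m + 1)) *
     fps_nth ((fps_binomial (real (Suc k) - q) * ?R) * P ^ (Suc k - m - 1)) m)"
  proof (rule sum.cong)
    fix m assume m: "m \<in> {..<Suc k}"
    have "(k + 1) choose (k - m) = Suc k choose (m + 1)"
      using m binomial_symmetric[of "k - m" "k + 1"] by (simp add: Suc_diff_le)
    then show "real ((k + 1) choose (k - m)) * fps_nth ((fps_binomial (real (Suc k) - q) * ?R) * P ^ (k - m)) m =
      real (Suc k choose (m + 1)) * fps_nth ((fps_binomial (real (Suc k) - q) * ?R) * P ^ (Suc k - m - 1)) m"
      by simp
  qed auto
  finally show ?thesis by (simp add: mom'_def)
qed

text \<open>Since (H^p)' = p H^(p - 1) H', both terms contribute [X^p] H^p: the residue of an exact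
  differential is 0.\<close>

lemma fps_nth_power_deriv_cancel:
  fixes H :: "real fps"
  assumes "p > 0"
  shows "fps_nth (H ^ p - fps_X * (H ^ (p - 1) * fps_deriv H)) p = 0"
proof -
  obtain r where r: "p = Suc r" using assms by (cases p) auto
  have "fps_deriv (H ^ p) = fps_const (real p) * (H ^ (p - 1) * fps_deriv H)"
    by (simp add: fps_deriv_power mult_ac)
  then have "fps_nth (fps_deriv (H ^ p)) r = real p * fps_nth (H ^ (p - 1) * fps_deriv H) r"
    by simp
  then have "real p * fps_nth (H ^ p) p = real p * fps_nth (H ^ (p - 1) * fps_deriv H) r"
    unfolding fps_deriv_nth r by simp
  then show ?thesis using r by (simp del: power_Suc)
qed

text \<open>As H = X / T, the coefficient is the residue of T^(j - n - 1) dT, hence 1 for j = n and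
  0 for an exact differential. Powers of H take the place of Laurent series.\<close>

lemma lagrange_monomial:
  fixes H :: "real fps"
  assumes H0: "fps_nth H 0 = 1" and jn: "j \<le> n"
  defines "T \<equiv> fps_X * inverse H"
  shows "fps_nth (T ^ j * fps_deriv T * H ^ (n + 1)) n = (if j = n then 1 else 0)"
proof -
  have Hi: "inverse H * H = 1" using H0 by (simp add: inverse_mult_eq_1)
  have dT: "fps_deriv T = inverse H - fps_X * fps_deriv H * inverse H ^ 2"
    using H0 by (simp add: T_def fps_inverse_deriv algebra_simps)
  have Hj: "inverse H ^ i * H ^ i = 1" for i
    by (simp add: power_mult_distrib[symmetric] Hi)
  define p where "p = n - j"
  have n: "n = p + j" using jn p_def by simp
  have *: "T ^ j * fps_deriv T * H ^ (n + 1) =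
     fps_X ^ j * (H ^ p - fps_X * (inverse H * H ^ p * fps_deriv H))"
  proof -
    have "T ^ j * fps_deriv T * H ^ (n + 1) =
       fps_X ^ j * (inverse H ^ j * H ^ j) * ((inverse H * H) * H ^ p - fps_X * fps_deriv H * (inverse H * H) * inverse H * H ^ p)"
      by (simp add: T_def[symmetric] dT n power_add power2_eq_square power_mult_distrib algebra_simps)
         (simp add: T_def power_mult_distrib algebra_simps)
    then show ?thesis by (simp only: Hi Hj mult_1_left mult_1_right) (simp add: mult_ac)
  qed
  show ?thesis
  proof (cases "p = 0")
    case True
    then show ?thesis using n unfolding * by (simp add: fps_X_power_mult_nth)
  next
    case False
    have "inverse H * H ^ p = H ^ (p - 1)"
      using False Hi by (cases p) (auto simp: mult.assoc[symmetric])
    then have "fps_nth (T ^ j * fps_deriv T * H ^ (n + 1)) n = fps_nth (H ^ p - fps_X * (H ^ (p - 1) * fps_deriv H)) p"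
      unfolding * using n by (simp add: fps_X_power_mult_nth)
    also have "\<dots> = 0" using False by (intro fps_nth_power_deriv_cancel) auto
    finally show ?thesis using False n by simp
  qed
qed

text \<open>With R for the series on the left, the chain rule for V o T = X gives h = (R o T) T';
  expanding R o T in powers of T reduces the claim to \<open>lagrange_monomial\<close>.\<close>

lemma lagrange_inversion:
  fixes H h :: "real fps"
  assumes H0: "fps_nth H 0 = 1"
  defines "V \<equiv> fps_inv (fps_X * inverse H)"
  shows "fps_nth ((h oo V) * fps_deriv V) n = fps_nth (h * H ^ (n + 1)) n"
proof -
  define T where "T = fps_X * inverse H"
  have T0: "fps_nth T 0 = 0" by (simp add: T_def)
  have T1: "fps_nth T 1 \<noteq> 0" using H0 by (simp add: T_def)
  have V0: "fps_nth V 0 = 0" by (simp add: V_def fps_inv_def)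
  have VT: "V oo T = fps_X" using fps_inv[OF T0 T1] by (simp add: V_def T_def)
  define R where "R = (h oo V) * fps_deriv V"
  have "fps_deriv (V oo T) = (fps_deriv V oo T) * fps_deriv T"
    by (rule fps_compose_deriv[OF T0])
  then have dVT: "(fps_deriv V oo T) * fps_deriv T = 1" by (simp add: VT)
  have "(R oo T) * fps_deriv T = (h oo V oo T) * ((fps_deriv V oo T) * fps_deriv T)"
    by (simp add: R_def fps_compose_mult_distrib[OF T0] mult.assoc)
  also have "h oo V oo T = h"
    by (simp add: fps_compose_assoc[OF T0 V0, symmetric] VT)
  finally have h: "h = (R oo T) * fps_deriv T" by (simp add: dVT)
  define W where "W = fps_deriv T * H ^ (n + 1)"
  have T_low: "fps_nth (T ^ j) i = 0" if "i < j" for i j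
    using that by (simp add: T_def power_mult_distrib fps_X_power_mult_nth)
  \<comment> \<open>T^j starts at X^j, so powers beyond n do not reach coefficients of order at most
    n.\<close>
  have RT: "fps_nth (R oo T) i = (\<Sum>j=0..n. fps_nth R j * fps_nth (T ^ j) i)" if "i \<le> n" for i
    unfolding fps_compose_nth
    by (rule sum.mono_neutral_left) (use that T_low in auto)
  have "fps_nth (h * H ^ (n + 1)) n = fps_nth ((R oo T) * W) n"
    by (subst h) (simp add: W_def mult.assoc)
  also have "\<dots> = (\<Sum>i=0..n. (\<Sum>j=0..n. fps_nth R j * fps_nth (T ^ j) i) * fps_nth W (n - i))"
    unfolding fps_mult_nth by (intro sum.cong refl) (simp add: RT)
  also have "\<dots> = (\<Sum>j=0..n. fps_nth R j * fps_nth (T ^ j * W) n)"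
    unfolding fps_mult_nth sum_distrib_right sum_distrib_left
    by (subst sum.swap) (simp add: mult_ac)
  also have "\<dots> = (\<Sum>j=0..n. fps_nth R j * (if j = n then 1 else 0))"
    by (intro sum.cong refl)
       (use lagrange_monomial[OF H0] in \<open>simp add: T_def W_def mult.assoc\<close>)
  also have "\<dots> = fps_nth R n" by (simp add: if_distrib cong: if_cong)
  finally show ?thesis by (simp add: R_def)
qed

text \<open>By Lagrange inversion the series of \<open>mom P 0\<close> is ln (1 + V), seen through
  its derivative V' / (1 + V). The exponential is therefore (1 + V)^q and cancels the (1 + V)^(-q)
  inside the series of \<open>mom'\<close>; what is left depends on q linearly.\<close>

lemma exp_mom_generating_identity:
  fixes P Q :: "real fps" and q :: real
  shows "(fps_exp 1 oo (fps_const q * Abs_fps (\<lambda>n. if n = 0 then 0 else mom P 0 (n - 1)))) *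
      Abs_fps (\<lambda>n. if n = 0 then 0 else mom' P Q q (n - 1))
    = Abs_fps (\<lambda>n. if n = 0 then 0 else mom' P Q 0 (n - 1)) +
      fps_const (q / 2) * Abs_fps (\<lambda>n. if n < 2 then 0 else real (n - 1) * mom P 0 (n - 2))"
proof -
  define H where "H = (1 + fps_X) * (1 + fps_X * P)"
  have H0: "fps_nth H 0 = 1" by (simp add: H_def)
  define V where "V = fps_inv (fps_X * inverse H)"
  have V0: "fps_nth V 0 = 0" by (simp add: V_def fps_inv_def)
  define R where "R q = Q - fps_const ((1 - q) / 2) * fps_binomial (-1)" for q
  define A where "A = Abs_fps (\<lambda>n. if n = 0 then 0 else mom P 0 (n - 1))"
  have dA: "fps_deriv A = (fps_binomial (-1) oo V) * fps_deriv V"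
  proof (rule fps_ext)
    fix n
    have "fps_nth (fps_deriv A) n = fps_nth (fps_binomial (-1) * H ^ (n + 1)) n"
      using mom_residue[of n P 0] by (simp add: A_def H_def)
    then show "fps_nth (fps_deriv A) n = fps_nth ((fps_binomial (-1) oo V) * fps_deriv V) n"
      by (simp only: V_def lagrange_inversion[OF H0])
  qed
  \<comment> \<open>\<open>mom'\<close> vanishes at 0, so the series starts at X^2 and the Lagrange
    index is shifted by one.\<close>
  have B: "Abs_fps (\<lambda>n. if n = 0 then 0 else mom' P Q q (n - 1)) =
      fps_X ^ 2 * (((fps_binomial (-q) * R q) oo V) * fps_deriv V)" for q
  proof (rule fps_ext)
    fix n
    show "fps_nth (Abs_fps (\<lambda>n. if n = 0 then 0 else mom' P Q q (n - 1))) n =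
       fps_nth (fps_X ^ 2 * (((fps_binomial (-q) * R q) oo V) * fps_deriv V)) n"
    proof (cases "n < 2")
      case True
      then have "n = 0 \<or> n = 1" by auto
      then show ?thesis by (auto simp: fps_X_power_mult_nth mom'_def)
    next
      case False
      then obtain k where k: "n = Suc (Suc k)" by (metis add_2_eq_Suc le_add_diff_inverse not_less)
      have "mom' P Q q (Suc k) = fps_nth ((fps_binomial (-q) * R q) * H ^ (k + 1)) k"
        unfolding mom'_residue R_def H_def ..
      also have "\<dots> = fps_nth (((fps_binomial (-q) * R q) oo V) * fps_deriv V) k"
        by (simp only: V_def lagrange_inversion[OF H0])
      finally show ?thesis using k by (simp add: fps_X_power_mult_nth)
    qed
  qed
  define E where "E = fps_exp 1 oo (fps_const q * A)"
  have qA0: "fps_nth (fps_const q * A) 0 = 0" by (simp add: A_def)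
  have dE: "fps_deriv E = E * (fps_const q * fps_deriv A)"
    unfolding E_def by (subst fps_compose_deriv[OF qA0]) simp
  define Y where "Y = fps_binomial (-q) oo V"
  have inv1X: "inverse (1 + fps_X :: real fps) = fps_binomial (-1)"
    by (simp add: fps_binomial_minus_one)
  have db: "fps_deriv (fps_binomial (-q)) = fps_const (-q) * (fps_binomial (-q) * fps_binomial (-1))"
    by (simp add: fps_binomial_deriv fps_divide_unit inv1X mult_ac del: fps_const_neg)
  have dY: "fps_deriv Y = - (fps_const q * Y * fps_deriv A)"
    unfolding Y_def dA
    by (subst fps_compose_deriv[OF V0], subst db)
       (simp add: fps_compose_mult_distrib[OF V0] fps_compose_uminus mult_ac
         flip: fps_const_neg)
  \<comment> \<open>E and Y are (1 + V)^q and (1 + V)^(-q); that they are inverse is checked by the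
    derivative and the constant term of the product.\<close>
  have "fps_deriv (E * Y) = 0"
    by (simp add: dE dY algebra_simps)
  then have "E * Y = fps_const (fps_nth (E * Y) 0)" by (simp only: fps_deriv_eq_0_iff)
  also have "fps_nth (E * Y) 0 = 1"
    by (simp add: E_def Y_def)
  finally have EY: "E * Y = 1" by simp
  have "E * (fps_X ^ 2 * (((fps_binomial (-q) * R q) oo V) * fps_deriv V)) =
      (E * Y) * (fps_X ^ 2 * ((R q oo V) * fps_deriv V))"
    by (simp add: Y_def fps_compose_mult_distrib[OF V0] mult_ac)
  also have "\<dots> = fps_X ^ 2 * ((R q oo V) * fps_deriv V)" by (simp add: EY)
  also have "R q oo V = (R 0 + fps_const (q / 2) * fps_binomial (-1)) oo V"
  proof -
    have *: "C = A + B \<Longrightarrow> Q - A * b = Q - C * b + B * b" for A B C b :: "real fps"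
      by (simp add: algebra_simps)
    have "R q = R 0 + fps_const (q / 2) * fps_binomial (-1)"
      unfolding R_def by (rule *) (simp add: field_simps)
    then show ?thesis by simp
  qed
  also have "fps_X ^ 2 * ((R 0 + fps_const (q / 2) * fps_binomial (-1) oo V) * fps_deriv V) =
      fps_X ^ 2 * ((R 0 oo V) * fps_deriv V) + fps_const (q / 2) * (fps_X ^ 2 * fps_deriv A)"
    by (simp add: dA fps_compose_add_distrib fps_compose_mult_distrib[OF V0] algebra_simps)
  also have "fps_X ^ 2 * ((R 0 oo V) * fps_deriv V) = Abs_fps (\<lambda>n. if n = 0 then 0 else mom' P Q 0 (n - 1))"
    unfolding B by simp
  also have "fps_X ^ 2 * fps_deriv A = Abs_fps (\<lambda>n. if n < 2 then 0 else real (n - 1) * mom P 0 (n - 2))"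
    by (rule fps_ext) (auto simp: fps_X_power_mult_nth A_def of_nat_diff)
  finally show ?thesis unfolding B E_def A_def .
qed

text \<open>The left side collects the 1/N corrections: \<open>Br\<close> from the exponential
  recursion, - m/2 from N choose (m + 1), and k choose 2 from turning factorial moments into powers.
  The second part of \<open>Br\<close> is a multiple of the derivative of a power of P; moving that
  derivative onto the binomial series produces boundary terms that cancel the - m/2 terms.\<close>

lemma mom'_integration_by_parts:
  fixes P Q :: "real fps"
  defines "Br \<equiv> (\<lambda>r. of_nat r * P ^ (r - 1) * Q + of_nat (r choose 2) * P ^ (r - 2) * fps_deriv P)"
  shows "(\<Sum>m\<le>k. real (k choose m) * (1 / real (m + 1) * fps_nth (fps_binomial (real k - q) * Br (k - m)) m
             - real m / 2 * fps_nth (fps_binomial (real k - q) * P ^ (k - m)) m))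
          + real (k choose 2) * mom P q (k - 1) = mom' P Q q k"
proof (cases k)
  case 0
  then show ?thesis by (simp add: mom'_def Br_def binomial_eq_0)
next
  case (Suc k1)
  let ?b = "fps_binomial (real k - q)" and ?b1 = "fps_binomial (real k - q - 1)"
  have db: "fps_deriv ?b = fps_const (real k - q) * ?b1"
  proof -
    have "?b1 = ?b * fps_binomial (-1)" by (simp add: fps_binomial_add_mult[symmetric])
    then show ?thesis
      by (simp add: fps_binomial_deriv fps_divide_unit fps_binomial_minus_one mult_ac)
  qed
  define c where "c m = real (k choose (m + 1))" for m
  \<comment> \<open>Boundary term of the integration by parts; it reappears with index m + 1, and as
    d 0 = 0 the two sums over d are equal.\<close>
  define d where "d m = real m / 2 * real (k choose m) * fps_nth (?b * P ^ (k - m)) m" for m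
  have tm: "real (k choose m) * (1 / real (m + 1) * fps_nth (?b * Br (k - m)) m) =
      c m * fps_nth (?b * Q * P ^ (k - m - 1)) m + d (m + 1)
       - (real k - q) / 2 * c m * fps_nth (?b1 * P ^ (k - m - 1)) m" if m: "m < k" for m
  proof -
    define r where "r = k - m - 1"
    have kr: "k - m = Suc r" using m by (simp add: r_def)
    have kr': "k - Suc m = r" by (simp add: r_def)
    have c: "c m = real (k choose m) * real (Suc r) / real (m + 1)"
    proof -
      have "Suc m * (k choose Suc m) = (k - m) * (k choose m)"
        using binomial_absorb_comp[of k m] Suc_times_binomial_eq[of k1 m] Suc
        by (simp del: binomial_Suc_Suc mult_Suc add: mult.commute)
      then have "real (Suc m) * real (k choose Suc m) = real (k - m) * real (k choose m)"
        by (metis of_nat_mult)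
      then show ?thesis using kr by (simp add: c_def field_simps)
    qed
    have dP: "fps_deriv (P ^ r) = of_nat r * P ^ (r - 1) * fps_deriv P"
      by (simp add: fps_deriv_power fps_of_nat)
    have ch: "2 * (Suc r choose 2) = Suc r * r"
      by (simp add: choose_two)
    have "fps_const 2 * (of_nat (Suc r choose 2) * P ^ (r - 1) * fps_deriv P) =
        (of_nat (2 * (Suc r choose 2)) :: real fps) * P ^ (r - 1) * fps_deriv P"
      by (simp add: fps_of_nat[symmetric] mult.assoc[symmetric])
    also have "\<dots> = of_nat (Suc r) * fps_deriv (P ^ r)"
      unfolding ch dP by (simp only: of_nat_mult mult_ac)
    finally have h: "of_nat (Suc r choose 2) * P ^ (r - 1) * fps_deriv P =
        fps_const (real (Suc r) / 2) * fps_deriv (P ^ r)"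
    proof -
      assume a: "fps_const 2 * (of_nat (Suc r choose 2) * P ^ (r - 1) * fps_deriv P) =
         of_nat (Suc r) * fps_deriv (P ^ r)"
      have "fps_const (1/2) * (fps_const 2 * (of_nat (Suc r choose 2) * P ^ (r - 1) * fps_deriv P)) =
         fps_const (1/2) * (of_nat (Suc r) * fps_deriv (P ^ r))" by (simp only: a)
      then show ?thesis
        by (simp add: mult.assoc[symmetric] fps_of_nat[symmetric] del: of_nat_Suc)
    qed
    have Br: "Br (k - m) = of_nat (Suc r) * P ^ r * Q + fps_const (real (Suc r) / 2) * fps_deriv (P ^ r)"
      unfolding Br_def kr using h by simp
    have "fps_nth (fps_deriv (?b * P ^ r)) m = fps_nth (?b * fps_deriv (P ^ r)) m
        + (real k - q) * fps_nth (?b1 * P ^ r) m"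
      by (simp add: db mult.assoc)
    then have byparts: "fps_nth (?b * fps_deriv (P ^ r)) m =
        real (m + 1) * fps_nth (?b * P ^ r) (m + 1) - (real k - q) * fps_nth (?b1 * P ^ r) m"
      unfolding fps_deriv_nth by simp
    have e1: "fps_nth (?b * Br (k - m)) m = real (Suc r) * fps_nth (?b * Q * P ^ r) m
         + real (Suc r) / 2 * fps_nth (?b * fps_deriv (P ^ r)) m"
    proof -
      have "?b * Br (k - m) = fps_const (real (Suc r)) * (?b * Q * P ^ r)
           + fps_const (real (Suc r) / 2) * (?b * fps_deriv (P ^ r))"
        unfolding Br by (simp only: fps_of_nat[symmetric] distrib_left mult_ac)
      then show ?thesis by simp
    qed
    have "real (k choose m) * (1 / real (m + 1) * fps_nth (?b * Br (k - m)) m) =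
       c m * fps_nth (?b * Q * P ^ r) m + c m / 2 * fps_nth (?b * fps_deriv (P ^ r)) m"
    proof -
      have "C * (1 / M * (s * x + s / 2 * y)) = C * s / M * x + C * s / M / 2 * y" for C M s x y :: real
        by (simp add: algebra_simps add_divide_distrib)
      from this[of "real (k choose m)" "real (m + 1)" "real (Suc r)"] show ?thesis
        by (simp only: e1 c)
    qed
    also have "c m / 2 * fps_nth (?b * fps_deriv (P ^ r)) m =
       d (m + 1) - (real k - q) / 2 * c m * fps_nth (?b1 * P ^ r) m"
    proof -
      have "x / 2 * (M * y - z * w) = M / 2 * x * y - z / 2 * x * w" for x M y z w :: real
        by (simp add: algebra_simps)
      then show ?thesis
        unfolding byparts d_def c_def using kr' by simp
    qed
    finally show ?thesis unfolding r_def by (simp only: add_diff_eq)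
  qed
  have last: "real (k choose k) * (1 / real (k + 1) * fps_nth (?b * Br (k - k)) k) = 0"
    by (simp add: Br_def binomial_eq_0)
  have S1: "(\<Sum>m\<le>k. real (k choose m) * (1 / real (m + 1) * fps_nth (?b * Br (k - m)) m)) =
     (\<Sum>m<k. c m * fps_nth (?b * Q * P ^ (k - m - 1)) m) + (\<Sum>m<k. d (m + 1))
       - (real k - q) / 2 * (\<Sum>m<k. c m * fps_nth (?b1 * P ^ (k - m - 1)) m)"
  proof -
    have "(\<Sum>m<k. real (k choose m) * (1 / real (m + 1) * fps_nth (?b * Br (k - m)) m)) =
      (\<Sum>m<k. c m * fps_nth (?b * Q * P ^ (k - m - 1)) m + d (m + 1)
       - (real k - q) / 2 * c m * fps_nth (?b1 * P ^ (k - m - 1)) m)"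
      by (rule sum.cong[OF refl], rule tm) simp
    then show ?thesis
      unfolding lessThan_Suc_atMost[symmetric] sum.lessThan_Suc last
      by (simp only: sum.distrib sum_subtractf sum_distrib_left mult.assoc add_0_right)
  qed
  have S2: "(\<Sum>m\<le>k. d m) = (\<Sum>m<k. d (m + 1))"
    unfolding lessThan_Suc_atMost[symmetric] sum.lessThan_Suc_shift by (simp add: d_def)
  have S3: "real (k choose 2) * mom P q (k - 1) = (real k - 1) / 2 * (\<Sum>m<k. c m * fps_nth (?b1 * P ^ (k - m - 1)) m)"
  proof -
    have cc: "real (k choose 2) * (real (k1 choose m) / real (m + 1)) = (real k - 1) / 2 * c m" for m
    proof -
      have "2 * (Suc k1 choose 2) = Suc k1 * k1" by (simp add: choose_two)
      then have "2 * real (k choose 2) = real k * real k1" unfolding Suc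
        by (metis of_nat_mult of_nat_numeral)
      then have k2: "real (k choose 2) = real k * (real k - 1) / 2" using Suc by simp
      have "real (Suc m) * real (Suc k1 choose Suc m) = real (Suc k1) * real (k1 choose m)"
        using Suc_times_binomial_eq[of k1 m] by (metis mult.commute of_nat_mult)
      then have "c m = real k * real (k1 choose m) / real (m + 1)"
        using Suc by (simp add: c_def field_simps)
      then show ?thesis by (simp add: k2)
    qed
    have "(real k - 1) / 2 * (\<Sum>m<k. c m * fps_nth (?b1 * P ^ (k - m - 1)) m) =
      (\<Sum>m<k. real (k choose 2) * (real (k1 choose m) / real (m + 1)) * fps_nth (?b1 * P ^ (k - m - 1)) m)"
      by (simp only: cc sum_distrib_left mult.assoc[symmetric])
    also have "\<dots> = real (k choose 2) * mom P q (k - 1)"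
    proof -
      have b1: "?b1 = fps_binomial (real k1 - q)" using Suc by (simp add: algebra_simps)
      show ?thesis unfolding mom_def sum_distrib_left b1
        by (rule sum.cong) (use Suc in auto)
    qed
    finally show ?thesis by simp
  qed
  have S4: "mom' P Q q k = (\<Sum>m<k. c m * fps_nth (?b * Q * P ^ (k - m - 1)) m)
      - (1 - q) / 2 * (\<Sum>m<k. c m * fps_nth (?b1 * P ^ (k - m - 1)) m)"
  proof -
    have ee: "fps_binomial (real k - q) * (Q - fps_const ((1 - q) / 2) * fps_binomial (-1)) * P ^ (k - m - 1)
      = ?b * Q * P ^ (k - m - 1) - fps_const ((1 - q) / 2) * (?b1 * P ^ (k - m - 1))" for m
    proof -
      have "?b1 = ?b * fps_binomial (-1)" by (simp add: fps_binomial_add_mult[symmetric])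
      then show ?thesis by (simp add: algebra_simps)
    qed
    show ?thesis
      unfolding mom'_def ee
      unfolding c_def fps_sub_nth fps_mult_left_const_nth right_diff_distrib sum_subtractf sum_distrib_left
      by (simp only: mult_ac)
  qed
  have "(\<Sum>m\<le>k. real (k choose m) * (1 / real (m + 1) * fps_nth (?b * Br (k - m)) m
             - real m / 2 * fps_nth (?b * P ^ (k - m)) m)) =
     (\<Sum>m\<le>k. real (k choose m) * (1 / real (m + 1) * fps_nth (?b * Br (k - m)) m)) - (\<Sum>m\<le>k. d m)"
    by (simp add: d_def sum_subtractf[symmetric] algebra_simps)
  \<comment> \<open>The multiples of the sum over \<open>?b1\<close> add up to (k - 1)/2 - (k - q)/2
    = -(1 - q)/2.\<close>
  then show ?thesis
    unfolding S1 S2 S3 S4 by (simp add: algebra_simps) (simp add: field_simps)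
qed

subsection \<open>Power series expansions and divided differences\<close>

text \<open>The remainder is the function of the series shifted by n, which is continuous at 0 with
  the n-th coefficient as its value.\<close>

lemma fps_expansion_remainder:
  fixes f :: "real \<Rightarrow> real"
  assumes "f has_fps_expansion F"
  shows "\<exists>r. (r \<longlongrightarrow> fps_nth F n) (at 0) \<and>
    eventually (\<lambda>h. f h = (\<Sum>p<n. fps_nth F p * h ^ p) + h ^ n * r h) (nhds 0)"
proof -
  have rad: "fps_conv_radius F > 0" and ev: "eventually (\<lambda>z. eval_fps F z = f z) (nhds 0)"
    using assms by (auto simp: has_fps_expansion_def)
  define r where "r = eval_fps (fps_shift n F)"
  have r: "r has_fps_expansion fps_shift n F"
    unfolding r_def by (rule eval_fps_has_fps_expansion) (simp add: rad)
  have "(\<lambda>h. (\<Sum>p<n. fps_nth F p * h ^ p) + h ^ n * r h) has_fps_expansion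
      (\<Sum>p<n. fps_const (fps_nth F p) * fps_X ^ p) + fps_X ^ n * fps_shift n F"
    by (intro fps_expansion_intros r)
  also have "(\<Sum>p<n. fps_const (fps_nth F p) * fps_X ^ p) + fps_X ^ n * fps_shift n F = F"
    by (rule fps_ext)
       (auto simp: fps_sum_nth fps_X_power_mult_nth fps_mult_fps_X_power_nonzero if_distrib
             cong: if_cong)
  finally have "eventually (\<lambda>z. eval_fps F z = (\<Sum>p<n. fps_nth F p * z ^ p) + z ^ n * r z) (nhds 0)"
    by (auto simp: has_fps_expansion_def)
  with ev have "eventually (\<lambda>h. f h = (\<Sum>p<n. fps_nth F p * h ^ p) + h ^ n * r h) (nhds 0)"
    by eventually_elim simp
  moreover have "(r \<longlongrightarrow> fps_nth F n) (at 0)"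
    using has_fps_expansion_imp_continuous[OF r, of UNIV]
    by (simp add: continuous_within r_def eval_fps_at_0)
  ultimately show ?thesis by blast
qed

text \<open>Going up from p = 0: once the lower coefficients vanish, f h / h^p tends to the p-th
  coefficient; for p < m it is also h^(m - p) times a convergent quotient and tends to 0.\<close>

lemma fps_expansion_quotient_limit:
  fixes f :: "real \<Rightarrow> real"
  assumes f: "f has_fps_expansion F" and lim: "((\<lambda>h. f h / h ^ m) \<longlongrightarrow> L) (at 0)"
  shows "\<And>p. p < m \<Longrightarrow> fps_nth F p = 0" and "fps_nth F m = L"
proof -
  have quot: "((\<lambda>h. f h / h ^ p) \<longlongrightarrow> fps_nth F p) (at 0)" if z: "\<And>j. j < p \<Longrightarrow> fps_nth F j = 0" for p
  proof -
    obtain r where r: "(r \<longlongrightarrow> fps_nth F p) (at 0)"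
      and ev: "eventually (\<lambda>h. f h = (\<Sum>j<p. fps_nth F j * h ^ j) + h ^ p * r h) (nhds 0)"
      using fps_expansion_remainder[OF f] by blast
    have "eventually (\<lambda>h. f h = (\<Sum>j<p. fps_nth F j * h ^ j) + h ^ p * r h) (at 0)"
      using ev by (simp add: eventually_nhds_conv_at)
    moreover have "eventually (\<lambda>h::real. h \<noteq> 0) (at 0)" by (simp add: eventually_at_filter)
    ultimately have "eventually (\<lambda>h. r h = f h / h ^ p) (at 0)"
      by eventually_elim (simp add: z)
    then show ?thesis using r by (rule Lim_transform_eventually[rotated])
  qed
  have low: "p < m \<Longrightarrow> fps_nth F p = 0" for p
  proof (induction p rule: less_induct)
    case (less p)
    have A: "((\<lambda>h. f h / h ^ p) \<longlongrightarrow> fps_nth F p) (at 0)" by (rule quot) (use less in auto)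
    have B: "((\<lambda>h. h ^ (m - p) * (f h / h ^ m)) \<longlongrightarrow> 0 ^ (m - p) * L) (at 0)"
      by (intro tendsto_intros lim)
    have "eventually (\<lambda>h::real. h \<noteq> 0) (at 0)" by (simp add: eventually_at_filter)
    then have "eventually (\<lambda>h. h ^ (m - p) * (f h / h ^ m) = f h / h ^ p) (at 0)"
      by eventually_elim (use less in \<open>simp add: power_diff\<close>)
    from Lim_transform_eventually[OF B this]
    have "fps_nth F p = 0 ^ (m - p) * L" using tendsto_unique[OF _ A] by simp
    then show ?case using less.prems by simp
  qed
  then show "\<And>p. p < m \<Longrightarrow> fps_nth F p = 0" .
  have "((\<lambda>h. f h / h ^ m) \<longlongrightarrow> fps_nth F m) (at 0)" by (rule quot) (use low in auto)
  from tendsto_unique[OF _ this lim] show "fps_nth F m = L" by simp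
qed

text \<open>The zero function f - f has the expansion F - G, and its quotients by powers of h tend
  to 0.\<close>

lemma fps_expansion_unique_real:
  fixes f :: "real \<Rightarrow> real"
  assumes "f has_fps_expansion F" "f has_fps_expansion G"
  shows "F = G"
proof (rule fps_ext)
  fix n
  have "(\<lambda>h. f h - f h) has_fps_expansion F - G" using assms by (intro fps_expansion_intros)
  moreover have "((\<lambda>h::real. (f h - f h) / h ^ n) \<longlongrightarrow> 0) (at 0)" by simp
  ultimately have "fps_nth (F - G) n = 0" by (rule fps_expansion_quotient_limit(2))
  then show "fps_nth F n = fps_nth G n" by simp
qed

lemma fps_expansion_cong:
  assumes "f has_fps_expansion F" "eventually (\<lambda>z. f z = g z) (nhds 0)"
  shows "g has_fps_expansion F"
proof -
  have "eventually (\<lambda>z. eval_fps F z = f z) (nhds 0)" using assms(1) by (simp add: has_fps_expansion_def)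
  with assms(2) have "eventually (\<lambda>z. eval_fps F z = g z) (nhds 0)" by eventually_elim simp
  then show ?thesis using assms(1) by (simp add: has_fps_expansion_def)
qed

lemma fps_expansion_scale:
  fixes f :: "real \<Rightarrow> real"
  assumes f: "f has_fps_expansion F"
  shows "(\<lambda>h. f (c * h)) has_fps_expansion (F oo (fps_const c * fps_X))"
proof (rule has_fps_expansionI)
  have rad: "fps_conv_radius F > 0" and ev: "eventually (\<lambda>z. eval_fps F z = f z) (nhds 0)"
    using f by (auto simp: has_fps_expansion_def)
  have lim: "filterlim (\<lambda>h. c * h) (nhds 0) (nhds (0::real))"
    by (rule tendsto_eq_intros filterlim_ident refl | simp)+
  have "eventually (\<lambda>z. z \<in> eball 0 (fps_conv_radius F)) (nhds 0)"
    using rad by (intro eventually_nhds_in_open) (auto simp: zero_ereal_def)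
  with ev have "eventually (\<lambda>z. (\<lambda>n. fps_nth F n * z ^ n) sums f z) (nhds 0)"
  proof eventually_elim
    case (elim z)
    then show ?case using sums_eval_fps[of z F] by (simp add: dist_norm)
  qed
  then have "eventually (\<lambda>h. (\<lambda>n. fps_nth F n * (c * h) ^ n) sums f (c * h)) (nhds 0)"
    using lim by (rule eventually_compose_filterlim)
  then show "eventually (\<lambda>u. (\<lambda>n. fps_nth (F oo (fps_const c * fps_X)) n * u ^ n) sums f (c * u)) (nhds 0)"
    by eventually_elim (simp add: fps_nth_compose_linear power_mult_distrib mult.assoc mult.left_commute)
qed

lemma powr_fps_expansion: "(\<lambda>h. (1 + h) powr c) has_fps_expansion fps_binomial (c::real)"
proof (rule has_fps_expansionI)
  have "eventually (\<lambda>h::real. h \<in> {-1<..<1}) (nhds 0)"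
    by (rule eventually_nhds_in_open) auto
  then show "eventually (\<lambda>u. (\<lambda>n. fps_nth (fps_binomial c) n * u ^ n) sums (1 + u) powr c) (nhds 0)"
    by eventually_elim (auto intro!: gen_binomial_real)
qed

lemma higher_deriv_fps_expansion:
  fixes f :: "real \<Rightarrow> real"
  assumes "(\<lambda>v. f (1 + v)) has_fps_expansion F"
  shows "(deriv ^^ n) f 1 = fact n * fps_nth F n"
  using assms
proof (induction n arbitrary: f F)
  case 0
  have "eventually (\<lambda>v. eval_fps F v = f (1 + v)) (nhds 0)"
    using 0 by (simp add: has_fps_expansion_def)
  then have "eval_fps F 0 = f (1 + 0)" by (rule eventually_nhds_x_imp_x)
  then show ?case by (simp add: eval_fps_at_0)
next
  case (Suc n)
  have "((\<lambda>v. f (1 + v)) has_real_derivative D) (at v) \<longleftrightarrow> (f has_real_derivative D) (at (1 + v))" for D v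
    using DERIV_shift[where f=f and x=v and z=1 and y=D] by (simp only: add.commute)
  then have "deriv (\<lambda>v. f (1 + v)) = (\<lambda>v. deriv f (1 + v))"
    by (simp add: fun_eq_iff deriv_def)
  then have "(\<lambda>v. deriv f (1 + v)) has_fps_expansion fps_deriv F"
    using has_fps_expansion_deriv[OF Suc.prems] by simp
  from Suc.IH[OF this] show ?case
    by (simp add: funpow_swap1 algebra_simps)
qed

section \<open>Divided differences and their limit at coalescing nodes\<close>

text \<open>Weight of the node \<open>x i\<close> in Newton's divided difference: the sum of
  \<open>f (x i) * dd x I i\<close> over I is the divided difference of f at the nodes of I.\<close>

definition dd :: "(nat \<Rightarrow> real) \<Rightarrow> nat set \<Rightarrow> nat \<Rightarrow> real" where
  "dd x I i = (\<Prod>l\<in>I - {i}. inverse (x i - x l))"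

lemma dd_remove:
  assumes "finite I" "inj_on x I" "a \<in> I" "i \<in> I" "i \<noteq> a"
  shows "(x i - x a) * dd x I i = dd x (I - {a}) i"
proof -
  have I: "I - {i} = insert a (I - {a} - {i})" using assms by auto
  have "x i \<noteq> x a" using assms by (auto dest: inj_onD)
  then show ?thesis unfolding dd_def I using assms(1) by simp
qed

text \<open>The factor x_i - x_a removes the node a from every weight and kills the term i = a,
  leaving a divided difference with one node fewer.\<close>

lemma dd_sum_shift:
  assumes "finite I" "inj_on x I" "a \<in> I"
  shows "(\<Sum>i\<in>I. (x i - x a) * f i * dd x I i) = (\<Sum>i\<in>I - {a}. f i * dd x (I - {a}) i)"
proof -
  have "(\<Sum>i\<in>I. (x i - x a) * f i * dd x I i) = (\<Sum>i\<in>I - {a}. (x i - x a) * f i * dd x I i)"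
    using assms by (simp add: sum.remove[of I a])
  also have "\<dots> = (\<Sum>i\<in>I - {a}. f i * dd x (I - {a}) i)"
    by (intro sum.cong refl) (use dd_remove[OF assms, symmetric] in \<open>auto simp: mult_ac\<close>)
  finally show ?thesis .
qed

text \<open>By induction, removing either of two nodes a and b gives the same value, so x_b - x_a
  times the sum of order at most m is 0; the top order then follows from a single removal.\<close>

lemma dd_power_sum:
  assumes "finite I" "inj_on x I" "card I = Suc m" "p \<le> m"
  shows "(\<Sum>i\<in>I. x i ^ p * dd x I i) = (if p = m then 1 else 0)"
  using assms
proof (induction m arbitrary: I p)
  case 0
  then obtain i where "I = {i}" by (auto simp: card_Suc_eq)
  then show ?case using 0 by (simp add: dd_def)
next
  case (Suc m)
  let ?S = "\<lambda>I p. \<Sum>i\<in>I. x i ^ p * dd x I i"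
  have IH: "?S (I - {a}) p = (if p = m then 1 else 0)" if "a \<in> I" "p \<le> m" for a p
    by (rule Suc.IH) (use Suc.prems that in \<open>auto intro: inj_on_subset\<close>)
  have step: "?S I (Suc p) - x a * ?S I p = ?S (I - {a}) p" if "a \<in> I" for a p
    using dd_sum_shift[OF Suc.prems(1,2) that, of "\<lambda>i. x i ^ p"]
    by (simp add: sum_distrib_left sum_subtractf[symmetric] algebra_simps)
  obtain a b where ab: "a \<in> I" "b \<in> I" "a \<noteq> b"
    using Suc.prems(3) by (metis card_Suc_eq insertI1 insert_iff)
  have low: "?S I p = 0" if "p \<le> m" for p
  proof -
    have "(x b - x a) * ?S I p = ?S (I - {a}) p - ?S (I - {b}) p"
      using step[OF ab(1), of p] step[OF ab(2), of p] by (simp add: algebra_simps)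
    also have "\<dots> = 0" using IH[OF ab(1) that] IH[OF ab(2) that] by simp
    finally show ?thesis using ab Suc.prems(2) by (auto dest: inj_onD)
  qed
  show ?case
  proof (cases "p = Suc m")
    case True
    have "?S I (Suc m) = x a * ?S I m + ?S (I - {a}) m" using step[OF ab(1), of m] by simp
    also have "\<dots> = 1" using low[of m] IH[OF ab(1), of m] by simp
    finally show ?thesis using True by simp
  next
    case False
    then show ?thesis using low[of p] Suc.prems(4) by simp
  qed
qed

lemma dd_scale:
  "finite I \<Longrightarrow> i \<in> I \<Longrightarrow> card I = Suc m \<Longrightarrow> dd (\<lambda>l. 1 + e * x l) I i = dd x I i / e ^ m"
proof -
  assume I: "finite I" "i \<in> I" "card I = Suc m"
  have "dd (\<lambda>l. 1 + e * x l) I i = (\<Prod>l\<in>I - {i}. inverse e * inverse (x i - x l))"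
    unfolding dd_def
    by (intro prod.cong refl) (simp add: right_diff_distrib[symmetric])
  also have "\<dots> = inverse e ^ m * dd x I i"
    using I by (simp add: prod.distrib dd_def)
  finally show ?thesis by (simp add: divide_inverse power_inverse mult.commute)
qed

text \<open>Taylor expansion at 1: the weights annihilate the degrees below m, degree m survives
  with total weight 1, and the remainder keeps a factor e.\<close>

lemma divided_difference_tendsto:
  fixes f :: "real \<Rightarrow> real"
  assumes f: "(\<lambda>h. f (1 + h)) has_fps_expansion F"
    and I: "finite I" "inj_on x I" "card I = Suc m"
  shows "((\<lambda>e. \<Sum>i\<in>I. f (1 + e * x i) * dd (\<lambda>l. 1 + e * x l) I i) \<longlongrightarrow> fps_nth F m) (at 0)"
proof -
  obtain r where r: "(r \<longlongrightarrow> fps_nth F (Suc m)) (at 0)"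
    and ev: "eventually (\<lambda>h. f (1 + h) = (\<Sum>j<Suc m. fps_nth F j * h ^ j) + h ^ Suc m * r h) (nhds 0)"
    using fps_expansion_remainder[OF f] by blast
  \<comment> \<open>A direction \<open>x i\<close> may be 0, and then the remainder is evaluated at
    0 itself for every e; so its value there has to be the limit.\<close>
  define r' where "r' h = (if h = 0 then fps_nth F (Suc m) else r h)" for h
  have r': "isCont r' 0" unfolding isCont_def r'_def
    using r by (auto simp: tendsto_def eventually_at_filter)
  have ev': "eventually (\<lambda>h. f (1 + h) = (\<Sum>j<Suc m. fps_nth F j * h ^ j) + h ^ Suc m * r' h) (nhds 0)"
    using ev by eventually_elim (auto simp: r'_def)
  have lim: "filterlim (\<lambda>e. e * c) (nhds 0) (at (0::real))" for c
    by (rule tendsto_eq_intros filterlim_ident refl | simp)+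
  have evi: "eventually (\<lambda>e. \<forall>i\<in>I. f (1 + e * x i) =
      (\<Sum>j<Suc m. fps_nth F j * (e * x i) ^ j) + (e * x i) ^ Suc m * r' (e * x i)) (at 0)"
  proof (intro eventually_ball_finite ballI I(1))
    fix i
    show "eventually (\<lambda>e. f (1 + e * x i) =
      (\<Sum>j<Suc m. fps_nth F j * (e * x i) ^ j) + (e * x i) ^ Suc m * r' (e * x i)) (at 0)"
      using eventually_compose_filterlim[OF ev' lim[of "x i"]] .
  qed
  have "eventually (\<lambda>e::real. e \<noteq> 0) (at 0)" by (simp add: eventually_at_filter)
  with evi have eq: "eventually (\<lambda>e. fps_nth F m + e * (\<Sum>i\<in>I. x i ^ Suc m * r' (e * x i) * dd x I i) =
      (\<Sum>i\<in>I. f (1 + e * x i) * dd (\<lambda>l. 1 + e * x l) I i)) (at 0)"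
  proof eventually_elim
    case (elim e)
    have "(\<Sum>i\<in>I. f (1 + e * x i) * dd (\<lambda>l. 1 + e * x l) I i) =
      (\<Sum>i\<in>I. ((\<Sum>j<Suc m. fps_nth F j * (e * x i) ^ j) + (e * x i) ^ Suc m * r' (e * x i)) * dd x I i / e ^ m)"
      using elim dd_scale[OF I(1) _ I(3)] by (intro sum.cong refl) simp
    also have "\<dots> = (\<Sum>j<Suc m. fps_nth F j * e ^ j / e ^ m * (\<Sum>i\<in>I. x i ^ j * dd x I i))
       + (\<Sum>i\<in>I. (e * x i) ^ Suc m * r' (e * x i) * dd x I i / e ^ m)"
    proof -
      have "((\<Sum>j<Suc m. fps_nth F j * (e * x i) ^ j) + (e * x i) ^ Suc m * r' (e * x i)) * dd x I i / e ^ m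
        = (\<Sum>j<Suc m. fps_nth F j * e ^ j / e ^ m * (x i ^ j * dd x I i))
          + (e * x i) ^ Suc m * r' (e * x i) * dd x I i / e ^ m" for i
        unfolding add_divide_distrib distrib_right sum_distrib_right sum_divide_distrib
        by (simp only: power_mult_distrib divide_inverse mult_ac)
      then show ?thesis
        by (simp only: sum.distrib sum_distrib_left) (simp only: sum.swap[of _ "{..<Suc m}" I])
    qed
    also have "(\<Sum>j<Suc m. fps_nth F j * e ^ j / e ^ m * (\<Sum>i\<in>I. x i ^ j * dd x I i)) =
       (\<Sum>j<Suc m. fps_nth F j * e ^ j / e ^ m * (if j = m then 1 else 0))"
      by (intro sum.cong refl) (use dd_power_sum[OF I] in auto)
    also have "\<dots> = fps_nth F m" using elim by (simp add: if_distrib cong: if_cong)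
    also have "(\<Sum>i\<in>I. (e * x i) ^ Suc m * r' (e * x i) * dd x I i / e ^ m) =
       e * (\<Sum>i\<in>I. x i ^ Suc m * r' (e * x i) * dd x I i)"
      using elim by (simp add: sum_distrib_left power_mult_distrib mult_ac)
    finally show ?case by simp
  qed
  have "((\<lambda>e. fps_nth F m + e * (\<Sum>i\<in>I. x i ^ Suc m * r' (e * x i) * dd x I i)) \<longlongrightarrow>
      fps_nth F m + 0 * (\<Sum>i\<in>I. x i ^ Suc m * r' 0 * dd x I i)) (at 0)"
    by (intro tendsto_intros isCont_tendsto_compose[OF r'] lim)
  then show ?thesis using eq by (simp add: Lim_transform_eventually)
qed

subsection \<open>Determinants\<close>

text \<open>Conjugation by \<open>Suc\<close> carries the permutations of {0..<N} to those of {1..N}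
  and preserves signs; this gives access to the theory of \<open>Determinant.det\<close>.\<close>

lemma detN_eq_det:
  "detN N M = Determinant.det (mat N N (\<lambda>(i, j). M (Suc i) (Suc j)))"
proof -
  let ?A = "{0..<N}" and ?B = "{1..N}"
  have inj: "inj_on Suc ?A" and im: "Suc ` ?A = ?B" by (auto simp: image_Suc_atLeastLessThan)
  have bij: "bij_betw Suc ?A ?B" using inj im by (simp add: bij_betw_def)
  have bp: "bij_betw (map_permutation ?A Suc) {p. p permutes ?A} {p. p permutes ?B}"
    by (rule iffD1[OF bij_betw_cong bij_betw_permutations[OF bij]])
       (auto simp: map_permutation_def restrict_id_def fun_eq_iff im[symmetric])
  have "detN N M = (\<Sum>p | p permutes ?A. of_int (sign (map_permutation ?A Suc p)) *
      (\<Prod>i\<in>?B. M i (map_permutation ?A Suc p i)))"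
    unfolding detN_def by (rule sum.reindex_bij_betw[OF bp, symmetric])
  also have "\<dots> = (\<Sum>p | p permutes ?A. of_int (sign p) * (\<Prod>i = 0..<N. M (Suc i) (Suc (p i))))"
  proof (intro sum.cong refl)
    fix p assume "p \<in> {p. p permutes ?A}"
    then have p: "p permutes ?A" by simp
    have "(\<Prod>i\<in>?B. M i (map_permutation ?A Suc p i)) = (\<Prod>i\<in>?A. M (Suc i) (map_permutation ?A Suc p (Suc i)))"
      unfolding im[symmetric] by (rule prod.reindex_cong[OF inj refl refl])
    also have "\<dots> = (\<Prod>i = 0..<N. M (Suc i) (Suc (p i)))"
      by (intro prod.cong refl) (simp add: map_permutation_apply[OF inj] )
    finally show "of_int (sign (map_permutation ?A Suc p)) * (\<Prod>i\<in>?B. M i (map_permutation ?A Suc p i)) =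
      of_int (sign p) * (\<Prod>i = 0..<N. M (Suc i) (Suc (p i)))"
      using sign_map_permutation[OF inj p] by simp
  qed
  also have "\<dots> = Determinant.det (mat N N (\<lambda>(i, j). M (Suc i) (Suc j)))"
  proof (subst det_def'[of _ N])
    show "(\<Sum>p | p permutes ?A. of_int (sign p) * (\<Prod>i = 0..<N. M (Suc i) (Suc (p i)))) =
      (\<Sum>p | p permutes ?A. of_int (sign p) * (\<Prod>i = 0..<N. mat N N (\<lambda>(i, j). M (Suc i) (Suc j)) $$ (i, p i)))"
    proof (intro sum.cong refl)
      fix p assume "p \<in> {p. p permutes ?A}"
      then have "p i < N" if "i < N" for i using permutes_in_image[of p ?A i] that by simp
      then show "of_int (sign p) * (\<Prod>i = 0..<N. M (Suc i) (Suc (p i))) =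
        of_int (sign p) * (\<Prod>i = 0..<N. mat N N (\<lambda>(i, j). M (Suc i) (Suc j)) $$ (i, p i))" by simp
    qed
  qed simp
  finally show ?thesis .
qed

lemma detN_cong: "(\<And>i j. i \<in> {1..N} \<Longrightarrow> j \<in> {1..N} \<Longrightarrow> A i j = B i j) \<Longrightarrow> detN N A = detN N B"
  unfolding detN_def
proof (intro sum.cong refl)
  fix p assume "p \<in> {p. p permutes {1..N}}"
    and AB: "\<And>i j. i \<in> {1..N} \<Longrightarrow> j \<in> {1..N} \<Longrightarrow> A i j = B i j"
  then have "p i \<in> {1..N}" if "i \<in> {1..N}" for i using permutes_in_image[of p "{1..N}" i] that by blast
  then have "(\<Prod>i\<in>{1..N}. A i (p i)) = (\<Prod>i\<in>{1..N}. B i (p i))" by (intro prod.cong refl AB)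
  then show "of_int (sign p) * (\<Prod>i\<in>{1..N}. A i (p i)) = of_int (sign p) * (\<Prod>i\<in>{1..N}. B i (p i))" by simp
qed

lemma detN_mult: "detN N (\<lambda>i j. \<Sum>k\<in>{1..N}. A i k * B k j) = detN N A * detN N B"
proof -
  have im: "Suc ` {0..<N} = {1..N}" by (auto simp: image_Suc_atLeastLessThan)
  have S: "(\<Sum>k\<in>{Suc 0..N}. f k) = (\<Sum>k = 0..<N. f (Suc k))" for f :: "nat \<Rightarrow> real"
    using sum.reindex[of Suc "{0..<N}" f] by (simp add: image_Suc_atLeastLessThan atLeastLessThanSuc_atLeastAtMost)
  have "mat N N (\<lambda>(i, j). \<Sum>k\<in>{1..N}. A (Suc i) k * B k (Suc j)) =
     mat N N (\<lambda>(i, j). A (Suc i) (Suc j)) * mat N N (\<lambda>(i, j). B (Suc i) (Suc j))"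
    by (rule eq_matI) (auto simp: S scalar_prod_def)
  then show ?thesis
    unfolding detN_eq_det by (simp add: det_mult[of _ N])
qed

lemma prod_list_diag_detN:
  "prod_list (diag_mat (mat N N (\<lambda>(i, j). M (Suc i) (Suc j)))) = (\<Prod>i\<in>{1..N}. M i i :: real)"
proof -
  have im: "Suc ` {0..<N} = {1..N}" by (auto simp: image_Suc_atLeastLessThan)
  show ?thesis unfolding im[symmetric]
    by (subst prod.reindex) (auto simp: prod_list_diag_prod)
qed

lemma detN_lower_triangular:
  assumes "\<And>i j. i \<in> {1..N} \<Longrightarrow> j \<in> {1..N} \<Longrightarrow> i < j \<Longrightarrow> M i j = 0"
  shows "detN N M = (\<Prod>i\<in>{1..N}. M i i)"
proof -
  have "Determinant.det (mat N N (\<lambda>(i, j). M (Suc i) (Suc j))) = prod_list (diag_mat (mat N N (\<lambda>(i, j). M (Suc i) (Suc j))))"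
    by (rule det_lower_triangular[of N]) (use assms in auto)
  then show ?thesis unfolding detN_eq_det using prod_list_diag_detN[of N M] by (rule trans)
qed

lemma detN_upper_triangular:
  assumes "\<And>i j. i \<in> {1..N} \<Longrightarrow> j \<in> {1..N} \<Longrightarrow> j < i \<Longrightarrow> M i j = 0"
  shows "detN N M = (\<Prod>i\<in>{1..N}. M i i)"
proof -
  have "Determinant.det (mat N N (\<lambda>(i, j). M (Suc i) (Suc j))) = prod_list (diag_mat (mat N N (\<lambda>(i, j). M (Suc i) (Suc j))))"
    by (rule det_upper_triangular[of _ N]) (use assms in \<open>auto intro!: upper_triangularI\<close>)
  then show ?thesis unfolding detN_eq_det using prod_list_diag_detN[of N M] by (rule trans)
qed

lemma detN_transpose: "detN N (\<lambda>i j. M j i) = detN N M"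
proof -
  have "mat N N (\<lambda>(i, j). M (Suc j) (Suc i)) = transpose_mat (mat N N (\<lambda>(i, j). M (Suc i) (Suc j)))"
    by (rule eq_matI) auto
  then show ?thesis unfolding detN_eq_det using det_transpose[of "mat N N (\<lambda>(i, j). M (Suc i) (Suc j))" N] by simp
qed

lemma detN_permute_rows:
  assumes "p permutes {1..N}"
  shows "detN N (\<lambda>i j. M (p i) j) = of_int (sign p) * detN N M"
proof -
  have fin: "finite {1..N}" by simp
  have pp: "permutation p" using assms by (auto simp: permutation_permutes)
  have "detN N M = (\<Sum>r | r permutes {1..N}. of_int (sign (r \<circ> inv_into UNIV p)) * (\<Prod>i\<in>{1..N}. M i ((r \<circ> inv_into UNIV p) i)))"
    unfolding detN_def by (rule sum_permutations_compose_right[OF permutes_inv[OF assms]])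
  also have "\<dots> = (\<Sum>r | r permutes {1..N}. of_int (sign p) * (of_int (sign r) * (\<Prod>i\<in>{1..N}. M (p i) (r i))))"
  proof (intro sum.cong refl)
    fix r assume "r \<in> {r. r permutes {1..N}}"
    then have r: "r permutes {1..N}" by simp
    have pr: "permutation r" using r by (auto simp: permutation_permutes)
    have "sign (r \<circ> inv_into UNIV p) = sign r * sign p"
      using sign_compose[OF pr permutation_inverse[OF pp]] sign_inverse[OF pp] by simp
    moreover have "(\<Prod>i\<in>{1..N}. M i ((r \<circ> inv_into UNIV p) i)) = (\<Prod>i\<in>{1..N}. M (p i) ((r \<circ> inv_into UNIV p) (p i)))"
      using prod.permute[OF assms, of "\<lambda>i. M i ((r \<circ> inv_into UNIV p) i)"] by (simp add: comp_def)
    ultimately show "of_int (sign (r \<circ> inv_into UNIV p)) * (\<Prod>i\<in>{1..N}. M i ((r \<circ> inv_into UNIV p) i)) =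
      of_int (sign p) * (of_int (sign r) * (\<Prod>i\<in>{1..N}. M (p i) (r i)))"
      using permutes_inverses(2)[OF assms] by simp
  qed
  also have "\<dots> = of_int (sign p) * detN N (\<lambda>i j. M (p i) j)"
    by (simp add: detN_def sum_distrib_left)
  finally have "of_int (sign p) * detN N M = of_int (sign p) * of_int (sign p) * detN N (\<lambda>i j. M (p i) j)" by simp
  moreover have "of_int (sign p) * of_int (sign p) = (1::real)" by (simp add: sign_def)
  ultimately show ?thesis by simp
qed

lemma detN_identical_columns:
  assumes "a \<in> {1..N}" "b \<in> {1..N}" "a \<noteq> b" "\<And>i. i \<in> {1..N} \<Longrightarrow> M i a = M i b"
  shows "detN N M = 0"
proof -
  let ?p = "Transposition.transpose a b"
  have p: "?p permutes {1..N}" using assms by (intro permutes_swap_id)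
  have "M i j = M i (?p j)" if "i \<in> {1..N}" for i j
    using assms(4)[OF that] by (cases "j = a"; cases "j = b") (simp_all add: transpose_apply_other)
  then have "detN N M = detN N (\<lambda>i j. M i (?p j))" by (intro detN_cong)
  also have "\<dots> = detN N (\<lambda>i j. M j (?p i))" by (rule detN_transpose[symmetric])
  also have "\<dots> = of_int (sign ?p) * detN N (\<lambda>i j. M j i)" by (rule detN_permute_rows[OF p, of "\<lambda>i j. M j i"])
  also have "\<dots> = - detN N M" using assms(3) detN_transpose[of N M] by (simp add: sign_swap_id)
  finally show ?thesis by simp
qed

lemma detN_last_row:
  assumes "\<And>j. j \<in> {1..N} \<Longrightarrow> M (Suc N) j = 0"
  shows "detN (Suc N) M = M (Suc N) (Suc N) * detN N M"
proof -
  let ?A = "mat (Suc N) (Suc N) (\<lambda>(i, j). M (Suc i) (Suc j))"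
  have "Determinant.det ?A = (\<Sum>j<Suc N. ?A $$ (N, j) * cofactor ?A N j)"
    by (rule laplace_expansion_row[of _ "Suc N"]) auto
  also have "\<dots> = ?A $$ (N, N) * cofactor ?A N N" using assms by simp
  also have "mat_delete ?A N N = mat N N (\<lambda>(i, j). M (Suc i) (Suc j))"
    by (rule eq_matI) (auto simp: mat_delete_def)
  then have "cofactor ?A N N = detN N M" by (simp add: cofactor_def detN_eq_det)
  finally show ?thesis by (simp add: detN_eq_det)
qed

lemma detN_scale_rows: "detN N (\<lambda>i j. c i * M i j) = (\<Prod>i\<in>{1..N}. c i) * detN N M"
  by (simp add: detN_def prod.distrib sum_distrib_left mult_ac)

lemma detN_sum_columns:
  assumes "\<And>j. j \<in> {1..N} \<Longrightarrow> finite (R j)"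
  shows "detN N (\<lambda>i j. \<Sum>a\<in>R j. f i j a) = (\<Sum>a\<in>Pi\<^sub>E {1..N} R. detN N (\<lambda>i j. f i j (a j)))"
proof -
  have "(\<Prod>i\<in>{1..N}. \<Sum>a\<in>R (p i). f i (p i) a) = (\<Sum>a\<in>Pi\<^sub>E {1..N} R. \<Prod>i\<in>{1..N}. f i (p i) (a (p i)))"
    if p: "p permutes {1..N}" for p
  proof -
    have "(\<Prod>i\<in>{1..N}. \<Sum>a\<in>R (p i). f i (p i) a) = (\<Prod>j\<in>{1..N}. \<Sum>a\<in>R j. f (inv_into UNIV p j) j a)"
      using prod.permute[OF p, of "\<lambda>j. \<Sum>a\<in>R j. f (inv_into UNIV p j) j a"] permutes_inverses(2)[OF p] by (simp add: comp_def)
    also have "\<dots> = (\<Sum>a\<in>Pi\<^sub>E {1..N} R. \<Prod>j\<in>{1..N}. f (inv_into UNIV p j) j (a j))"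
      by (rule prod_sum_PiE) (use assms in auto)
    also have "\<dots> = (\<Sum>a\<in>Pi\<^sub>E {1..N} R. \<Prod>i\<in>{1..N}. f i (p i) (a (p i)))"
    proof (intro sum.cong refl)
      fix a
      show "(\<Prod>j\<in>{1..N}. f (inv_into UNIV p j) j (a j)) = (\<Prod>i\<in>{1..N}. f i (p i) (a (p i)))"
        using prod.permute[OF p, of "\<lambda>j. f (inv_into UNIV p j) j (a j)"] permutes_inverses(2)[OF p]
        by (simp add: comp_def)
    qed
    finally show ?thesis .
  qed
  then have "detN N (\<lambda>i j. \<Sum>a\<in>R j. f i j a) =
     (\<Sum>p | p permutes {1..N}. \<Sum>a\<in>Pi\<^sub>E {1..N} R. of_int (sign p) * (\<Prod>i\<in>{1..N}. f i (p i) (a (p i))))"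
    unfolding detN_def by (intro sum.cong refl) (simp add: sum_distrib_left)
  also have "\<dots> = (\<Sum>a\<in>Pi\<^sub>E {1..N} R. detN N (\<lambda>i j. f i j (a j)))"
    unfolding detN_def by (rule sum.swap)
  finally show ?thesis .
qed

text \<open>In the Leibniz sum both sides replace one factor of each product, indexed by its row or
  by its column. An operator on exponents (columns) can thus be read as one on variables
  (rows).\<close>

lemma sum_detN_rows_eq_sum_detN_columns:
  "(\<Sum>i\<in>{1..N}. detN N (\<lambda>a j. if a = i then B a j else M a j)) =
   (\<Sum>c\<in>{1..N}. detN N (\<lambda>a j. if j = c then B a j else M a j))"
proof -
  have "(\<Sum>i\<in>{1..N}. detN N (\<lambda>a j. if a = i then B a j else M a j)) =
    (\<Sum>p | p permutes {1..N}. of_int (sign p) * (\<Sum>i\<in>{1..N}. \<Prod>a\<in>{1..N}. if a = i then B a (p a) else M a (p a)))"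
    unfolding detN_def by (subst sum.swap) (simp add: sum_distrib_left)
  also have "\<dots> = (\<Sum>p | p permutes {1..N}. of_int (sign p) * (\<Sum>c\<in>{1..N}. \<Prod>a\<in>{1..N}. if p a = c then B a (p a) else M a (p a)))"
  proof (rule sum.cong[OF refl], rule arg_cong2[where f = times, OF refl])
    fix p assume "p \<in> {p. p permutes {1..N}}"
    then have p: "p permutes {1..N}" by simp
    have "(\<Sum>c\<in>{1..N}. \<Prod>a\<in>{1..N}. if p a = c then B a (p a) else M a (p a)) =
       (\<Sum>i\<in>{1..N}. \<Prod>a\<in>{1..N}. if p a = p i then B a (p a) else M a (p a))"
      using sum.permute[OF p, of "\<lambda>c. \<Prod>a\<in>{1..N}. if p a = c then B a (p a) else M a (p a)"] by (simp add: comp_def)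
    also have "\<dots> = (\<Sum>i\<in>{1..N}. \<Prod>a\<in>{1..N}. if a = i then B a (p a) else M a (p a))"
      using permutes_inj[OF p] by (simp add: inj_eq)
    finally show "(\<Sum>i\<in>{1..N}. \<Prod>a\<in>{1..N}. if a = i then B a (p a) else M a (p a)) =
       (\<Sum>c\<in>{1..N}. \<Prod>a\<in>{1..N}. if p a = c then B a (p a) else M a (p a))" by simp
  qed
  also have "\<dots> = (\<Sum>c\<in>{1..N}. detN N (\<lambda>a j. if j = c then B a j else M a j))"
    unfolding detN_def by (subst sum.swap) (simp add: sum_distrib_left)
  finally show ?thesis .
qed

lemma tendsto_detN:
  assumes "\<And>i j. i \<in> {1..N} \<Longrightarrow> j \<in> {1..N} \<Longrightarrow> ((\<lambda>e. M e i j) \<longlongrightarrow> L i j) F"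
  shows "((\<lambda>e. detN N (M e)) \<longlongrightarrow> detN N L) F"
  unfolding detN_def
proof (intro tendsto_sum tendsto_mult tendsto_const tendsto_prod)
  fix p i assume "p \<in> {p. p permutes {1..N}}" "i \<in> {1..N}"
  then have "p i \<in> {1..N}" using permutes_in_image[of p "{1..N}" i] by blast
  with \<open>i \<in> {1..N}\<close> show "((\<lambda>e. M e i (p i)) \<longlongrightarrow> L i (p i)) F" by (rule assms)
qed

section \<open>The Vandermonde product\<close>

definition vdm :: "nat \<Rightarrow> (nat \<Rightarrow> real) \<Rightarrow> real" where
  "vdm N u = (\<Prod>i\<in>{1..N}. \<Prod>l\<in>{1..<i}. (u i - u l))"

text \<open>The index i contributes i - 1 factors to \<open>vdm\<close>, each of the opposite
  sign.\<close>

lemma vdm_sign: "(\<Prod>i\<in>{1..N}. \<Prod>j\<in>{i<..N}. (u i - u j)) = (\<Prod>i\<in>{1..N}. (-1) ^ (i - 1)) * vdm N u"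
proof -
  have "(\<Prod>i\<in>{1..N}. \<Prod>j\<in>{i<..N}. (u i - u j)) = (\<Prod>(i,j)\<in>Sigma {1..N} (\<lambda>i. {i<..N}). u i - u j)"
    by (subst prod.Sigma) auto
  also have "\<dots> = (\<Prod>(j,i)\<in>Sigma {1..N} (\<lambda>j. {1..<j}). u i - u j)"
    by (rule prod.reindex_bij_witness[where i = prod.swap and j = prod.swap]) auto
  also have "\<dots> = (\<Prod>j\<in>{1..N}. \<Prod>i\<in>{1..<j}. (u i - u j))"
    by (subst prod.Sigma) auto
  also have "\<dots> = (\<Prod>j\<in>{1..N}. \<Prod>i\<in>{1..<j}. (-1) * (u j - u i))"
    by simp
  also have "\<dots> = (\<Prod>i\<in>{1..N}. (-1) ^ (i - 1)) * vdm N u"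
    unfolding prod.distrib vdm_def by simp
  finally show ?thesis .
qed

lemma vdm_nonzero: "inj_on u {1..N} \<Longrightarrow> vdm N u \<noteq> 0"
proof -
  assume inj: "inj_on u {1..N}"
  have "u i - u l \<noteq> 0" if "i \<in> {1..N}" "l \<in> {1..<i}" for i l
    using inj_onD[OF inj, of i l] that by auto
  then have "(\<Prod>l\<in>{1..<i}. u i - u l) \<noteq> 0" if "i \<in> {1..N}" for i
    using that by (subst prod_zero_iff) blast+
  then show ?thesis unfolding vdm_def by (subst prod_zero_iff) blast+
qed

lemma vdm_Suc: "vdm (Suc N) u = vdm N u * (\<Prod>l\<in>{1..N}. (u (Suc N) - u l))"
  by (simp add: vdm_def atLeastLessThanSuc_atLeastAtMost)

text \<open>C depends on u and j but not on y. Quotients of Vandermonde products that differ in one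
  entry therefore reduce to a single product.\<close>

lemma vdm_upd: "j \<in> {1..N} \<Longrightarrow> \<exists>C. \<forall>y. vdm N (u(j := y)) = C * (\<Prod>l\<in>{1..N} - {j}. (y - u l))"
proof (induction N)
  case (Suc N)
  show ?case
  proof (cases "j = Suc N")
    case True
    have "vdm N (u(j := y)) = vdm N u" for y
      unfolding vdm_def using True by (intro prod.cong refl) auto
    moreover have "(\<Prod>l\<in>{1..N}. (u(j := y)) (Suc N) - (u(j := y)) l) = (\<Prod>l\<in>{1..Suc N} - {j}. (y - u l))" for y
      using True by (intro prod.cong) auto
    ultimately show ?thesis by (intro exI[of _ "vdm N u"] allI) (simp only: vdm_Suc)
  next
    case False
    then have j: "j \<in> {1..N}" using Suc.prems by auto
    from Suc.IH[OF this] obtain C where C: "\<And>y. vdm N (u(j := y)) = C * (\<Prod>l\<in>{1..N} - {j}. (y - u l))" by blast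
    have P1: "(\<Prod>l\<in>{1..N}. (u(j := y)) (Suc N) - (u(j := y)) l) = - (y - u (Suc N)) * (\<Prod>l\<in>{1..N} - {j}. u (Suc N) - u l)" for y
      using j False by (subst prod.remove[of _ j]) (auto intro!: prod.cong)
    have P2: "(\<Prod>l\<in>{1..Suc N} - {j}. (y - u l)) = (y - u (Suc N)) * (\<Prod>l\<in>{1..N} - {j}. (y - u l))" for y
    proof -
      have "{1..Suc N} - {j} = insert (Suc N) ({1..N} - {j})" using j by auto
      then show ?thesis by simp
    qed
    show ?thesis
    proof (intro exI allI)
      fix y
      show "vdm (Suc N) (u(j := y)) = - C * (\<Prod>l\<in>{1..N} - {j}. u (Suc N) - u l) * (\<Prod>l\<in>{1..Suc N} - {j}. (y - u l))"
      proof -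
        have "C * P * (- a * Q) = - C * Q * (a * P)" for C P Q a :: real by simp
        then show ?thesis unfolding vdm_Suc C P1 P2 .
      qed
    qed
  qed
qed simp

subsection \<open>Schur functions as positive combinations of monomials\<close>

lemma sum_list_map_concat:
  "sum_list (map f (concat xss)) = (\<Sum>xs\<leftarrow>xss. sum_list (map f xs) :: real)"
  by (induction xss) auto

lemma power_int_sum:
  "finite S \<Longrightarrow> z \<noteq> 0 \<Longrightarrow> (z::real) powi (\<Sum>j\<in>S. f j) = (\<Prod>j\<in>S. z powi f j)"
  by (induction S rule: finite_induct) (auto simp: power_int_add)

text \<open>A geometric sum with possibly negative exponents; it supplies the factor u - z that each
  row of the reduced alternant gives off.\<close>

lemma power_int_diff_geometric:
  fixes u z :: real and a b :: int
  assumes "u \<noteq> 0" "z \<noteq> 0" "b \<le> a"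
  shows "u powi a - z powi (a - b) * u powi b = (u - z) * (\<Sum>c\<in>{b..<a}. u powi c * z powi (a - 1 - c))"
proof -
  have "u powi (b + int n) - z powi (int n) * u powi b =
     (u - z) * (\<Sum>c\<in>{b..<b + int n}. u powi c * z powi (b + int n - 1 - c))" for n
  proof (induction n)
    case (Suc n)
    define a where "a = b + int n"
    have I: "{b..<b + int (Suc n)} = insert a {b..<a}" by (auto simp: a_def)
    have z1: "z powi (b + int (Suc n) - 1 - c) = z * z powi (a - 1 - c)" for c
    proof -
      have eq: "b + int (Suc n) - 1 - c = 1 + (a - 1 - c)" by (simp add: a_def)
      show ?thesis unfolding eq by (subst power_int_add) (use assms(2) in simp_all)
    qed
    have u1: "u powi (b + int (Suc n)) = u * u powi a"
    proof -
      have eq: "b + int (Suc n) = 1 + a" by (simp add: a_def)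
      show ?thesis unfolding eq by (subst power_int_add) (use assms(1) in simp_all)
    qed
    have z2: "z powi int (Suc n) = z * z powi int n" by (simp add: power_int_add)
    have z3: "z * z powi (a - 1 - a) = 1" using assms(2) by (simp add: power_int_minus)
    have "(u - z) * (\<Sum>c\<in>{b..<b + int (Suc n)}. u powi c * z powi (b + int (Suc n) - 1 - c)) =
       (u - z) * (u powi a * (z * z powi (a - 1 - a)) + (\<Sum>c\<in>{b..<a}. u powi c * (z * z powi (a - 1 - c))))"
      unfolding I z1 by simp
    also have "(\<Sum>c\<in>{b..<a}. u powi c * (z * z powi (a - 1 - c))) = z * (\<Sum>c\<in>{b..<a}. u powi c * z powi (a - 1 - c))"
      by (simp add: sum_distrib_left mult_ac)
    also have "(u - z) * (u powi a * (z * z powi (a - 1 - a)) + z * (\<Sum>c\<in>{b..<a}. u powi c * z powi (a - 1 - c))) =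
       (u - z) * u powi a + z * ((u - z) * (\<Sum>c\<in>{b..<a}. u powi c * z powi (a - 1 - c)))"
      unfolding z3 by (simp add: algebra_simps)
    also have "(u - z) * (\<Sum>c\<in>{b..<a}. u powi c * z powi (a - 1 - c)) = u powi a - z powi (int n) * u powi b"
      using Suc.IH unfolding a_def by simp
    also have "(u - z) * u powi a + z * (u powi a - z powi (int n) * u powi b) =
       u powi (b + int (Suc n)) - z powi int (Suc n) * u powi b"
      unfolding u1 z2 by (simp add: algebra_simps)
    finally show ?case by simp
  qed simp
  from this[of "nat (a - b)"] assms(3) show ?thesis by simp
qed

text \<open>The branching rule, proved by column operations that clear the last row.\<close>

lemma schur_monomial_list:
  assumes "\<And>i j. 1 \<le> i \<Longrightarrow> i < j \<Longrightarrow> j \<le> N \<Longrightarrow> lam j < (lam i :: int)"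
  shows "\<exists>W :: (nat \<Rightarrow> int) list. \<forall>u :: nat \<Rightarrow> real. (\<forall>i\<in>{1..N}. u i \<noteq> 0) \<longrightarrow>
    detN N (\<lambda>i j. u i powi lam j) =
      (\<Prod>i\<in>{1..N}. \<Prod>j\<in>{i<..N}. (u i - u j)) * (\<Sum>\<mu>\<leftarrow>W. \<Prod>i\<in>{1..N}. u i powi \<mu> i)"
  using assms
proof (induction N arbitrary: lam)
  case 0
  have "detN 0 M = 1" for M using detN_upper_triangular[of 0 M] by simp
  then show ?case by (intro exI[of _ "[\<lambda>_. 0]"]) simp
next
  case (Suc N)
  \<comment> \<open>The interlacing condition: the new exponent of column j lies between two
    consecutive old ones. Half-open intervals keep the chosen exponents strictly decreasing.\<close>
  define R where "R j = {lam (Suc j)..<lam j}" for j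
  define A where "A = Pi\<^sub>E {1..N} R"
  have finA: "finite A" unfolding A_def R_def by (intro finite_PiE) auto
  have dec: "a j < a i" if "a \<in> A" "1 \<le> i" "i < j" "j \<le> N" for a i j
  proof -
    have "a j < lam j" "lam (Suc i) \<le> a i" using that by (auto simp: A_def R_def PiE_iff)
    moreover have "lam j \<le> lam (Suc i)"
      using Suc.prems[of "Suc i" j] that by (cases "Suc i = j") auto
    ultimately show ?thesis by linarith
  qed
  have "\<forall>a\<in>A. \<exists>W :: (nat \<Rightarrow> int) list. \<forall>u :: nat \<Rightarrow> real. (\<forall>i\<in>{1..N}. u i \<noteq> 0) \<longrightarrow>
    detN N (\<lambda>i j. u i powi a j) =
      (\<Prod>i\<in>{1..N}. \<Prod>j\<in>{i<..N}. (u i - u j)) * (\<Sum>\<mu>\<leftarrow>W. \<Prod>i\<in>{1..N}. u i powi \<mu> i)"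
    using Suc.IH dec by blast
  then obtain Wf :: "(nat \<Rightarrow> int) \<Rightarrow> (nat \<Rightarrow> int) list" where Wf: "\<And>a u. a \<in> A \<Longrightarrow> (\<forall>i\<in>{1..N}. u i \<noteq> 0) \<Longrightarrow>
    detN N (\<lambda>i j. u i powi a j) =
      (\<Prod>i\<in>{1..N}. \<Prod>j\<in>{i<..N}. (u i - u j)) * (\<Sum>\<mu>\<leftarrow>Wf a. \<Prod>i\<in>{1..N}. u i powi \<mu> i)"
    by (subst (asm) bchoice_iff) blast
  obtain xs where xs: "set xs = A" "distinct xs" using finite_distinct_list[OF finA] by blast
  \<comment> \<open>Exponent of the last variable: the old last exponent plus the powers of z left
    over by the geometric sums.\<close>
  define e where "e a = lam (Suc N) + (\<Sum>j\<in>{1..N}. lam j - 1 - a j)" for a :: "nat \<Rightarrow> int"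
  define W where "W = concat (map (\<lambda>a. map (\<lambda>\<mu>. \<mu>(Suc N := e a)) (Wf a)) xs)"
  show ?case
  proof (intro exI allI impI)
    fix u :: "nat \<Rightarrow> real"
    assume u: "\<forall>i\<in>{1..Suc N}. u i \<noteq> 0"
    define z where "z = u (Suc N)"
    have z: "z \<noteq> 0" using u by (simp add: z_def)
    define D where "D = (\<Prod>i\<in>{1..N}. \<Prod>j\<in>{i<..N}. (u i - u j))"
    \<comment> \<open>Column j minus a multiple of column j + 1; the power of z is chosen so that
      the entry in the last row, where the variable is z, becomes 0.\<close>
    define E where "E k j = (if k = j then 1 else if k = Suc j then - (z powi (lam j - lam k)) else 0)" for k j
    define M where "M i j = (\<Sum>k\<in>{1..Suc N}. u i powi lam k * E k j)" for i j
    have detE: "detN (Suc N) E = 1"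
      by (subst detN_lower_triangular) (auto simp: E_def)
    have "detN (Suc N) M = detN (Suc N) (\<lambda>i j. u i powi lam j)"
      unfolding M_def detN_mult detE by simp
    have Mj: "M i j = u i powi lam j - z powi (lam j - lam (Suc j)) * u i powi lam (Suc j)" if "j \<in> {1..N}" for i j
    proof -
      have "M i j = (\<Sum>k\<in>{j, Suc j}. u i powi lam k * E k j)" unfolding M_def
        by (rule sum.mono_neutral_right) (use that in \<open>auto simp: E_def\<close>)
      then show ?thesis by (simp add: E_def mult.commute)
    qed
    have Mlast: "M i (Suc N) = u i powi lam (Suc N)" for i
    proof -
      have "M i (Suc N) = (\<Sum>k\<in>{Suc N}. u i powi lam k * E k (Suc N))" unfolding M_def
        by (rule sum.mono_neutral_right) (auto simp: E_def)
      then show ?thesis by (simp add: E_def)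
    qed
    have M0: "M (Suc N) j = 0" if "j \<in> {1..N}" for j
      unfolding Mj[OF that] z_def[symmetric] using z by (simp add: power_int_add[symmetric])
    have MN: "M i j = (u i - z) * (\<Sum>a\<in>R j. u i powi a * z powi (lam j - 1 - a))" if "i \<in> {1..N}" "j \<in> {1..N}" for i j
      unfolding Mj[OF that(2)] R_def
      by (rule power_int_diff_geometric) (use that u z Suc.prems[of j "Suc j"] in auto)
    have "detN (Suc N) (\<lambda>i j. u i powi lam j) = z powi lam (Suc N) * detN N M"
      using detN_last_row[of N M, OF M0] \<open>detN (Suc N) M = _\<close> Mlast by (simp add: z_def)
    also have "detN N M = detN N (\<lambda>i j. (u i - z) * (\<Sum>a\<in>R j. u i powi a * z powi (lam j - 1 - a)))"
      by (rule detN_cong) (rule MN)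
    also have "\<dots> = (\<Prod>i\<in>{1..N}. u i - z) * (\<Sum>a\<in>A. detN N (\<lambda>i j. u i powi a j * z powi (lam j - 1 - a j)))"
      unfolding detN_scale_rows A_def by (subst detN_sum_columns) (auto simp: R_def)
    also have "(\<Sum>a\<in>A. detN N (\<lambda>i j. u i powi a j * z powi (lam j - 1 - a j))) =
       (\<Sum>a\<in>A. (\<Prod>j\<in>{1..N}. z powi (lam j - 1 - a j)) * (D * (\<Sum>\<mu>\<leftarrow>Wf a. \<Prod>i\<in>{1..N}. u i powi \<mu> i)))"
    proof (rule sum.cong[OF refl])
      fix a assume a: "a \<in> A"
      have "detN N (\<lambda>i j. u i powi a j * z powi (lam j - 1 - a j)) =
        detN N (\<lambda>j i. z powi (lam j - 1 - a j) * u i powi a j)"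
        by (subst detN_transpose[symmetric]) (simp add: mult.commute)
      also have "\<dots> = (\<Prod>j\<in>{1..N}. z powi (lam j - 1 - a j)) * detN N (\<lambda>j i. u i powi a j)"
        by (rule detN_scale_rows)
      also have "detN N (\<lambda>j i. u i powi a j) = detN N (\<lambda>i j. u i powi a j)"
        by (rule detN_transpose)
      also have "\<dots> = D * (\<Sum>\<mu>\<leftarrow>Wf a. \<Prod>i\<in>{1..N}. u i powi \<mu> i)"
        unfolding D_def using Wf[OF a] u by simp
      finally show "detN N (\<lambda>i j. u i powi a j * z powi (lam j - 1 - a j)) =
        (\<Prod>j\<in>{1..N}. z powi (lam j - 1 - a j)) * (D * (\<Sum>\<mu>\<leftarrow>Wf a. \<Prod>i\<in>{1..N}. u i powi \<mu> i))" .
    qed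
    finally have L: "detN (Suc N) (\<lambda>i j. u i powi lam j) = z powi lam (Suc N) * ((\<Prod>i\<in>{1..N}. u i - z) *
       (\<Sum>a\<in>A. (\<Prod>j\<in>{1..N}. z powi (lam j - 1 - a j)) * (D * (\<Sum>\<mu>\<leftarrow>Wf a. \<Prod>i\<in>{1..N}. u i powi \<mu> i))))" .
    have D': "(\<Prod>i\<in>{1..Suc N}. \<Prod>j\<in>{i<..Suc N}. (u i - u j)) = (\<Prod>i\<in>{1..N}. u i - z) * D"
    proof -
      have "(\<Prod>j\<in>{i<..Suc N}. (u i - u j)) = (u i - z) * (\<Prod>j\<in>{i<..N}. (u i - u j))" if "i \<in> {1..N}" for i
      proof -
        have "{i<..Suc N} = insert (Suc N) {i<..N}" using that by auto
        then show ?thesis by (simp add: z_def)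
      qed
      then show ?thesis by (simp add: D_def prod.distrib)
    qed
    have W: "(\<Sum>\<mu>\<leftarrow>W. \<Prod>i\<in>{1..Suc N}. u i powi \<mu> i) =
       (\<Sum>a\<in>A. z powi e a * (\<Sum>\<mu>\<leftarrow>Wf a. \<Prod>i\<in>{1..N}. u i powi \<mu> i))"
    proof -
      have 1: "(\<Sum>\<mu>\<leftarrow>map (\<lambda>\<mu>. \<mu>(Suc N := e a)) (Wf a). \<Prod>i\<in>{1..Suc N}. u i powi \<mu> i) =
        z powi e a * (\<Sum>\<mu>\<leftarrow>Wf a. \<Prod>i\<in>{1..N}. u i powi \<mu> i)" for a
        by (simp add: comp_def sum_list_const_mult[symmetric] z_def mult.commute)
      have "(\<Sum>\<mu>\<leftarrow>W. \<Prod>i\<in>{1..Suc N}. u i powi \<mu> i) =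
         (\<Sum>a\<leftarrow>xs. \<Sum>\<mu>\<leftarrow>map (\<lambda>\<mu>. \<mu>(Suc N := e a)) (Wf a). \<Prod>i\<in>{1..Suc N}. u i powi \<mu> i)"
        unfolding W_def sum_list_map_concat by (simp add: comp_def)
      also have "\<dots> = (\<Sum>a\<in>A. z powi e a * (\<Sum>\<mu>\<leftarrow>Wf a. \<Prod>i\<in>{1..N}. u i powi \<mu> i))"
        unfolding 1 xs(1)[symmetric] by (rule sum_list_distinct_conv_sum_set[OF xs(2)])
      finally show ?thesis .
    qed
    have e: "z powi e a = z powi lam (Suc N) * (\<Prod>j\<in>{1..N}. z powi (lam j - 1 - a j))" for a
      unfolding e_def using z by (simp add: power_int_add power_int_sum)
    show "detN (Suc N) (\<lambda>i j. u i powi lam j) =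
      (\<Prod>i\<in>{1..Suc N}. \<Prod>j\<in>{i<..Suc N}. (u i - u j)) * (\<Sum>\<mu>\<leftarrow>W. \<Prod>i\<in>{1..Suc N}. u i powi \<mu> i)"
      unfolding L D' W e sum_distrib_left by (intro sum.cong refl) (simp only: mult_ac)
  qed
qed

section \<open>Confluent limits of alternants\<close>

text \<open>Divided differences over initial segments arise by left multiplication with a lower
  triangular matrix whose diagonal entries multiply to 1 / \<open>vdm N u\<close>.\<close>

lemma detN_divided_differences:
  assumes "inj_on u {1..N}"
  shows "detN N (\<lambda>i j. f j (u i)) = vdm N u * detN N (\<lambda>i j. \<Sum>r\<in>{1..i}. f j (u r) * dd u {1..i} r)"
proof -
  define L where "L i r = (if r \<le> i then dd u {1..i} r else 0)" for i r
  have "detN N (\<lambda>i j. \<Sum>r\<in>{1..i}. f j (u r) * dd u {1..i} r) = detN N (\<lambda>i j. \<Sum>r\<in>{1..N}. L i r * f j (u r))"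
  proof (rule detN_cong)
    fix i j assume "i \<in> {1..N}"
    then show "(\<Sum>r\<in>{1..i}. f j (u r) * dd u {1..i} r) = (\<Sum>r\<in>{1..N}. L i r * f j (u r))"
      by (intro sum.mono_neutral_cong_left) (auto simp: L_def)
  qed
  also have "\<dots> = detN N L * detN N (\<lambda>i j. f j (u i))" by (rule detN_mult)
  also have "detN N L = (\<Prod>i\<in>{1..N}. L i i)" by (rule detN_lower_triangular) (simp add: L_def)
  also have "\<dots> = inverse (vdm N u)"
  proof -
    have "{1..i} - {i} = {1..<i}" for i :: nat by auto
    then show ?thesis unfolding L_def dd_def vdm_def by (simp add: prod_inversef[symmetric] comp_def)
  qed
  finally show ?thesis using vdm_nonzero[OF assms] by simp
qed

text \<open>For powers the divided differences over initial segments form an upper triangular matrix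
  with unit diagonal.\<close>

lemma vdm_eq_detN:
  assumes "inj_on u {1..N}"
  shows "detN N (\<lambda>i j. u i ^ (j - 1)) = vdm N u"
proof -
  have inj: "inj_on u {1..i}" if "i \<le> N" for i using assms by (rule inj_on_subset) (use that in auto)
  have S: "(\<Sum>r\<in>{1..i}. u r ^ (j - 1) * dd u {1..i} r) = (if j = i then 1 else 0)"
    if "i \<in> {1..N}" "j \<in> {1..N}" "j \<le> i" for i j
    by (subst dd_power_sum[where m = "i - 1"]) (use that inj in auto)
  have "detN N (\<lambda>i j. \<Sum>r\<in>{1..i}. u r ^ (j - 1) * dd u {1..i} r) = 1"
    by (subst detN_upper_triangular) (use S in auto)
  then show ?thesis using detN_divided_differences[OF assms, of "\<lambda>j y. y ^ (j - 1)"] by simp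
qed

lemma vdm_permute:
  assumes "p permutes {1..N}" "inj_on u {1..N}"
  shows "vdm N (\<lambda>i. u (p i)) = of_int (sign p) * vdm N u"
proof -
  have "inj_on (u \<circ> p) {1..N}"
    using assms by (intro comp_inj_on) (auto simp: permutes_inj_on permutes_image)
  then have "vdm N (\<lambda>i. u (p i)) = detN N (\<lambda>i j. u (p i) ^ (j - 1))"
    by (intro vdm_eq_detN[symmetric]) (simp add: comp_def)
  also have "\<dots> = of_int (sign p) * detN N (\<lambda>i j. u i ^ (j - 1))"
    by (rule detN_permute_rows[OF assms(1), of "\<lambda>i j. u i ^ (j - 1)"])
  finally show ?thesis by (simp only: vdm_eq_detN[OF assms(2)])
qed

text \<open>A binomial polynomial of degree p has leading coefficient 1/p!. The induction multiplies
  y choose p by y - p, split as (y - x_a) + (x_a - p) at a node x_a.\<close>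

lemma dd_gbinomial_sum:
  assumes "finite I" "inj_on x I" "card I = Suc m" "p \<le> m"
  shows "(\<Sum>i\<in>I. (x i gchoose p) * dd x I i) = (if p = m then 1 / fact p else 0)"
  using assms
proof (induction p arbitrary: I m)
  case 0
  then show ?case using dd_power_sum[of I x m 0] by simp
next
  case (Suc p)
  then obtain m' where m': "m = Suc m'" by (cases m) auto
  obtain a where a: "a \<in> I" using Suc.prems(3) by (metis card.empty ex_in_conv nat.distinct(1))
  have rec: "real (Suc p) * (y gchoose Suc p) = (y - real p) * (y gchoose p)" for y :: real
    using gbinomial_absorb_comp[of y p] gbinomial_mult_1[of y p] by (simp add: algebra_simps)
  have "real (Suc p) * (\<Sum>i\<in>I. (x i gchoose Suc p) * dd x I i) = (\<Sum>i\<in>I. (x i - real p) * (x i gchoose p) * dd x I i)"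
    unfolding sum_distrib_left by (intro sum.cong refl) (simp only: rec mult.assoc[symmetric])
  also have "\<dots> = (\<Sum>i\<in>I. (x i - x a) * (x i gchoose p) * dd x I i) + (x a - real p) * (\<Sum>i\<in>I. (x i gchoose p) * dd x I i)"
    unfolding sum_distrib_left sum.distrib[symmetric] by (intro sum.cong refl) (simp add: algebra_simps)
  also have "(\<Sum>i\<in>I. (x i gchoose p) * dd x I i) = 0"
    using Suc.IH[OF Suc.prems(1-3)] Suc.prems(4) by simp
  also have "(\<Sum>i\<in>I. (x i - x a) * (x i gchoose p) * dd x I i) = (\<Sum>i\<in>I - {a}. (x i gchoose p) * dd x (I - {a}) i)"
    by (rule dd_sum_shift[OF Suc.prems(1,2) a])
  also have "\<dots> = (if p = m' then 1 / fact p else 0)"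
    by (rule Suc.IH) (use Suc.prems a m' in \<open>auto intro: inj_on_subset\<close>)
  finally have "real (Suc p) * (\<Sum>i\<in>I. (x i gchoose Suc p) * dd x I i) = (if p = m' then 1 / fact p else 0)" by simp
  moreover have "s = c / a" if "a * s = c" "a \<noteq> 0" for a s c :: real using that by auto
  ultimately have "(\<Sum>i\<in>I. (x i gchoose Suc p) * dd x I i) = (if p = m' then 1 / fact p else 0) / real (Suc p)"
    using of_nat_neq_0 by blast
  then show ?case using m' by simp
qed

text \<open>Binomial polynomials form a triangular basis with leading coefficients 1/(i - 1)!. With
  a repeated entry both sides are 0.\<close>

lemma detN_gbinomial:
  "detN N (\<lambda>i j. lam j gchoose (i - 1)) = vdm N lam / (\<Prod>i\<in>{1..N}. fact (i - 1))"
proof (cases "inj_on lam {1..N}")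
  case True
  have inj: "inj_on lam {1..i}" if "i \<le> N" for i using True by (rule inj_on_subset) (use that in auto)
  have S: "(\<Sum>r\<in>{1..i}. (lam r gchoose (j - 1)) * dd lam {1..i} r) = (if j = i then 1 / fact (j - 1) else 0)"
    if "i \<in> {1..N}" "j \<in> {1..N}" "j \<le> i" for i j
    by (subst dd_gbinomial_sum[where m = "i - 1"]) (use that inj in auto)
  have "detN N (\<lambda>i j. \<Sum>r\<in>{1..i}. (lam r gchoose (j - 1)) * dd lam {1..i} r) = (\<Prod>i\<in>{1..N}. 1 / fact (i - 1))"
    by (subst detN_upper_triangular) (use S in auto)
  then have "detN N (\<lambda>i j. lam i gchoose (j - 1)) = vdm N lam / (\<Prod>i\<in>{1..N}. fact (i - 1))"
    using detN_divided_differences[OF True, of "\<lambda>j y. y gchoose (j - 1)"] by (simp add: prod_dividef)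
  then show ?thesis using detN_transpose[of N "\<lambda>i j. lam i gchoose (j - 1)"] by simp
next
  case False
  then obtain a b where ab: "a \<in> {1..N}" "b \<in> {1..N}" "a \<noteq> b" "lam a = lam b" by (auto simp: inj_on_def)
  have "detN N (\<lambda>i j. lam j gchoose (i - 1)) = 0"
    by (rule detN_identical_columns[OF ab(1,2,3)]) (simp add: ab)
  moreover obtain C where "\<And>y. vdm N (lam(a := y)) = C * (\<Prod>l\<in>{1..N} - {a}. (y - lam l))"
    using vdm_upd[OF ab(1)] by blast
  from this[of "lam a"] have "vdm N lam = C * (\<Prod>l\<in>{1..N} - {a}. (lam a - lam l))" by simp
  moreover have "(\<Prod>l\<in>{1..N} - {a}. (lam a - lam l)) = 0"
    by (rule prod_zero) (use ab in auto)
  ultimately show ?thesis by simp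
qed

text \<open>Weyl's dimension formula for real exponents: row i becomes a divided difference over i
  nodes and tends to a Taylor coefficient of order i - 1. Real exponents occur because one of them
  will be lowered by q.\<close>

lemma detN_powr_limit:
  assumes "inj_on x {1..N}"
  shows "((\<lambda>e. detN N (\<lambda>i j. (1 + e * x i) powr lam j) / vdm N (\<lambda>i. 1 + e * x i)) \<longlongrightarrow>
    vdm N lam / (\<Prod>i\<in>{1..N}. fact (i - 1))) (at 0)"
proof -
  have inj: "inj_on x {1..i}" if "i \<le> N" for i using assms by (rule inj_on_subset) (use that in auto)
  have "((\<lambda>e. detN N (\<lambda>i j. \<Sum>r\<in>{1..i}. (1 + e * x r) powr lam j * dd (\<lambda>i. 1 + e * x i) {1..i} r)) \<longlongrightarrow>
     detN N (\<lambda>i j. lam j gchoose (i - 1))) (at 0)"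
  proof (rule tendsto_detN)
    fix i j assume i: "i \<in> {1..N}"
    show "((\<lambda>e. \<Sum>r\<in>{1..i}. (1 + e * x r) powr lam j * dd (\<lambda>i. 1 + e * x i) {1..i} r) \<longlongrightarrow> lam j gchoose (i - 1)) (at 0)"
      using divided_difference_tendsto[OF powr_fps_expansion, of "{1..i}" x "i - 1" "lam j"] i inj[of i]
      by simp
  qed
  moreover have "eventually (\<lambda>e::real. e \<noteq> 0) (at 0)" by (simp add: eventually_at_filter)
  then have "eventually (\<lambda>e. detN N (\<lambda>i j. \<Sum>r\<in>{1..i}. (1 + e * x r) powr lam j * dd (\<lambda>i. 1 + e * x i) {1..i} r) =
      detN N (\<lambda>i j. (1 + e * x i) powr lam j) / vdm N (\<lambda>i. 1 + e * x i)) (at 0)"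
  proof eventually_elim
    case (elim e)
    have "inj_on (\<lambda>i. 1 + e * x i) {1..N}"
      by (intro inj_onI, rule inj_onD[OF assms]) (use elim in auto)
    from detN_divided_differences[OF this, of "\<lambda>j y. y powr lam j"] vdm_nonzero[OF this] show ?case by simp
  qed
  ultimately show ?thesis unfolding detN_gbinomial by (rule Lim_transform_eventually)
qed

definition decreasing_upto :: "nat \<Rightarrow> (nat \<Rightarrow> int) \<Rightarrow> bool" where
  "decreasing_upto N lam \<longleftrightarrow> (\<forall>i j. 1 \<le> i \<longrightarrow> i < j \<longrightarrow> j \<le> N \<longrightarrow> lam j < lam i)"

text \<open>Permutation invariance of a multiset of exponent vectors, expressed through test
  functions so that it applies to any sum over the multiset.\<close>

definition sym_weights :: "nat \<Rightarrow> nat \<Rightarrow> (nat \<Rightarrow> nat \<Rightarrow> int) \<Rightarrow> bool" where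
  "sym_weights N n \<mu> \<longleftrightarrow> (\<forall>p. p permutes {1..N} \<longrightarrow>
     (\<forall>f :: (nat \<Rightarrow> int) \<Rightarrow> real. (\<Sum>t<n. f (\<mu> t \<circ> p)) = (\<Sum>t<n. f (\<mu> t))))"

text \<open>All permuted copies of the list are put together. This only multiplies the value by N!,
  because a quotient of two alternating functions is symmetric already.\<close>

lemma schur_sym_weights:
  assumes "decreasing_upto N lam"
  shows "\<exists>n \<mu>. sym_weights N n \<mu> \<and> (\<forall>u :: nat \<Rightarrow> real. (\<forall>i\<in>{1..N}. u i \<noteq> 0) \<longrightarrow> inj_on u {1..N} \<longrightarrow>
    detN N (\<lambda>i j. u i powi lam j) =
      (\<Prod>i\<in>{1..N}. \<Prod>j\<in>{i<..N}. (u i - u j)) / fact N * (\<Sum>t<n. \<Prod>i\<in>{1..N}. u i powi \<mu> t i))"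
proof -
  obtain W :: "(nat \<Rightarrow> int) list" where W: "\<And>u :: nat \<Rightarrow> real. (\<forall>i\<in>{1..N}. u i \<noteq> 0) \<Longrightarrow>
    detN N (\<lambda>i j. u i powi lam j) =
      (\<Prod>i\<in>{1..N}. \<Prod>j\<in>{i<..N}. (u i - u j)) * (\<Sum>\<mu>\<leftarrow>W. \<Prod>i\<in>{1..N}. u i powi \<mu> i)"
    using schur_monomial_list[of N lam] assms unfolding decreasing_upto_def by blast
  let ?S = "{p. p permutes {1..N}}"
  have finS: "finite ?S" by (simp add: finite_permutations)
  obtain ps where ps: "set ps = ?S" "distinct ps" using finite_distinct_list[OF finS] by blast
  define W' where "W' = concat (map (\<lambda>p. map (\<lambda>m. m \<circ> p) W) ps)"
  define n where "n = length W'"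
  define \<mu> where "\<mu> t = W' ! t" for t
  have sumW': "(\<Sum>t<n. f (\<mu> t)) = (\<Sum>p\<in>?S. \<Sum>m\<leftarrow>W. f (m \<circ> p))" for f :: "(nat \<Rightarrow> int) \<Rightarrow> real"
  proof -
    have "(\<Sum>t<n. f (\<mu> t)) = sum_list (map f W')"
      by (simp add: sum_list_sum_nth n_def \<mu>_def lessThan_atLeast0)
    also have "\<dots> = (\<Sum>p\<leftarrow>ps. \<Sum>m\<leftarrow>W. f (m \<circ> p))"
      unfolding W'_def sum_list_map_concat by (simp add: comp_def)
    also have "\<dots> = (\<Sum>p\<in>?S. \<Sum>m\<leftarrow>W. f (m \<circ> p))"
      unfolding ps(1)[symmetric] by (rule sum_list_distinct_conv_sum_set[OF ps(2)])
    finally show ?thesis .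
  qed
  have "sym_weights N n \<mu>"
    unfolding sym_weights_def
  proof (intro allI impI)
    fix p and f :: "(nat \<Rightarrow> int) \<Rightarrow> real" assume p: "p permutes {1..N}"
    have "(\<Sum>t<n. f (\<mu> t \<circ> p)) = (\<Sum>r\<in>?S. \<Sum>m\<leftarrow>W. f (m \<circ> (r \<circ> p)))"
      using sumW'[of "\<lambda>m. f (m \<circ> p)"] by (simp add: comp_assoc)
    also have "\<dots> = (\<Sum>r\<in>?S. \<Sum>m\<leftarrow>W. f (m \<circ> r))"
      using sum_permutations_compose_right[OF p, of "\<lambda>r. \<Sum>m\<leftarrow>W. f (m \<circ> r)"] by simp
    finally show "(\<Sum>t<n. f (\<mu> t \<circ> p)) = (\<Sum>t<n. f (\<mu> t) :: real)" using sumW'[of f] by simp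
  qed
  moreover have "detN N (\<lambda>i j. u i powi lam j) =
      (\<Prod>i\<in>{1..N}. \<Prod>j\<in>{i<..N}. (u i - u j)) / fact N * (\<Sum>t<n. \<Prod>i\<in>{1..N}. u i powi \<mu> t i)"
    if u: "\<forall>i\<in>{1..N}. u i \<noteq> 0" and inj: "inj_on u {1..N}" for u :: "nat \<Rightarrow> real"
  proof -
    define D where "D u = (\<Prod>i\<in>{1..N}. \<Prod>j\<in>{i<..N}. (u i - u j))" for u :: "nat \<Rightarrow> real"
    define s where "s u = (\<Sum>\<mu>\<leftarrow>W. \<Prod>i\<in>{1..N}. u i powi \<mu> i)" for u :: "nat \<Rightarrow> real"
    have D0: "D u \<noteq> 0" unfolding D_def vdm_sign using vdm_nonzero[OF inj] by simp
    have mono: "(\<Prod>i\<in>{1..N}. u i powi (m \<circ> p) i) = (\<Prod>i\<in>{1..N}. u (inv_into UNIV p i) powi m i)"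
      if p: "p permutes {1..N}" for p m
      using prod.permute[OF p, of "\<lambda>i. u (inv_into UNIV p i) powi m i"] permutes_inverses(2)[OF p]
      by (simp add: comp_def)
    have sp: "s (\<lambda>i. u (q i)) = s u" if q: "q permutes {1..N}" for q
    proof -
      have "\<forall>i\<in>{1..N}. u (q i) \<noteq> 0" using u permutes_in_image[OF q] by blast
      from W[OF this] have "detN N (\<lambda>i j. u (q i) powi lam j) = D (\<lambda>i. u (q i)) * s (\<lambda>i. u (q i))"
        by (simp add: D_def s_def)
      moreover have "detN N (\<lambda>i j. u (q i) powi lam j) = of_int (sign q) * (D u * s u)"
        using detN_permute_rows[OF q, of "\<lambda>i j. u i powi lam j"] W[OF u] by (simp add: D_def s_def)
      moreover have "D (\<lambda>i. u (q i)) = of_int (sign q) * D u"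
        unfolding D_def vdm_sign vdm_permute[OF q inj] by simp
      moreover have "of_int (sign q) \<noteq> (0::real)" by (simp add: sign_def)
      ultimately show ?thesis using D0 by (simp add: mult.assoc)
    qed
    have "(\<Sum>t<n. \<Prod>i\<in>{1..N}. u i powi \<mu> t i) = (\<Sum>p\<in>?S. \<Sum>m\<leftarrow>W. \<Prod>i\<in>{1..N}. u i powi (m \<circ> p) i)"
      by (rule sumW')
    also have "\<dots> = (\<Sum>p\<in>?S. s (\<lambda>i. u (inv_into UNIV p i)))"
    proof (rule sum.cong[OF refl])
      fix p assume "p \<in> ?S"
      then show "(\<Sum>m\<leftarrow>W. \<Prod>i\<in>{1..N}. u i powi (m \<circ> p) i) = s (\<lambda>i. u (inv_into UNIV p i))"
        by (simp only: mono s_def mem_Collect_eq)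
    qed
    also have "\<dots> = (\<Sum>p\<in>?S. s u)"
      by (intro sum.cong refl sp) (auto intro: permutes_inv)
    also have "\<dots> = fact N * s u" by (simp add: card_permutations)
    finally show ?thesis using W[OF u] by (simp add: s_def)
  qed
  ultimately show ?thesis by blast
qed

subsection \<open>The differential operator on Schur functions\<close>

lemma prod_one_plus_Pow:
  fixes f :: "'a \<Rightarrow> 'b :: comm_ring_1"
  assumes "finite S"
  shows "(\<Prod>l\<in>S. 1 + f l) = (\<Sum>J\<in>Pow S. \<Prod>l\<in>J. f l)"
  using assms
proof (induction S rule: finite_induct)
  case (insert x S)
  have "(\<Sum>J\<in>Pow (insert x S). \<Prod>l\<in>J. f l) =
      (\<Sum>J\<in>Pow S. \<Prod>l\<in>J. f l) + (\<Sum>J\<in>insert x ` Pow S. \<Prod>l\<in>J. f l)"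
    unfolding Pow_insert by (rule sum.union_disjoint) (use insert.hyps in auto)
  also have "(\<Sum>J\<in>insert x ` Pow S. \<Prod>l\<in>J. f l) = (\<Sum>J\<in>Pow S. \<Prod>l\<in>insert x J. f l)"
    by (rule sum.reindex_cong[where l = "insert x"]) (use insert.hyps in \<open>auto simp: inj_on_def\<close>)
  also have "\<dots> = (\<Sum>J\<in>Pow S. f x * (\<Prod>l\<in>J. f l))"
  proof (rule sum.cong[OF refl])
    fix J assume "J \<in> Pow S"
    then have "finite J" "x \<notin> J" using insert.hyps finite_subset by auto
    then show "(\<Prod>l\<in>insert x J. f l) = f x * (\<Prod>l\<in>J. f l)" by simp
  qed
  finally show ?case using insert by (simp add: algebra_simps sum_distrib_left sum.distrib)
qed simp

lemma alternating_sum_Pow: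
  "finite B \<Longrightarrow> (\<Sum>A\<in>Pow B. (-1) ^ card A) = (if B = {} then 1 else (0::real))"
  using prod_one_plus_Pow[of B "\<lambda>_. -1 :: real"] by (simp add: power_0_left)

text \<open>Inclusion-exclusion over the image: after expanding the products into maps from S to S,
  the signed sum over A retains exactly the surjective maps, that is, the permutations.\<close>

lemma ryser_permanent:
  fixes M :: "'a \<Rightarrow> 'a \<Rightarrow> real"
  assumes fin: "finite S"
  shows "(\<Sum>p | p permutes S. \<Prod>l\<in>S. M l (p l)) =
    (\<Sum>A\<in>Pow S. (-1) ^ card (S - A) * (\<Prod>l\<in>S. \<Sum>j\<in>A. M l j))"
proof -
  define \<Omega> where "\<Omega> = Pi\<^sub>E S (\<lambda>_. S)"
  have fin\<Omega>: "finite \<Omega>" unfolding \<Omega>_def using fin by (intro finite_PiE) auto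
  have "(\<Sum>A\<in>Pow S. (-1) ^ card (S - A) * (\<Prod>l\<in>S. \<Sum>j\<in>A. M l j)) =
    (\<Sum>A\<in>Pow S. \<Sum>f\<in>\<Omega>. if f ` S \<subseteq> A then (-1) ^ card (S - A) * (\<Prod>l\<in>S. M l (f l)) else 0)"
  proof (rule sum.cong[OF refl])
    fix A assume A: "A \<in> Pow S"
    then have finA: "finite A" using fin finite_subset by auto
    have "(\<Prod>l\<in>S. \<Sum>j\<in>A. M l j) = (\<Sum>f\<in>Pi\<^sub>E S (\<lambda>_. A). \<Prod>l\<in>S. M l (f l))"
      by (rule prod_sum_PiE) (use fin finA in auto)
    also have "Pi\<^sub>E S (\<lambda>_. A) = {f \<in> \<Omega>. f ` S \<subseteq> A}"
      using A unfolding \<Omega>_def PiE_iff set_eq_iff mem_Collect_eq image_subset_iff Pow_iff by blast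
    also have "(\<Sum>f\<in>{f \<in> \<Omega>. f ` S \<subseteq> A}. \<Prod>l\<in>S. M l (f l)) = (\<Sum>f\<in>\<Omega>. if f ` S \<subseteq> A then \<Prod>l\<in>S. M l (f l) else 0)"
      by (rule sum.inter_filter[OF fin\<Omega>])
    finally show "(-1) ^ card (S - A) * (\<Prod>l\<in>S. \<Sum>j\<in>A. M l j) =
      (\<Sum>f\<in>\<Omega>. if f ` S \<subseteq> A then (-1) ^ card (S - A) * (\<Prod>l\<in>S. M l (f l)) else 0)"
      by (simp add: sum_distrib_left if_distrib cong: if_cong)
  qed
  also have "\<dots> = (\<Sum>f\<in>\<Omega>. (\<Prod>l\<in>S. M l (f l)) * (\<Sum>A\<in>Pow S. if f ` S \<subseteq> A then (-1) ^ card (S - A) else 0))"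
    by (subst sum.swap) (simp add: sum_distrib_left if_distrib mult.commute cong: if_cong)
  also have "\<dots> = (\<Sum>f\<in>\<Omega>. (\<Prod>l\<in>S. M l (f l)) * (if f ` S = S then 1 else 0))"
  proof (rule sum.cong[OF refl])
    fix f assume f: "f \<in> \<Omega>"
    then have fS: "f ` S \<subseteq> S" by (auto simp: \<Omega>_def PiE_iff)
    have "(\<Sum>A\<in>Pow S. if f ` S \<subseteq> A then (-1) ^ card (S - A) else 0) = (\<Sum>A\<in>{A \<in> Pow S. f ` S \<subseteq> A}. (-1) ^ card (S - A) :: real)"
      by (rule sum.inter_filter[symmetric]) (use fin in auto)
    also have "\<dots> = (\<Sum>B\<in>Pow (S - f ` S). (-1) ^ card B)"
      by (rule sum.reindex_bij_witness[where i = "\<lambda>B. S - B" and j = "\<lambda>A. S - A"]) (use fS in \<open>auto simp: double_diff\<close>)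
    also have "\<dots> = (if S - f ` S = {} then 1 else 0)" by (rule alternating_sum_Pow) (use fin in auto)
    finally show "(\<Prod>l\<in>S. M l (f l)) * (\<Sum>A\<in>Pow S. if f ` S \<subseteq> A then (-1) ^ card (S - A) else 0) =
      (\<Prod>l\<in>S. M l (f l)) * (if f ` S = S then 1 else 0)" using fS by auto
  qed
  also have "\<dots> = (\<Sum>f\<in>{f \<in> \<Omega>. f ` S = S}. \<Prod>l\<in>S. M l (f l))"
    by (subst sum.inter_filter[OF fin\<Omega>]) (auto intro!: sum.cong)
  also have "\<dots> = (\<Sum>p | p permutes S. \<Prod>l\<in>S. M l (p l))"
  proof (rule sum.reindex_bij_witness[where i = "\<lambda>p. restrict p S" and j = "\<lambda>f x. if x \<in> S then f x else x"])
    fix f assume f: "f \<in> {f \<in> \<Omega>. f ` S = S}"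
    then show "restrict (\<lambda>x. if x \<in> S then f x else x) S = f"
      by (auto simp: \<Omega>_def fun_eq_iff restrict_def PiE_iff extensional_def)
    have "bij_betw f S S" using f fin by (auto simp: bij_betw_def intro: finite_surj_inj)
    then have "bij_betw (\<lambda>x. if x \<in> S then f x else x) S S" by (rule bij_betw_cong[THEN iffD1, rotated]) auto
    then show "(\<lambda>x. if x \<in> S then f x else x) \<in> {p. p permutes S}" by (auto intro: bij_imp_permutes)
    show "(\<Prod>l\<in>S. M l (if l \<in> S then f l else l)) = (\<Prod>l\<in>S. M l (f l))" by (intro prod.cong) auto
  next
    fix p assume p: "p \<in> {p. p permutes S}"
    then show "(\<lambda>x. if x \<in> S then restrict p S x else x) = p" by (auto simp: fun_eq_iff permutes_not_in)
    show "restrict p S \<in> {f \<in> \<Omega>. f ` S = S}"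
      using p permutes_image[of p S] by (auto simp: \<Omega>_def permutes_in_image)
  qed
  finally show ?thesis by simp
qed

definition esym :: "nat set \<Rightarrow> (nat \<Rightarrow> real) \<Rightarrow> nat \<Rightarrow> real" where
  "esym S c m = (\<Sum>J | J \<subseteq> S \<and> card J = m. \<Prod>l\<in>J. c l)"

lemma fps_const_prod: "(\<Prod>a\<in>S. fps_const (c a)) = fps_const (\<Prod>a\<in>S. c a :: real)"
  by (induction S rule: infinite_finite_induct) auto

lemma fps_nth_prod_one_plus:
  assumes "finite S"
  shows "fps_nth (\<Prod>l\<in>S. 1 + fps_const (c l) * fps_X) m = esym S c m"
proof -
  have "fps_nth (\<Prod>l\<in>J. fps_const (c l) * fps_X) m = (if card J = m then \<Prod>l\<in>J. c l else 0)" for J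
    by (simp add: prod.distrib fps_const_prod)
  then have "fps_nth (\<Prod>l\<in>S. 1 + fps_const (c l) * fps_X) m = (\<Sum>J\<in>Pow S. if card J = m then \<Prod>l\<in>J. c l else 0)"
    unfolding prod_one_plus_Pow[OF assms] fps_sum_nth by (intro sum.cong refl)
  also have "\<dots> = (\<Sum>J\<in>{J \<in> Pow S. card J = m}. \<Prod>l\<in>J. c l)"
    by (rule sum.inter_filter[symmetric]) (use assms in auto)
  finally show ?thesis by (simp add: esym_def)
qed

definition fps_powr_at :: "real \<Rightarrow> real \<Rightarrow> real fps" where
  "fps_powr_at y c = fps_const (y powr c) * (fps_binomial c oo (fps_const (1 / y) * fps_X))"

lemma fps_powr_at_expansion:
  assumes "y > 0"
  shows "(\<lambda>h. (y + h) powr c) has_fps_expansion fps_powr_at y c"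
proof (rule fps_expansion_cong)
  show "(\<lambda>h. y powr c * (1 + 1 / y * h) powr c) has_fps_expansion fps_powr_at y c"
    unfolding fps_powr_at_def
    by (intro has_fps_expansion_cmult_left fps_expansion_scale[OF powr_fps_expansion])
  have "eventually (\<lambda>h. h \<in> {-y<..}) (nhds 0)" using assms by (intro eventually_nhds_in_open) auto
  then show "eventually (\<lambda>h. y powr c * (1 + 1 / y * h) powr c = (y + h) powr c) (nhds 0)"
  proof eventually_elim
    case (elim h)
    have "0 \<le> 1 + 1 / y * h" using assms elim by (simp add: field_simps)
    then have "y powr c * (1 + 1 / y * h) powr c = (y * (1 + 1 / y * h)) powr c"
      using assms by (simp add: powr_mult)
    also have "y * (1 + 1 / y * h) = y + h" using assms by (simp add: field_simps)
    finally show ?case .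
  qed
qed

lemma fps_powr_at_nth: "y > 0 \<Longrightarrow> fps_nth (fps_powr_at y c) k = (c gchoose k) * y powr (c - real k)"
  by (simp add: fps_powr_at_def fps_nth_compose_linear powr_diff powr_realpow power_one_over divide_simps)

lemma fps_nth_prod_single:
  assumes "finite S" "i \<in> S"
  shows "fps_nth (\<Prod>a\<in>S. if a = i then G a else fps_const (c a)) k = fps_nth (G i) k * (\<Prod>a\<in>S - {i}. c a :: real)"
proof -
  have "(\<Prod>a\<in>S - {i}. if a = i then G a else fps_const (c a)) = fps_const (\<Prod>a\<in>S - {i}. c a)"
    unfolding fps_const_prod[symmetric] by (intro prod.cong) auto
  then show ?thesis by (simp add: prod.remove[OF assms])
qed

text \<open>Stated with \<open>powr\<close>, since the operator lowers an exponent by the real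
  number q.\<close>

locale monomial_expansion =
  fixes N n :: nat and K :: real and lam :: "nat \<Rightarrow> real" and mu :: "nat \<Rightarrow> nat \<Rightarrow> real"
  assumes expansion: "\<And>v. (\<forall>a\<in>{1..N}. v a > 0) \<Longrightarrow> inj_on v {1..N} \<Longrightarrow>
    detN N (\<lambda>a j. v a powr lam j) = K * vdm N v * (\<Sum>t<n. \<Prod>a\<in>{1..N}. v a powr mu t a)"
begin

text \<open>The variable u_i is moved to u_i + h and the coefficients of h^k are compared, which
  amounts to applying 1/k! times the k-th partial derivative. The Vandermonde product contributes
  elementary symmetric functions of 1/(u_i - u_l), the monomials take the remaining order k -
  m.\<close>

lemma action_row:
  assumes i: "i \<in> {1..N}" and u: "\<forall>a\<in>{1..N}. u a > 0" and inj: "inj_on u {1..N}"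
  shows "detN N (\<lambda>a j. if a = i then (lam j gchoose k) * u a powr (lam j - real k) else u a powr lam j) =
    K * vdm N u * (\<Sum>m\<le>k. esym ({1..N} - {i}) (\<lambda>l. inverse (u i - u l)) m *
      (\<Sum>t<n. (mu t i gchoose (k - m)) * (u i powr (- real (k - m)) * (\<Prod>a\<in>{1..N}. u a powr mu t a))))"
proof -
  have ui: "u i > 0" using u i by blast
  let ?S = "{1..N} - {i}"
  let ?u = "\<lambda>h. u(i := u i + h)"
  obtain C where C: "\<And>y. vdm N (u(i := y)) = C * (\<Prod>l\<in>?S. (y - u l))" using vdm_upd[OF i] by blast
  define row where "row d = (\<Prod>a\<in>{1..N}. if a = i then fps_powr_at (u i) (d a) else fps_const (u a powr d a))" for d
  have row: "(\<lambda>h. \<Prod>a\<in>{1..N}. ?u h a powr d a) has_fps_expansion row d" for d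
    unfolding row_def
  proof (rule has_fps_expansion_prod)
    fix a show "(\<lambda>h. ?u h a powr d a) has_fps_expansion (if a = i then fps_powr_at (u i) (d a) else fps_const (u a powr d a))"
      using fps_powr_at_expansion[OF ui, of "d a"] by auto
  qed
  have row_nth: "fps_nth (row d) r = (d i gchoose r) * u i powr (d i - real r) * (\<Prod>a\<in>?S. u a powr d a)" for d r
    unfolding row_def using i ui by (subst fps_nth_prod_single) (auto simp: fps_powr_at_nth)
  define FL where "FL = (\<Sum>p | p permutes {1..N}. fps_const (of_int (sign p)) * row (\<lambda>a. lam (p a)))"
  have FL: "(\<lambda>h. detN N (\<lambda>a j. ?u h a powr lam j)) has_fps_expansion FL"
    unfolding detN_def FL_def by (intro has_fps_expansion_sum has_fps_expansion_cmult_left row)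
  define FR where "FR = fps_const (K * C) * ((\<Prod>l\<in>?S. fps_const (u i - u l) + fps_X) * (\<Sum>t<n. row (mu t)))"
  have FR: "(\<lambda>h. (K * C) * ((\<Prod>l\<in>?S. (u i - u l) + h) * (\<Sum>t<n. \<Prod>a\<in>{1..N}. ?u h a powr mu t a))) has_fps_expansion FR"
    unfolding FR_def
    by (intro has_fps_expansion_sum has_fps_expansion_cmult_left has_fps_expansion_mult has_fps_expansion_prod
        has_fps_expansion_add has_fps_expansion_const has_fps_expansion_fps_X row)
  have ev1: "eventually (\<lambda>h. h \<in> {- u i<..}) (nhds 0)" using ui by (intro eventually_nhds_in_open) auto
  \<comment> \<open>The expansion is available at distinct points only, so u_i + h must avoid the
    other variables.\<close>
  have ev2: "eventually (\<lambda>h. \<forall>l\<in>?S. u i + h \<noteq> u l) (nhds 0)"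
  proof (intro eventually_ball_finite ballI)
    fix l assume l: "l \<in> ?S"
    then have "u i \<noteq> u l" using inj i by (auto dest: inj_onD)
    then have "eventually (\<lambda>h. h \<in> - {u l - u i}) (nhds 0)" by (intro eventually_nhds_in_open) auto
    then show "eventually (\<lambda>h. u i + h \<noteq> u l) (nhds 0)" by eventually_elim auto
  qed simp
  from ev1 ev2 have "eventually (\<lambda>h. detN N (\<lambda>a j. ?u h a powr lam j) =
     (K * C) * ((\<Prod>l\<in>?S. (u i - u l) + h) * (\<Sum>t<n. \<Prod>a\<in>{1..N}. ?u h a powr mu t a))) (nhds 0)"
  proof eventually_elim
    case (elim h)
    have pos: "\<forall>a\<in>{1..N}. ?u h a > 0" using u elim by auto
    have inj': "inj_on (?u h) {1..N}"
    proof (rule inj_onI)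
      fix a b assume ab: "a \<in> {1..N}" "b \<in> {1..N}" "?u h a = ?u h b"
      show "a = b"
      proof (rule ccontr)
        assume ne: "a \<noteq> b"
        consider "a = i" "b \<noteq> i" | "b = i" "a \<noteq> i" | "a \<noteq> i" "b \<noteq> i" using ne by auto
        then show False
        proof cases
          case 1
          then have "b \<in> ?S" using ab by auto
          then have "u i + h \<noteq> u b" using elim(2) by blast
          then show False using ab 1 by simp
        next
          case 2
          then have "a \<in> ?S" using ab by auto
          then have "u i + h \<noteq> u a" using elim(2) by blast
          then show False using ab 2 by simp
        next
          case 3
          then have "u a = u b" using ab by simp
          then show False using inj_onD[OF inj, of a b] ab ne by simp
        qed
      qed
    qed
    have "(\<Prod>l\<in>?S. (u i + h - u l)) = (\<Prod>l\<in>?S. (u i - u l) + h)"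
      by (intro prod.cong refl) simp
    then show ?case unfolding expansion[OF pos inj'] C by (simp only: mult_ac)
  qed
  from fps_expansion_cong[OF FL this] FR have FLR: "FL = FR" by (rule fps_expansion_unique_real)
  have L: "fps_nth FL k = detN N (\<lambda>a j. if a = i then (lam j gchoose k) * u a powr (lam j - real k) else u a powr lam j)"
  proof -
    have "fps_nth (row (\<lambda>a. lam (p a))) k = (\<Prod>a\<in>{1..N}. if a = i then (lam (p a) gchoose k) * u a powr (lam (p a) - real k) else u a powr lam (p a))" for p
      unfolding row_nth by (subst prod.remove[of _ i]) (use i in \<open>auto intro!: prod.cong\<close>)
    then show ?thesis by (simp add: FL_def fps_sum_nth detN_def)
  qed
  have P: "(\<Prod>l\<in>?S. fps_const (u i - u l) + fps_X) =
     fps_const (\<Prod>l\<in>?S. u i - u l) * (\<Prod>l\<in>?S. 1 + fps_const (inverse (u i - u l)) * fps_X)"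
    unfolding fps_const_prod[symmetric] prod.distrib[symmetric]
  proof (intro prod.cong refl)
    fix l assume l: "l \<in> ?S"
    then have "u i - u l \<noteq> 0" using inj i by (auto dest: inj_onD)
    then show "fps_const (u i - u l) + fps_X = fps_const (u i - u l) * (1 + fps_const (inverse (u i - u l)) * fps_X)"
      by (simp add: distrib_left mult.assoc[symmetric] del: fps_const_sub)
  qed
  have vd: "C * (\<Prod>l\<in>?S. u i - u l) = vdm N u" using C[of "u i"] by simp
  have rn: "fps_nth (row (mu t)) r = (mu t i gchoose r) * (u i powr (- real r) * (\<Prod>a\<in>{1..N}. u a powr mu t a))" for t r
    unfolding row_nth using i ui by (subst prod.remove[of _ i]) (auto simp: powr_diff powr_minus divide_simps)
  have "FR = fps_const (K * vdm N u) * ((\<Prod>l\<in>?S. 1 + fps_const (inverse (u i - u l)) * fps_X) * (\<Sum>t<n. row (mu t)))"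
    unfolding FR_def P vd[symmetric] by (simp only: mult.assoc[symmetric] fps_const_mult)
  then have "fps_nth FR k = K * vdm N u * fps_nth ((\<Prod>l\<in>?S. 1 + fps_const (inverse (u i - u l)) * fps_X) * (\<Sum>t<n. row (mu t))) k"
    by simp
  also have "fps_nth ((\<Prod>l\<in>?S. 1 + fps_const (inverse (u i - u l)) * fps_X) * (\<Sum>t<n. row (mu t))) k =
      (\<Sum>m\<le>k. esym ?S (\<lambda>l. inverse (u i - u l)) m * (\<Sum>t<n. fps_nth (row (mu t)) (k - m)))"
    unfolding fps_mult_nth fps_sum_nth atMost_atLeast0
    by (intro sum.cong refl, subst fps_nth_prod_one_plus) simp_all
  finally have "fps_nth FR k = K * vdm N u * (\<Sum>m\<le>k. esym ?S (\<lambda>l. inverse (u i - u l)) m * (\<Sum>t<n. fps_nth (row (mu t)) (k - m)))" .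
  then show ?thesis using L FLR by (simp only: rn)
qed

text \<open>The sum over lowered exponents replaces columns, hence rows, and
  \<open>action_row\<close> applies to each with the extra factor u_i^(k - q). Pairs of an index i
  and a set J of m further indices are regrouped by I = insert i J, and the products of 1/(u_i -
  u_l) become divided-difference weights on I.\<close>

lemma action:
  assumes u: "\<forall>a\<in>{1..N}. u a > 0" and inj: "inj_on u {1..N}"
  shows "(\<Sum>c\<in>{1..N}. (lam c gchoose k) * detN N (\<lambda>a j. u a powr (lam(c := lam c - q)) j)) =
    K * vdm N u * (\<Sum>m\<le>k. \<Sum>I | I \<subseteq> {1..N} \<and> card I = Suc m. \<Sum>i\<in>I. dd u I i *
      (u i powr (real m - q) * (\<Sum>t<n. (mu t i gchoose (k - m)) * (\<Prod>a\<in>{1..N}. u a powr mu t a))))"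
proof -
  define B where "B a j = (lam j gchoose k) * u a powr (lam j - q)" for a j
  define g where "g m i = u i powr (real m - q) * (\<Sum>t<n. (mu t i gchoose (k - m)) * (\<Prod>a\<in>{1..N}. u a powr mu t a))" for m i
  have "(lam c gchoose k) * detN N (\<lambda>a j. u a powr (lam(c := lam c - q)) j) = detN N (\<lambda>a j. if j = c then B a j else u a powr lam j)"
    if c: "c \<in> {1..N}" for c
  proof -
    have "detN N (\<lambda>a j. if j = c then B a j else u a powr lam j) = detN N (\<lambda>j a. if j = c then B a j else u a powr lam j)"
      by (rule detN_transpose[symmetric])
    also have "\<dots> = detN N (\<lambda>j a. (if j = c then lam c gchoose k else 1) * u a powr (lam(c := lam c - q)) j)"
      by (rule detN_cong) (simp add: B_def)
    also have "\<dots> = (\<Prod>j\<in>{1..N}. if j = c then lam c gchoose k else 1) * detN N (\<lambda>j a. u a powr (lam(c := lam c - q)) j)"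
      by (rule detN_scale_rows)
    also have "(\<Prod>j\<in>{1..N}. if j = c then lam c gchoose k else 1) = lam c gchoose k"
      using c by (simp add: prod.delta)
    also have "detN N (\<lambda>j a. u a powr (lam(c := lam c - q)) j) = detN N (\<lambda>a j. u a powr (lam(c := lam c - q)) j)"
      by (rule detN_transpose)
    finally show ?thesis by simp
  qed
  then have "(\<Sum>c\<in>{1..N}. (lam c gchoose k) * detN N (\<lambda>a j. u a powr (lam(c := lam c - q)) j)) =
     (\<Sum>c\<in>{1..N}. detN N (\<lambda>a j. if j = c then B a j else u a powr lam j))" by (intro sum.cong refl)
  also have "\<dots> = (\<Sum>i\<in>{1..N}. detN N (\<lambda>a j. if a = i then B a j else u a powr lam j))"
    by (rule sum_detN_rows_eq_sum_detN_columns[symmetric])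
  also have "\<dots> = (\<Sum>i\<in>{1..N}. K * vdm N u * (\<Sum>m\<le>k. esym ({1..N} - {i}) (\<lambda>l. inverse (u i - u l)) m * g m i))"
  proof (rule sum.cong[OF refl])
    fix i assume i: "i \<in> {1..N}"
    have ui: "u i > 0" using u i by blast
    let ?s = "u i powr (real k - q)"
    have "detN N (\<lambda>a j. if a = i then B a j else u a powr lam j) =
      detN N (\<lambda>a j. (if a = i then ?s else 1) * (if a = i then (lam j gchoose k) * u a powr (lam j - real k) else u a powr lam j))"
      by (rule detN_cong) (use ui in \<open>auto simp: B_def powr_add[symmetric] algebra_simps\<close>)
    also have "\<dots> = (\<Prod>a\<in>{1..N}. if a = i then ?s else 1) *
       detN N (\<lambda>a j. if a = i then (lam j gchoose k) * u a powr (lam j - real k) else u a powr lam j)"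
      by (rule detN_scale_rows)
    also have "(\<Prod>a\<in>{1..N}. if a = i then ?s else 1) = ?s" using i by (simp add: prod.delta)
    also have "?s * detN N (\<lambda>a j. if a = i then (lam j gchoose k) * u a powr (lam j - real k) else u a powr lam j) =
       K * vdm N u * (\<Sum>m\<le>k. esym ({1..N} - {i}) (\<lambda>l. inverse (u i - u l)) m * (?s *
        (\<Sum>t<n. (mu t i gchoose (k - m)) * (u i powr (- real (k - m)) * (\<Prod>a\<in>{1..N}. u a powr mu t a)))))"
      unfolding action_row[OF i u inj] by (simp only: sum_distrib_left mult_ac)
    also have "(\<Sum>m\<le>k. esym ({1..N} - {i}) (\<lambda>l. inverse (u i - u l)) m * (?s *
        (\<Sum>t<n. (mu t i gchoose (k - m)) * (u i powr (- real (k - m)) * (\<Prod>a\<in>{1..N}. u a powr mu t a))))) =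
       (\<Sum>m\<le>k. esym ({1..N} - {i}) (\<lambda>l. inverse (u i - u l)) m * g m i)"
    proof (intro sum.cong refl)
      fix m assume "m \<in> {..k}"
      then have "?s * u i powr (- real (k - m)) = u i powr (real m - q)"
        using ui by (simp add: powr_add[symmetric] of_nat_diff)
      then have "?s * (x * (u i powr (- real (k - m)) * y)) = u i powr (real m - q) * (x * y)" for x y
        by (metis (no_types) mult.assoc mult.left_commute)
      then show "esym ({1..N} - {i}) (\<lambda>l. inverse (u i - u l)) m * (?s *
        (\<Sum>t<n. (mu t i gchoose (k - m)) * (u i powr (- real (k - m)) * (\<Prod>a\<in>{1..N}. u a powr mu t a)))) =
        esym ({1..N} - {i}) (\<lambda>l. inverse (u i - u l)) m * g m i"
        by (simp only: g_def sum_distrib_left)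
    qed
    finally show "detN N (\<lambda>a j. if a = i then B a j else u a powr lam j) =
      K * vdm N u * (\<Sum>m\<le>k. esym ({1..N} - {i}) (\<lambda>l. inverse (u i - u l)) m * g m i)" .
  qed
  also have "\<dots> = K * vdm N u * (\<Sum>m\<le>k. \<Sum>i\<in>{1..N}. esym ({1..N} - {i}) (\<lambda>l. inverse (u i - u l)) m * g m i)"
    by (subst sum.swap) (simp only: sum_distrib_left)
  also have "(\<Sum>m\<le>k. \<Sum>i\<in>{1..N}. esym ({1..N} - {i}) (\<lambda>l. inverse (u i - u l)) m * g m i) =
    (\<Sum>m\<le>k. \<Sum>I | I \<subseteq> {1..N} \<and> card I = Suc m. \<Sum>i\<in>I. dd u I i * g m i)"
  proof (intro sum.cong refl)
    fix m
    have "(\<Sum>i\<in>{1..N}. esym ({1..N} - {i}) (\<lambda>l. inverse (u i - u l)) m * g m i) =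
      (\<Sum>(i, J)\<in>Sigma {1..N} (\<lambda>i. {J. J \<subseteq> {1..N} - {i} \<and> card J = m}). (\<Prod>l\<in>J. inverse (u i - u l)) * g m i)"
      unfolding esym_def sum_distrib_right
      by (rule sum.Sigma) (auto intro: finite_subset[of _ "Pow {1..N}"])
    also have "\<dots> = (\<Sum>(I, i)\<in>Sigma {I. I \<subseteq> {1..N} \<and> card I = Suc m} (\<lambda>I. I). dd u I i * g m i)"
    proof (rule sum.reindex_bij_witness[where i = "\<lambda>(I, i). (i, I - {i})" and j = "\<lambda>(i, J). (insert i J, i)"])
      fix x assume x: "x \<in> Sigma {1..N} (\<lambda>i. {J. J \<subseteq> {1..N} - {i} \<and> card J = m})"
      obtain i J where xe: "x = (i, J)" by (cases x)
      with x have iJ: "i \<in> {1..N}" "J \<subseteq> {1..N} - {i}" "card J = m" by auto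
      have "finite J" using iJ(2) finite_subset by auto
      have "i \<notin> J" using iJ by auto
      then have J: "insert i J - {i} = J" by auto
      show "(case case x of (i, J) \<Rightarrow> (insert i J, i) of (I, i) \<Rightarrow> (i, I - {i})) = x" using xe J by simp
      show "(case x of (i, J) \<Rightarrow> (insert i J, i)) \<in> Sigma {I. I \<subseteq> {1..N} \<and> card I = Suc m} (\<lambda>I. I)"
        using xe iJ \<open>finite J\<close> \<open>i \<notin> J\<close> by auto
      show "(case case x of (i, J) \<Rightarrow> (insert i J, i) of (I, i) \<Rightarrow> dd u I i * g m i) =
         (case x of (i, J) \<Rightarrow> (\<Prod>l\<in>J. inverse (u i - u l)) * g m i)"
        using xe J by (simp add: dd_def)
    next
      fix y assume y: "y \<in> Sigma {I. I \<subseteq> {1..N} \<and> card I = Suc m} (\<lambda>I. I)"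
      obtain I i where ye: "y = (I, i)" by (cases y)
      with y have Ii: "I \<subseteq> {1..N}" "card I = Suc m" "i \<in> I" by auto
      have "insert i (I - {i}) = I" using Ii by auto
      then show "(case case y of (I, i) \<Rightarrow> (i, I - {i}) of (i, J) \<Rightarrow> (insert i J, i)) = y" using ye by simp
      have "card (I - {i}) = m" using Ii by (simp add: card_Diff_singleton)
      then show "(case y of (I, i) \<Rightarrow> (i, I - {i})) \<in> Sigma {1..N} (\<lambda>i. {J. J \<subseteq> {1..N} - {i} \<and> card J = m})"
        using ye Ii by auto
    qed
    also have "\<dots> = (\<Sum>I | I \<subseteq> {1..N} \<and> card I = Suc m. \<Sum>i\<in>I. dd u I i * g m i)"
      by (rule sum.Sigma[symmetric]) (auto intro: finite_subset[of _ "Pow {1..N}"] card_ge_0_finite)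
    finally show "(\<Sum>i\<in>{1..N}. esym ({1..N} - {i}) (\<lambda>l. inverse (u i - u l)) m * g m i) =
      (\<Sum>I | I \<subseteq> {1..N} \<and> card I = Suc m. \<Sum>i\<in>I. dd u I i * g m i)" .
  qed
  finally show ?thesis by (simp only: g_def)
qed

end

text \<open>By Ryser's formula a symmetric sum of monomials is a signed sum of products of the form
  \<open>\<Prod>a. g (u a)\<close>; on such a product the operator acts through a function of one variable, so its
  symmetrisation is an ordinary divided difference.\<close>

lemma sym_weights_limit:
  assumes sym: "sym_weights N n \<mu>"
  shows "\<exists>L. \<forall>x I. I \<subseteq> {1..N} \<longrightarrow> card I = Suc m \<longrightarrow> inj_on x I \<longrightarrow>
    ((\<lambda>e. \<Sum>i\<in>I. dd (\<lambda>l. 1 + e * x l) I i * ((1 + e * x i) powr s *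
       (\<Sum>t<n. (real_of_int (\<mu> t i) gchoose r) * (\<Prod>a\<in>{1..N}. (1 + e * x a) powr real_of_int (\<mu> t a))))) \<longlongrightarrow> L) (at 0)"
proof -
  define g where "g t A y = (\<Sum>b\<in>A. y powr real_of_int (\<mu> t b))" for t A and y :: real
  define f where "f t A y = (\<Sum>b\<in>A. (real_of_int (\<mu> t b) gchoose r) * y powr real_of_int (\<mu> t b))" for t A and y :: real
  \<comment> \<open>Multiplying the product of all \<open>g t A (u a)\<close> by f/g at u_i
    exchanges its i-th factor, so the distinguished index enters only through this function of one
    variable.\<close>
  define \<psi> where "\<psi> t A y = y powr s * (f t A y * inverse (g t A y))" for t A y
  define Fg where "Fg t A = (\<Sum>b\<in>A. fps_binomial (real_of_int (\<mu> t b)))" for t A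
  define Ff where "Ff t A = (\<Sum>b\<in>A. fps_const (real_of_int (\<mu> t b) gchoose r) * fps_binomial (real_of_int (\<mu> t b)))" for t A
  define F\<psi> where "F\<psi> t A = fps_binomial s * (Ff t A * inverse (Fg t A))" for t A
  \<comment> \<open>The empty set is left out because \<open>g t {}\<close> is 0 and could not be
    divided by.\<close>
  let ?P = "Pow {1..N} - {{}}"
  have exp: "(\<lambda>h. \<psi> t A (1 + h)) has_fps_expansion F\<psi> t A" if A: "A \<in> ?P" for t A
  proof -
    have "fps_nth (Fg t A) 0 = real (card A)" by (simp add: Fg_def fps_sum_nth)
    moreover have "card A \<noteq> 0" using A finite_subset[of A "{1..N}"] by auto
    ultimately have nz: "fps_nth (Fg t A) 0 \<noteq> 0" by simp
    show ?thesis unfolding \<psi>_def F\<psi>_def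
      by (intro has_fps_expansion_mult has_fps_expansion_inverse nz powr_fps_expansion)
         (auto simp: g_def Fg_def f_def Ff_def intro!: has_fps_expansion_sum has_fps_expansion_cmult_left powr_fps_expansion)
  qed
  have key: "u i powr s * (\<Sum>t<n. (real_of_int (\<mu> t i) gchoose r) * (\<Prod>a\<in>{1..N}. u a powr real_of_int (\<mu> t a))) =
     (1 / fact N) * (\<Sum>t<n. \<Sum>A\<in>?P. (-1) ^ card ({1..N} - A) * (\<Prod>a\<in>{1..N}. g t A (u a)) * \<psi> t A (u i))"
    if u: "\<forall>a\<in>{1..N}. u a > 0" and i: "i \<in> {1..N}" for u :: "nat \<Rightarrow> real" and i
  proof -
    define \<Phi> where "\<Phi> m = (real_of_int (m i) gchoose r) * (\<Prod>a\<in>{1..N}. u a powr real_of_int (m a))" for m :: "nat \<Rightarrow> int"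
    define M where "M t a b = (if a = i then real_of_int (\<mu> t b) gchoose r else 1) * u a powr real_of_int (\<mu> t b)" for t a b
    have \<Phi>M: "\<Phi> (\<mu> t \<circ> p) = (\<Prod>a\<in>{1..N}. M t a (p a))" for t p
      unfolding \<Phi>_def M_def prod.distrib using i by (simp add: prod.delta)
    \<comment> \<open>Averaging over permutations turns the symmetric sum into a sum of
      permanents.\<close>
    have "fact N * (\<Sum>t<n. \<Phi> (\<mu> t)) = (\<Sum>p | p permutes {1..N}. \<Sum>t<n. \<Phi> (\<mu> t \<circ> p))"
    proof -
      have "(\<Sum>p | p permutes {1..N}. \<Sum>t<n. \<Phi> (\<mu> t \<circ> p)) = (\<Sum>p | p permutes {1..N}. \<Sum>t<n. \<Phi> (\<mu> t))"
        by (rule sum.cong[OF refl]) (use sym in \<open>auto simp: sym_weights_def\<close>)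
      then show ?thesis by (simp add: card_permutations)
    qed
    also have "\<dots> = (\<Sum>t<n. \<Sum>p | p permutes {1..N}. \<Prod>a\<in>{1..N}. M t a (p a))"
      unfolding \<Phi>M by (rule sum.swap)
    also have "\<dots> = (\<Sum>t<n. \<Sum>A\<in>Pow {1..N}. (-1) ^ card ({1..N} - A) * (\<Prod>a\<in>{1..N}. \<Sum>b\<in>A. M t a b))"
      by (intro sum.cong refl ryser_permanent) simp
    also have "\<dots> = (\<Sum>t<n. \<Sum>A\<in>?P. (-1) ^ card ({1..N} - A) * ((\<Prod>a\<in>{1..N}. g t A (u a)) * (f t A (u i) * inverse (g t A (u i)))))"
    proof (rule sum.cong[OF refl], rule sum.mono_neutral_cong_right)
      fix t
      show "\<forall>A\<in>Pow {1..N} - ?P. (-1) ^ card ({1..N} - A) * (\<Prod>a\<in>{1..N}. \<Sum>b\<in>A. M t a b) = 0"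
        using i by (auto simp: prod_zero_iff)
      fix A assume A: "A \<in> ?P"
      then have finA: "finite A" using finite_subset[of A "{1..N}"] by auto
      have "u i > 0" using u i by blast
      then have "g t A (u i) > 0" unfolding g_def
        by (intro sum_pos) (use A finA in auto)
      then have gi: "g t A (u i) \<noteq> 0" by simp
      have "(\<Prod>a\<in>{1..N}. \<Sum>b\<in>A. M t a b) = f t A (u i) * (\<Prod>a\<in>{1..N} - {i}. g t A (u a))"
        by (subst prod.remove[of _ i]) (use i in \<open>auto simp: M_def f_def g_def intro!: prod.cong\<close>)
      also have "\<dots> = (\<Prod>a\<in>{1..N}. g t A (u a)) * (f t A (u i) * inverse (g t A (u i)))"
      proof -
        have "(\<Prod>a\<in>{1..N}. g t A (u a)) = g t A (u i) * (\<Prod>a\<in>{1..N} - {i}. g t A (u a))"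
          by (rule prod.remove) (use i in auto)
        then show ?thesis using gi by simp
      qed
      finally show "(-1) ^ card ({1..N} - A) * (\<Prod>a\<in>{1..N}. \<Sum>b\<in>A. M t a b) =
        (-1) ^ card ({1..N} - A) * ((\<Prod>a\<in>{1..N}. g t A (u a)) * (f t A (u i) * inverse (g t A (u i))))" by simp
    qed auto
    finally have "(\<Sum>t<n. \<Phi> (\<mu> t)) = (1 / fact N) * (\<Sum>t<n. \<Sum>A\<in>?P. (-1) ^ card ({1..N} - A) *
        ((\<Prod>a\<in>{1..N}. g t A (u a)) * (f t A (u i) * inverse (g t A (u i)))))"
      by (simp add: field_simps)
    then show ?thesis unfolding \<Phi>_def \<psi>_def by (simp add: sum_distrib_left mult_ac)
  qed
  \<comment> \<open>Only values and coefficients at 1 enter, so the limit depends neither on the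
    direction x nor on the set I.\<close>
  define L where "L = (1 / fact N) * (\<Sum>t<n. \<Sum>A\<in>?P. (-1) ^ card ({1..N} - A) * (\<Prod>a\<in>{1..N}. g t A 1) * fps_nth (F\<psi> t A) m)"
  show ?thesis
  proof (intro exI[of _ L] allI impI)
    fix x :: "nat \<Rightarrow> real" and I
    assume I: "I \<subseteq> {1..N}" "card I = Suc m" "inj_on x I"
    have finI: "finite I" using I(1) finite_subset by auto
    have g: "((\<lambda>e. g t A (1 + e * x a)) \<longlongrightarrow> g t A (1 + 0 * x a)) (at 0)" for t A a
      unfolding g_def by (intro tendsto_intros) auto
    have "((\<lambda>e. (1 / fact N) * (\<Sum>t<n. \<Sum>A\<in>?P. (-1) ^ card ({1..N} - A) * (\<Prod>a\<in>{1..N}. g t A (1 + e * x a)) *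
        (\<Sum>i\<in>I. \<psi> t A (1 + e * x i) * dd (\<lambda>l. 1 + e * x l) I i))) \<longlongrightarrow>
       (1 / fact N) * (\<Sum>t<n. \<Sum>A\<in>?P. (-1) ^ card ({1..N} - A) * (\<Prod>a\<in>{1..N}. g t A (1 + 0 * x a)) * fps_nth (F\<psi> t A) m)) (at 0)"
      by (intro tendsto_mult tendsto_const tendsto_sum tendsto_prod g divided_difference_tendsto[OF exp finI I(3,2)])
    then have lim: "((\<lambda>e. (1 / fact N) * (\<Sum>t<n. \<Sum>A\<in>?P. (-1) ^ card ({1..N} - A) * (\<Prod>a\<in>{1..N}. g t A (1 + e * x a)) *
        (\<Sum>i\<in>I. \<psi> t A (1 + e * x i) * dd (\<lambda>l. 1 + e * x l) I i))) \<longlongrightarrow> L) (at 0)"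
      by (simp add: L_def)
    have "eventually (\<lambda>e. \<forall>a\<in>{1..N}. 1 + e * x a > 0) (at 0)"
    proof (intro eventually_ball_finite ballI)
      fix a
      have "((\<lambda>e. 1 + e * x a) \<longlongrightarrow> 1 + 0 * x a) (at 0)" by (intro tendsto_intros)
      then show "eventually (\<lambda>e. 1 + e * x a > 0) (at 0)" by (rule order_tendstoD(1)) simp
    qed simp
    then have "eventually (\<lambda>e. (1 / fact N) * (\<Sum>t<n. \<Sum>A\<in>?P. (-1) ^ card ({1..N} - A) * (\<Prod>a\<in>{1..N}. g t A (1 + e * x a)) *
        (\<Sum>i\<in>I. \<psi> t A (1 + e * x i) * dd (\<lambda>l. 1 + e * x l) I i)) =
      (\<Sum>i\<in>I. dd (\<lambda>l. 1 + e * x l) I i * ((1 + e * x i) powr s *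
       (\<Sum>t<n. (real_of_int (\<mu> t i) gchoose r) * (\<Prod>a\<in>{1..N}. (1 + e * x a) powr real_of_int (\<mu> t a)))))) (at 0)"
    proof eventually_elim
      case (elim e)
      have "(\<Sum>i\<in>I. dd (\<lambda>l. 1 + e * x l) I i * ((1 + e * x i) powr s *
         (\<Sum>t<n. (real_of_int (\<mu> t i) gchoose r) * (\<Prod>a\<in>{1..N}. (1 + e * x a) powr real_of_int (\<mu> t a))))) =
        (\<Sum>i\<in>I. dd (\<lambda>l. 1 + e * x l) I i * ((1 / fact N) * (\<Sum>t<n. \<Sum>A\<in>?P. (-1) ^ card ({1..N} - A) *
           (\<Prod>a\<in>{1..N}. g t A (1 + e * x a)) * \<psi> t A (1 + e * x i))))"
        by (intro sum.cong refl arg_cong2[where f = times] key[of "\<lambda>a. 1 + e * x a"]) (use elim I in auto)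
      also have "\<dots> = (\<Sum>i\<in>I. \<Sum>t<n. \<Sum>A\<in>?P. (1 / fact N) * ((-1) ^ card ({1..N} - A) *
           (\<Prod>a\<in>{1..N}. g t A (1 + e * x a)) * (\<psi> t A (1 + e * x i) * dd (\<lambda>l. 1 + e * x l) I i)))"
        unfolding sum_distrib_left by (simp only: mult_ac)
      also have "\<dots> = (\<Sum>t<n. \<Sum>A\<in>?P. \<Sum>i\<in>I. (1 / fact N) * ((-1) ^ card ({1..N} - A) *
           (\<Prod>a\<in>{1..N}. g t A (1 + e * x a)) * (\<psi> t A (1 + e * x i) * dd (\<lambda>l. 1 + e * x l) I i)))"
        by (subst sum.swap, intro sum.cong refl, rule sum.swap)
      finally show ?case by (simp only: sum_distrib_left)
    qed
    with lim show "((\<lambda>e. \<Sum>i\<in>I. dd (\<lambda>l. 1 + e * x l) I i * ((1 + e * x i) powr s *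
       (\<Sum>t<n. (real_of_int (\<mu> t i) gchoose r) * (\<Prod>a\<in>{1..N}. (1 + e * x a) powr real_of_int (\<mu> t a))))) \<longlongrightarrow> L) (at 0)"
      by (rule Lim_transform_eventually)
  qed
qed

text \<open>For one monomial with exponents \<nu>: the series in e of e^m times the divided
  difference over {1..m + 1}, at the point 1 + e (1, ..., m + 1) with all other variables equal to
  1.\<close>

definition Zf :: "nat \<Rightarrow> nat \<Rightarrow> real \<Rightarrow> (nat \<Rightarrow> int) \<Rightarrow> real fps" where
  "Zf m r s \<nu> = (\<Sum>i\<in>{1..Suc m}. fps_const (dd real {1..Suc m} i) *
     ((fps_binomial s oo (fps_const (real i) * fps_X)) * (fps_const (real_of_int (\<nu> i) gchoose r) *
       (\<Prod>a\<in>{1..Suc m}. fps_binomial (real_of_int (\<nu> a)) oo (fps_const (real a) * fps_X)))))"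

text \<open>The direction has zero entries beyond m + 1, so the other variables drop out.
  Convergence of the quotient by e^m then makes the lower coefficients vanish and identifies the
  m-th one with L.\<close>

lemma sym_weights_limit_Zf:
  assumes m: "m < N"
    and lim: "\<And>x I. I \<subseteq> {1..N} \<Longrightarrow> card I = Suc m \<Longrightarrow> inj_on x I \<Longrightarrow>
    ((\<lambda>e. \<Sum>i\<in>I. dd (\<lambda>l. 1 + e * x l) I i * ((1 + e * x i) powr s *
       (\<Sum>t<n. (real_of_int (\<mu> t i) gchoose r) * (\<Prod>a\<in>{1..N}. (1 + e * x a) powr real_of_int (\<mu> t a))))) \<longlongrightarrow> L) (at 0)"
  shows "\<And>p. p < m \<Longrightarrow> (\<Sum>t<n. fps_nth (Zf m r s (\<mu> t)) p) = 0"
    and "(\<Sum>t<n. fps_nth (Zf m r s (\<mu> t)) m) = L"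
proof -
  let ?I = "{1..Suc m}"
  define x where "x l = (if l \<le> Suc m then real l else 0)" for l
  define h where "h e = (\<Sum>t<n. \<Sum>i\<in>?I. dd real ?I i * ((1 + real i * e) powr s *
     ((real_of_int (\<mu> t i) gchoose r) * (\<Prod>a\<in>?I. (1 + real a * e) powr real_of_int (\<mu> t a)))))" for e
  have I: "?I \<subseteq> {1..N}" "card ?I = Suc m" "inj_on x ?I" using m by (auto simp: inj_on_def x_def)
  have pe: "(\<lambda>h. (1 + real i * h) powr c) has_fps_expansion (fps_binomial c oo (fps_const (real i) * fps_X))" for i c
    by (rule fps_expansion_scale[OF powr_fps_expansion])
  have h: "h has_fps_expansion (\<Sum>t<n. Zf m r s (\<mu> t))"
    unfolding h_def Zf_def
    by (intro has_fps_expansion_sum has_fps_expansion_cmult_left has_fps_expansion_mult has_fps_expansion_prod pe)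
  have ddx: "dd x ?I i = dd real ?I i" if "i \<in> ?I" for i
    unfolding dd_def by (intro prod.cong refl) (use that in \<open>auto simp: x_def\<close>)
  have "eventually (\<lambda>e::real. e \<noteq> 0) (at 0)" by (simp add: eventually_at_filter)
  then have ev: "eventually (\<lambda>e. (\<Sum>i\<in>?I. dd (\<lambda>l. 1 + e * x l) ?I i * ((1 + e * x i) powr s *
       (\<Sum>t<n. (real_of_int (\<mu> t i) gchoose r) * (\<Prod>a\<in>{1..N}. (1 + e * x a) powr real_of_int (\<mu> t a))))) = h e / e ^ m) (at 0)"
  proof eventually_elim
    case (elim e)
    have P: "(\<Prod>a\<in>{1..N}. (1 + e * x a) powr c a) = (\<Prod>a\<in>?I. (1 + real a * e) powr c a)" for c
      by (rule prod.mono_neutral_cong_right) (use m in \<open>auto simp: x_def mult.commute\<close>)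
    have "(\<Sum>i\<in>?I. dd (\<lambda>l. 1 + e * x l) ?I i * ((1 + e * x i) powr s *
       (\<Sum>t<n. (real_of_int (\<mu> t i) gchoose r) * (\<Prod>a\<in>{1..N}. (1 + e * x a) powr real_of_int (\<mu> t a))))) =
      (\<Sum>i\<in>?I. dd real ?I i / e ^ m * ((1 + real i * e) powr s *
       (\<Sum>t<n. (real_of_int (\<mu> t i) gchoose r) * (\<Prod>a\<in>?I. (1 + real a * e) powr real_of_int (\<mu> t a)))))"
    proof (rule sum.cong[OF refl])
      fix i assume i: "i \<in> ?I"
      have "dd (\<lambda>l. 1 + e * x l) ?I i = dd real ?I i / e ^ m"
        using dd_scale[OF _ i I(2), of e x] ddx[OF i] by simp
      moreover have "1 + e * x i = 1 + real i * e" using i by (simp add: x_def)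
      ultimately show "dd (\<lambda>l. 1 + e * x l) ?I i * ((1 + e * x i) powr s *
        (\<Sum>t<n. (real_of_int (\<mu> t i) gchoose r) * (\<Prod>a\<in>{1..N}. (1 + e * x a) powr real_of_int (\<mu> t a)))) =
        dd real ?I i / e ^ m * ((1 + real i * e) powr s *
        (\<Sum>t<n. (real_of_int (\<mu> t i) gchoose r) * (\<Prod>a\<in>?I. (1 + real a * e) powr real_of_int (\<mu> t a))))"
        by (simp only: P)
    qed
    also have "\<dots> = h e / e ^ m"
      unfolding h_def sum_divide_distrib
      by (subst sum.swap) (simp only: sum_distrib_left divide_inverse mult_ac)
    finally show ?case .
  qed
  have L: "((\<lambda>e. h e / e ^ m) \<longlongrightarrow> L) (at 0)"
    using lim[OF I] ev by (rule Lim_transform_eventually)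
  show "\<And>p. p < m \<Longrightarrow> (\<Sum>t<n. fps_nth (Zf m r s (\<mu> t)) p) = 0"
    using fps_expansion_quotient_limit(1)[OF h L] by (simp add: fps_sum_nth)
  show "(\<Sum>t<n. fps_nth (Zf m r s (\<mu> t)) m) = L"
    using fps_expansion_quotient_limit(2)[OF h L] by (simp add: fps_sum_nth)
qed

text \<open>The operator identity is divided by the Vandermonde product and taken to the limit along
  1 + e (1, ..., N). The left side becomes quotients of Vandermonde products in the exponents; on
  the right all sets I of size m + 1 have the same limit, whence N choose (m + 1).\<close>

lemma schur_operator_formula:
  assumes dec: "decreasing_upto N l"
  shows "\<exists>n \<mu> K. n > 0 \<and> K \<noteq> 0 \<and>
    (\<forall>u :: nat \<Rightarrow> real. (\<forall>i\<in>{1..N}. u i > 0) \<longrightarrow> inj_on u {1..N} \<longrightarrow>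
      detN N (\<lambda>i j. u i powi l j) =
      (\<Prod>i\<in>{1..N}. \<Prod>j\<in>{i<..N}. (u i - u j)) * (K * (\<Sum>t<n. \<Prod>i\<in>{1..N}. u i powi \<mu> t i))) \<and>
    (\<forall>k q. (\<Sum>c\<in>{1..N}. (real_of_int (l c) gchoose k) *
        (\<Prod>j\<in>{1..N} - {c}. (real_of_int (l c) - real_of_int (l j) - q) / (real_of_int (l c) - real_of_int (l j)))) =
      (\<Sum>m\<le>k. real (N choose Suc m) * ((\<Sum>t<n. fps_nth (Zf m (k - m) (real m - q) (\<mu> t)) m) / real n))) \<and>
    (\<forall>m r s p. m < N \<longrightarrow> p < m \<longrightarrow> (\<Sum>t<n. fps_nth (Zf m r s (\<mu> t)) p) = 0)"
proof -
  obtain n \<mu> where sym: "sym_weights N n \<mu>"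
    and W: "\<And>u :: nat \<Rightarrow> real. (\<forall>i\<in>{1..N}. u i \<noteq> 0) \<Longrightarrow> inj_on u {1..N} \<Longrightarrow>
    detN N (\<lambda>i j. u i powi l j) =
      (\<Prod>i\<in>{1..N}. \<Prod>j\<in>{i<..N}. (u i - u j)) / fact N * (\<Sum>t<n. \<Prod>i\<in>{1..N}. u i powi \<mu> t i)"
    using schur_sym_weights[OF dec] by blast
  define lam where "lam j = real_of_int (l j)" for j
  define sg :: real where "sg = (\<Prod>i\<in>{1..N}. (-1) ^ (i - 1))"
  \<comment> \<open>This constant carries the sign between the two orders of the Vandermonde
    factors; the statement uses the other order, so its witness is 1/N!.\<close>
  define K where "K = sg / fact N"
  have sg0: "sg \<noteq> 0" by (simp add: sg_def)
  have pw: "y powr real_of_int z = y powi z" if "y > 0" for y :: real and z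
    using that by (simp add: powr_real_of_int')
  interpret monomial_expansion N n K lam "\<lambda>t a. real_of_int (\<mu> t a)"
  proof
    fix v :: "nat \<Rightarrow> real" assume v: "\<forall>a\<in>{1..N}. v a > 0" and inj: "inj_on v {1..N}"
    have "detN N (\<lambda>a j. v a powr lam j) = detN N (\<lambda>i j. v i powi l j)"
      by (rule detN_cong) (use v in \<open>auto simp: lam_def pw\<close>)
    also have "\<dots> = (\<Prod>i\<in>{1..N}. \<Prod>j\<in>{i<..N}. (v i - v j)) / fact N * (\<Sum>t<n. \<Prod>i\<in>{1..N}. v i powi \<mu> t i)"
      by (rule W) (use v inj in auto)
    also have "(\<Sum>t<n. \<Prod>i\<in>{1..N}. v i powi \<mu> t i) = (\<Sum>t<n. \<Prod>i\<in>{1..N}. v i powr real_of_int (\<mu> t i))"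
      by (intro sum.cong prod.cong refl) (use v pw in auto)
    finally show "detN N (\<lambda>a j. v a powr lam j) = K * vdm N v * (\<Sum>t<n. \<Prod>a\<in>{1..N}. v a powr real_of_int (\<mu> t a))"
      unfolding vdm_sign K_def sg_def by (simp add: mult_ac)
  qed
  have injl: "inj_on lam {1..N}"
  proof (rule inj_onI)
    fix i j assume "i \<in> {1..N}" "j \<in> {1..N}" "lam i = lam j"
    then show "i = j" using dec unfolding decreasing_upto_def lam_def
      by (metis atLeastAtMost_iff less_irrefl nat_neq_iff of_int_eq_iff)
  qed
  define F :: real where "F = (\<Prod>i\<in>{1..N}. fact (i - 1))"
  have F0: "F \<noteq> 0" by (simp add: F_def)
  have injr: "inj_on real {1..N}" by (simp add: inj_on_def)
  have evpos: "eventually (\<lambda>e. \<forall>a\<in>{1..N}. 1 + e * real a > 0) (at 0)"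
  proof (intro eventually_ball_finite ballI)
    fix a
    have "((\<lambda>e. 1 + e * real a) \<longlongrightarrow> 1 + 0 * real a) (at 0)" by (intro tendsto_intros)
    then show "eventually (\<lambda>e. 1 + e * real a > 0) (at 0)" by (rule order_tendstoD(1)) simp
  qed simp
  have evnz: "eventually (\<lambda>e::real. e \<noteq> 0) (at 0)" by (simp add: eventually_at_filter)
  have inje: "inj_on (\<lambda>a. 1 + e * real a) {1..N}" if "e \<noteq> 0" for e
    by (intro inj_onI) (use that in auto)
  \<comment> \<open>Up to sign, the Schur function at \<open>ones\<close> computed twice: by
    counting monomials and by the dimension formula.\<close>
  have Kn: "K * real n = vdm N lam / F"
  proof -
    have "((\<lambda>e. K * (\<Sum>t<n. \<Prod>a\<in>{1..N}. (1 + e * real a) powr real_of_int (\<mu> t a))) \<longlongrightarrow>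
        K * (\<Sum>t<n. \<Prod>a\<in>{1..N}. (1 + 0 * real a) powr real_of_int (\<mu> t a))) (at 0)"
      by (intro tendsto_intros) auto
    moreover have "eventually (\<lambda>e. K * (\<Sum>t<n. \<Prod>a\<in>{1..N}. (1 + e * real a) powr real_of_int (\<mu> t a)) =
        detN N (\<lambda>i j. (1 + e * real i) powr lam j) / vdm N (\<lambda>i. 1 + e * real i)) (at 0)"
      using evpos evnz
    proof eventually_elim
      case (elim e)
      show ?case using expansion[OF elim(1) inje[OF elim(2)]] vdm_nonzero[OF inje[OF elim(2)]] by simp
    qed
    ultimately have "((\<lambda>e. detN N (\<lambda>i j. (1 + e * real i) powr lam j) / vdm N (\<lambda>i. 1 + e * real i)) \<longlongrightarrow>
        K * (\<Sum>t<n. \<Prod>a\<in>{1..N}. (1 + 0 * real a) powr real_of_int (\<mu> t a))) (at 0)"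
      by (rule Lim_transform_eventually)
    from tendsto_unique[OF _ this detN_powr_limit[OF injr, of lam]] show ?thesis by (simp add: F_def)
  qed
  have vl: "vdm N lam \<noteq> 0" by (rule vdm_nonzero[OF injl])
  have n0: "n > 0" using Kn vl F0 by (cases n) auto
  have K0: "K \<noteq> 0" using sg0 by (simp add: K_def)
  have A: "\<forall>u :: nat \<Rightarrow> real. (\<forall>i\<in>{1..N}. u i > 0) \<longrightarrow> inj_on u {1..N} \<longrightarrow>
      detN N (\<lambda>i j. u i powi l j) =
      (\<Prod>i\<in>{1..N}. \<Prod>j\<in>{i<..N}. (u i - u j)) * (1 / fact N * (\<Sum>t<n. \<Prod>i\<in>{1..N}. u i powi \<mu> t i))"
    by (intro allI impI, subst W) auto
  have C: "\<forall>m r s p. m < N \<longrightarrow> p < m \<longrightarrow> (\<Sum>t<n. fps_nth (Zf m r s (\<mu> t)) p) = 0"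
  proof (intro allI impI)
    fix m r p :: nat and s :: real assume mp: "m < N" "p < m"
    obtain L where "\<And>x I. I \<subseteq> {1..N} \<Longrightarrow> card I = Suc m \<Longrightarrow> inj_on x I \<Longrightarrow>
    ((\<lambda>e. \<Sum>i\<in>I. dd (\<lambda>l. 1 + e * x l) I i * ((1 + e * x i) powr s *
       (\<Sum>t<n. (real_of_int (\<mu> t i) gchoose r) * (\<Prod>a\<in>{1..N}. (1 + e * x a) powr real_of_int (\<mu> t a))))) \<longlongrightarrow> L) (at 0)"
      using sym_weights_limit[OF sym, of m s r] by blast
    from sym_weights_limit_Zf(1)[OF mp(1) this mp(2)]
    show "(\<Sum>t<n. fps_nth (Zf m r s (\<mu> t)) p) = 0" .
  qed
  have B: "(\<Sum>c\<in>{1..N}. (lam c gchoose k) * (\<Prod>j\<in>{1..N} - {c}. (lam c - lam j - q) / (lam c - lam j))) =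
      (\<Sum>m\<le>k. real (N choose Suc m) * ((\<Sum>t<n. fps_nth (Zf m (k - m) (real m - q) (\<mu> t)) m) / real n))" for k q
  proof -
    have "\<forall>m. \<exists>L. \<forall>x I. I \<subseteq> {1..N} \<longrightarrow> card I = Suc m \<longrightarrow> inj_on x I \<longrightarrow>
    ((\<lambda>e. \<Sum>i\<in>I. dd (\<lambda>l. 1 + e * x l) I i * ((1 + e * x i) powr (real m - q) *
       (\<Sum>t<n. (real_of_int (\<mu> t i) gchoose (k - m)) * (\<Prod>a\<in>{1..N}. (1 + e * x a) powr real_of_int (\<mu> t a))))) \<longlongrightarrow> L) (at 0)"
      using sym_weights_limit[OF sym] by blast
    from choice[OF this] obtain L where "\<forall>m x I. I \<subseteq> {1..N} \<longrightarrow> card I = Suc m \<longrightarrow> inj_on x I \<longrightarrow>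
    ((\<lambda>e. \<Sum>i\<in>I. dd (\<lambda>l. 1 + e * x l) I i * ((1 + e * x i) powr (real m - q) *
       (\<Sum>t<n. (real_of_int (\<mu> t i) gchoose (k - m)) * (\<Prod>a\<in>{1..N}. (1 + e * x a) powr real_of_int (\<mu> t a))))) \<longlongrightarrow> L m) (at 0)" ..
    then have L: "\<And>m x I. I \<subseteq> {1..N} \<Longrightarrow> card I = Suc m \<Longrightarrow> inj_on x I \<Longrightarrow>
    ((\<lambda>e. \<Sum>i\<in>I. dd (\<lambda>l. 1 + e * x l) I i * ((1 + e * x i) powr (real m - q) *
       (\<Sum>t<n. (real_of_int (\<mu> t i) gchoose (k - m)) * (\<Prod>a\<in>{1..N}. (1 + e * x a) powr real_of_int (\<mu> t a))))) \<longlongrightarrow> L m) (at 0)"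
      by blast
    have LZ: "(\<Sum>t<n. fps_nth (Zf m (k - m) (real m - q) (\<mu> t)) m) = L m" if "m < N" for m
      using sym_weights_limit_Zf(2)[OF that L] .
    have "((\<lambda>e. K * (\<Sum>m\<le>k. \<Sum>I | I \<subseteq> {1..N} \<and> card I = Suc m. \<Sum>i\<in>I. dd (\<lambda>l. 1 + e * real l) I i * ((1 + e * real i) powr (real m - q) *
       (\<Sum>t<n. (real_of_int (\<mu> t i) gchoose (k - m)) * (\<Prod>a\<in>{1..N}. (1 + e * real a) powr real_of_int (\<mu> t a)))))) \<longlongrightarrow>
       K * (\<Sum>m\<le>k. \<Sum>I | I \<subseteq> {1..N} \<and> card I = Suc m. L m)) (at 0)"
      by (intro tendsto_mult tendsto_const tendsto_sum L) (auto simp: inj_on_def)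
    moreover have "eventually (\<lambda>e. K * (\<Sum>m\<le>k. \<Sum>I | I \<subseteq> {1..N} \<and> card I = Suc m. \<Sum>i\<in>I. dd (\<lambda>l. 1 + e * real l) I i * ((1 + e * real i) powr (real m - q) *
       (\<Sum>t<n. (real_of_int (\<mu> t i) gchoose (k - m)) * (\<Prod>a\<in>{1..N}. (1 + e * real a) powr real_of_int (\<mu> t a))))) =
       (\<Sum>c\<in>{1..N}. (lam c gchoose k) * (detN N (\<lambda>a j. (1 + e * real a) powr (lam(c := lam c - q)) j) / vdm N (\<lambda>i. 1 + e * real i)))) (at 0)"
      using evpos evnz
    proof eventually_elim
      case (elim e)
      have "(\<Sum>c\<in>{1..N}. (lam c gchoose k) * (detN N (\<lambda>a j. (1 + e * real a) powr (lam(c := lam c - q)) j) / vdm N (\<lambda>i. 1 + e * real i))) =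
        (\<Sum>c\<in>{1..N}. (lam c gchoose k) * detN N (\<lambda>a j. (1 + e * real a) powr (lam(c := lam c - q)) j)) / vdm N (\<lambda>i. 1 + e * real i)"
        by (simp add: sum_divide_distrib)
      then show ?case
        unfolding action[OF elim(1) inje[OF elim(2)]] using vdm_nonzero[OF inje[OF elim(2)]] by simp
    qed
    ultimately have lim1: "((\<lambda>e. \<Sum>c\<in>{1..N}. (lam c gchoose k) * (detN N (\<lambda>a j. (1 + e * real a) powr (lam(c := lam c - q)) j) / vdm N (\<lambda>i. 1 + e * real i))) \<longlongrightarrow>
       K * (\<Sum>m\<le>k. \<Sum>I | I \<subseteq> {1..N} \<and> card I = Suc m. L m)) (at 0)"
      by (rule Lim_transform_eventually)
    have lim2: "((\<lambda>e. \<Sum>c\<in>{1..N}. (lam c gchoose k) * (detN N (\<lambda>a j. (1 + e * real a) powr (lam(c := lam c - q)) j) / vdm N (\<lambda>i. 1 + e * real i))) \<longlongrightarrow>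
       (\<Sum>c\<in>{1..N}. (lam c gchoose k) * (vdm N (lam(c := lam c - q)) / F))) (at 0)"
      unfolding F_def by (intro tendsto_sum tendsto_mult tendsto_const detN_powr_limit injr)
    have "(\<Sum>c\<in>{1..N}. (lam c gchoose k) * (vdm N (lam(c := lam c - q)) / F)) = K * (\<Sum>m\<le>k. \<Sum>I | I \<subseteq> {1..N} \<and> card I = Suc m. L m)"
      using tendsto_unique[OF _ lim2 lim1] by simp
    also have "(\<Sum>m\<le>k. \<Sum>I | I \<subseteq> {1..N} \<and> card I = Suc m. L m) =
       (\<Sum>m\<le>k. real (N choose Suc m) * (\<Sum>t<n. fps_nth (Zf m (k - m) (real m - q) (\<mu> t)) m))"
    proof (rule sum.cong[OF refl])
      fix m
      have "(\<Sum>I | I \<subseteq> {1..N} \<and> card I = Suc m. L m) = real (N choose Suc m) * L m"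
        using n_subsets[of "{1..N}" "Suc m"] by simp
      also have "\<dots> = real (N choose Suc m) * (\<Sum>t<n. fps_nth (Zf m (k - m) (real m - q) (\<mu> t)) m)"
        using LZ[of m] by (cases "m < N") (auto simp: binomial_eq_0)
      finally show "(\<Sum>I | I \<subseteq> {1..N} \<and> card I = Suc m. L m) =
         real (N choose Suc m) * (\<Sum>t<n. fps_nth (Zf m (k - m) (real m - q) (\<mu> t)) m)" .
    qed
    finally have eq: "(\<Sum>c\<in>{1..N}. (lam c gchoose k) * (vdm N (lam(c := lam c - q)) / F)) =
       K * (\<Sum>m\<le>k. real (N choose Suc m) * (\<Sum>t<n. fps_nth (Zf m (k - m) (real m - q) (\<mu> t)) m))" .
    \<comment> \<open>A quotient of Vandermonde products in which only the exponent c moves: the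
      Perelomov-Popov weight.\<close>
    have ratio: "(\<Prod>j\<in>{1..N} - {c}. (lam c - lam j - q) / (lam c - lam j)) = (vdm N (lam(c := lam c - q)) / F) / (K * real n)"
      if c: "c \<in> {1..N}" for c
    proof -
      obtain C where C: "\<And>y. vdm N (lam(c := y)) = C * (\<Prod>j\<in>{1..N} - {c}. (y - lam j))" using vdm_upd[OF c] by blast
      have v: "vdm N lam = C * (\<Prod>j\<in>{1..N} - {c}. (lam c - lam j))" using C[of "lam c"] by simp
      have "C \<noteq> 0" using v vl by auto
      have "(vdm N (lam(c := lam c - q)) / F) / (K * real n) = vdm N (lam(c := lam c - q)) / vdm N lam"
        unfolding Kn using F0 by simp
      also have "\<dots> = (\<Prod>j\<in>{1..N} - {c}. (lam c - q - lam j)) / (\<Prod>j\<in>{1..N} - {c}. (lam c - lam j))"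
        unfolding C v using \<open>C \<noteq> 0\<close> by simp
      also have "\<dots> = (\<Prod>j\<in>{1..N} - {c}. (lam c - lam j - q) / (lam c - lam j))"
        unfolding prod_dividef[symmetric] by (intro prod.cong refl) (simp add: algebra_simps)
      finally show ?thesis by simp
    qed
    have "(\<Sum>c\<in>{1..N}. (lam c gchoose k) * (\<Prod>j\<in>{1..N} - {c}. (lam c - lam j - q) / (lam c - lam j))) =
      (\<Sum>c\<in>{1..N}. (lam c gchoose k) * (vdm N (lam(c := lam c - q)) / F)) / (K * real n)"
      unfolding sum_divide_distrib by (intro sum.cong refl) (simp only: ratio times_divide_eq_right)
    also have "\<dots> = (\<Sum>m\<le>k. real (N choose Suc m) * (\<Sum>t<n. fps_nth (Zf m (k - m) (real m - q) (\<mu> t)) m)) / real n"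
      unfolding eq using K0 by simp
    also have "\<dots> = (\<Sum>m\<le>k. real (N choose Suc m) * ((\<Sum>t<n. fps_nth (Zf m (k - m) (real m - q) (\<mu> t)) m) / real n))"
      unfolding sum_divide_distrib[of _ "{..k}"] by simp
    finally show ?thesis .
  qed
  show ?thesis
    using n0 A C B unfolding lam_def by (intro exI[of _ n] exI[of _ \<mu>] exI[of _ "1 / fact N"]) auto
qed

subsection \<open>Jets along a line\<close>

definition cube :: "nat \<Rightarrow> real \<Rightarrow> (nat \<Rightarrow> real) set" where
  "cube N d = {u. \<forall>i\<in>{1..N}. \<bar>u i - 1\<bar> < d}"

lemma ones_in_cube: "d > 0 \<Longrightarrow> ones \<in> cube N d"
  by (simp add: cube_def ones_def)

lemma eventually_upd_in_cube:
  assumes "u \<in> cube N d" "i \<in> {1..N}"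
  shows "eventually (\<lambda>t. u(i := t) \<in> cube N d) (nhds (u i))"
proof -
  have "eventually (\<lambda>t. t \<in> ball 1 d) (nhds (u i))"
    using assms by (intro eventually_nhds_in_open) (auto simp: cube_def dist_real_def abs_minus_commute)
  then show ?thesis
    by eventually_elim (use assms in \<open>auto simp: cube_def dist_real_def abs_minus_commute\<close>)
qed

lemma pderiv_i_eqI:
  "((\<lambda>t. f (u(i := t))) has_real_derivative D) (at (u i)) \<Longrightarrow> pderiv_i i f u = D"
  by (simp add: pderiv_i_def DERIV_imp_deriv)

lemma has_pderiv_cong:
  assumes "\<And>v. v \<in> cube N d \<Longrightarrow> f v = g v" "u \<in> cube N d" "i \<in> {1..N}"
  shows "((\<lambda>t. f (u(i := t))) has_real_derivative D) (at (u i)) \<longleftrightarrow>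
    ((\<lambda>t. g (u(i := t))) has_real_derivative D) (at (u i))"
proof (rule DERIV_cong_ev[OF refl _ refl])
  show "eventually (\<lambda>t. f (u(i := t)) = g (u(i := t))) (nhds (u i))"
    using eventually_upd_in_cube[OF assms(2,3)] by eventually_elim (rule assms(1))
qed

lemma pderiv_i_cong:
  assumes "\<And>v. v \<in> cube N d \<Longrightarrow> f v = g v" "u \<in> cube N d" "i \<in> {1..N}"
  shows "pderiv_i i f u = pderiv_i i g u"
  unfolding pderiv_i_def deriv_def using has_pderiv_cong[of N d f g u i, OF assms] by simp

text \<open>Existence of iterated partial derivatives one coordinate at a time, which is what
  \<open>pderivs\<close> speaks about.\<close>

primrec smooth :: "nat \<Rightarrow> real \<Rightarrow> nat \<Rightarrow> ((nat \<Rightarrow> real) \<Rightarrow> real) \<Rightarrow> bool" where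
  "smooth N d 0 f = True"
| "smooth N d (Suc n) f = (\<forall>i\<in>{1..N}.
     (\<forall>u\<in>cube N d. \<exists>D. ((\<lambda>t. f (u(i := t))) has_real_derivative D) (at (u i))) \<and>
     smooth N d n (pderiv_i i f))"

lemma smooth_cong:
  assumes "\<And>v. v \<in> cube N d \<Longrightarrow> f v = g v" "smooth N d n f"
  shows "smooth N d n g"
  using assms
proof (induction n arbitrary: f g)
  case (Suc n)
  have "smooth N d n (pderiv_i i g)" if "i \<in> {1..N}" for i
    by (rule Suc.IH[of "pderiv_i i f"]) (use Suc.prems pderiv_i_cong[of N d f g] that in auto)
  moreover have "\<exists>D. ((\<lambda>t. g (u(i := t))) has_real_derivative D) (at (u i))"
    if "i \<in> {1..N}" "u \<in> cube N d" for i u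
    using has_pderiv_cong[of N d f g u i, OF Suc.prems(1) that(2,1)] Suc.prems(2) that
    unfolding smooth.simps by blast
  ultimately show ?case by simp
qed simp

lemma smooth_SucI:
  assumes "\<And>i u. i \<in> {1..N} \<Longrightarrow> u \<in> cube N d \<Longrightarrow> ((\<lambda>t. f (u(i := t))) has_real_derivative D i u) (at (u i))"
    and "\<And>i. i \<in> {1..N} \<Longrightarrow> smooth N d n (D i)"
  shows "smooth N d (Suc n) f"
proof -
  have "smooth N d n (pderiv_i i f)" if "i \<in> {1..N}" for i
  proof (rule smooth_cong[OF _ assms(2)[OF that]])
    fix v assume "v \<in> cube N d"
    from pderiv_i_eqI[of f v i, OF assms(1)[OF that this]] show "D i v = pderiv_i i f v" by simp
  qed
  then show ?thesis using assms(1) unfolding smooth.simps by blast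
qed

lemma smooth_SucD: "smooth N d (Suc n) f \<Longrightarrow> smooth N d n f"
  by (induction n arbitrary: f) auto

lemma smooth_has_pderiv:
  assumes "smooth N d (Suc n) f" "i \<in> {1..N}" "u \<in> cube N d"
  shows "((\<lambda>t. f (u(i := t))) has_real_derivative pderiv_i i f u) (at (u i))"
proof -
  obtain D where D: "((\<lambda>t. f (u(i := t))) has_real_derivative D) (at (u i))"
    using assms unfolding smooth.simps by blast
  then show ?thesis unfolding pderiv_i_eqI[of f u i, OF D] .
qed

lemma smooth_const: "smooth N d n (\<lambda>_. c)"
proof (induction n arbitrary: c)
  case (Suc n)
  show ?case by (rule smooth_SucI[where D = "\<lambda>_ _. 0"]) (auto intro: Suc)
qed simp

lemma smooth_add: "smooth N d n f \<Longrightarrow> smooth N d n g \<Longrightarrow> smooth N d n (\<lambda>u. f u + g u)"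
proof (induction n arbitrary: f g)
  case (Suc n)
  show ?case
  proof (rule smooth_SucI[where D = "\<lambda>i u. pderiv_i i f u + pderiv_i i g u"])
    fix i u assume iu: "i \<in> {1..N}" "u \<in> cube N d"
    show "((\<lambda>t. f (u(i := t)) + g (u(i := t))) has_real_derivative pderiv_i i f u + pderiv_i i g u) (at (u i))"
      by (intro DERIV_add smooth_has_pderiv[OF Suc.prems(1) iu] smooth_has_pderiv[OF Suc.prems(2) iu])
  next
    fix i assume "i \<in> {1..N}"
    then show "smooth N d n (\<lambda>u. pderiv_i i f u + pderiv_i i g u)"
      using Suc.prems by (intro Suc.IH) auto
  qed
qed simp

lemma smooth_mult: "smooth N d n f \<Longrightarrow> smooth N d n g \<Longrightarrow> smooth N d n (\<lambda>u. f u * g u)"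
proof (induction n arbitrary: f g)
  case (Suc n)
  show ?case
  proof (rule smooth_SucI[where D = "\<lambda>i u. f u * pderiv_i i g u + g u * pderiv_i i f u"])
    fix i u assume iu: "i \<in> {1..N}" "u \<in> cube N d"
    show "((\<lambda>t. f (u(i := t)) * g (u(i := t))) has_real_derivative f u * pderiv_i i g u + g u * pderiv_i i f u) (at (u i))"
      by (rule DERIV_cong[OF DERIV_mult[OF smooth_has_pderiv[OF Suc.prems(1) iu] smooth_has_pderiv[OF Suc.prems(2) iu]]]) simp
  next
    fix i assume "i \<in> {1..N}"
    then show "smooth N d n (\<lambda>u. f u * pderiv_i i g u + g u * pderiv_i i f u)"
      using Suc.prems Suc.prems[THEN smooth_SucD] by (intro smooth_add Suc.IH) auto
  qed
qed simp

lemma smooth_inverse: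
  assumes "\<And>u. u \<in> cube N d \<Longrightarrow> f u \<noteq> 0" "smooth N d n f"
  shows "smooth N d n (\<lambda>u. inverse (f u))"
  using assms(2)
proof (induction n)
  case (Suc n)
  show ?case
  proof (rule smooth_SucI[where D = "\<lambda>i u. (-1) * (inverse (f u) * inverse (f u) * pderiv_i i f u)"])
    fix i u assume iu: "i \<in> {1..N}" "u \<in> cube N d"
    show "((\<lambda>t. inverse (f (u(i := t)))) has_real_derivative (-1) * (inverse (f u) * inverse (f u) * pderiv_i i f u)) (at (u i))"
      by (rule DERIV_cong[OF DERIV_inverse'[OF smooth_has_pderiv[OF Suc.prems iu]]]) (use assms(1)[OF iu(2)] in simp_all)
  next
    fix i assume iu: "i \<in> {1..N}"
    show "smooth N d n (\<lambda>u. (-1) * (inverse (f u) * inverse (f u) * pderiv_i i f u))"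
      by (intro smooth_mult smooth_const Suc.IH smooth_SucD[OF Suc.prems]) (use Suc.prems iu in auto)
  qed
qed simp

lemma ln_has_pderiv:
  assumes "f u > 0" "((\<lambda>t. f (u(i := t))) has_real_derivative D) (at (u i))"
  shows "((\<lambda>t. ln (f (u(i := t)))) has_real_derivative D * inverse (f u)) (at (u i))"
  by (rule DERIV_cong[OF DERIV_chain2[OF DERIV_ln[of "f (u(i := u i))"] assms(2)]]) (use assms(1) in simp_all)

lemma smooth_ln:
  assumes "\<And>u. u \<in> cube N d \<Longrightarrow> f u > 0" "\<And>n. smooth N d n f"
  shows "smooth N d n (\<lambda>u. ln (f u))"
proof (cases n)
  case (Suc k)
  show ?thesis unfolding Suc
  proof (rule smooth_SucI[where D = "\<lambda>i u. pderiv_i i f u * inverse (f u)"])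
    fix i u assume iu: "i \<in> {1..N}" "u \<in> cube N d"
    show "((\<lambda>t. ln (f (u(i := t)))) has_real_derivative pderiv_i i f u * inverse (f u)) (at (u i))"
      by (rule ln_has_pderiv[OF assms(1)[OF iu(2)] smooth_has_pderiv[OF assms(2) iu]])
  next
    fix i assume iu: "i \<in> {1..N}"
    have "f u \<noteq> 0" if "u \<in> cube N d" for u using assms(1)[OF that] by simp
    then show "smooth N d k (\<lambda>u. pderiv_i i f u * inverse (f u))"
      using assms(2)[of "Suc k"] assms(2)[of k] iu by (intro smooth_mult smooth_inverse) auto
  qed
qed simp

definition Smooth :: "nat \<Rightarrow> real \<Rightarrow> ((nat \<Rightarrow> real) \<Rightarrow> real) \<Rightarrow> bool" where
  "Smooth N d f \<longleftrightarrow> (\<forall>n. smooth N d n f)"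

lemma Smooth_pderiv: "Smooth N d f \<Longrightarrow> i \<in> {1..N} \<Longrightarrow> Smooth N d (pderiv_i i f)"
  unfolding Smooth_def by (metis smooth.simps(2))

lemma Smooth_pderivs: "Smooth N d f \<Longrightarrow> set is \<subseteq> {1..N} \<Longrightarrow> Smooth N d (pderivs is f)"
  by (induction "is") (auto intro: Smooth_pderiv)

lemma Smooth_mult: "Smooth N d f \<Longrightarrow> Smooth N d g \<Longrightarrow> Smooth N d (\<lambda>u. f u * g u)"
  unfolding Smooth_def by (blast intro: smooth_mult)

lemma Smooth_has_pderiv:
  "Smooth N d f \<Longrightarrow> i \<in> {1..N} \<Longrightarrow> u \<in> cube N d \<Longrightarrow>
    ((\<lambda>t. f (u(i := t))) has_real_derivative pderiv_i i f u) (at (u i))"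
  unfolding Smooth_def using smooth_has_pderiv by blast

lemma pderiv_i_mult:
  assumes "Smooth N d f" "Smooth N d g" "i \<in> {1..N}" "u \<in> cube N d"
  shows "pderiv_i i (\<lambda>u. f u * g u) u = f u * pderiv_i i g u + g u * pderiv_i i f u"
  by (rule pderiv_i_eqI, rule DERIV_cong[OF DERIV_mult[OF Smooth_has_pderiv[OF assms(1,3,4)] Smooth_has_pderiv[OF assms(2,3,4)]]]) simp

lemma pderiv_i_add:
  assumes "Smooth N d f" "Smooth N d g" "i \<in> {1..N}" "u \<in> cube N d"
  shows "pderiv_i i (\<lambda>u. f u + g u) u = pderiv_i i f u + pderiv_i i g u"
  by (rule pderiv_i_eqI, rule DERIV_add[OF Smooth_has_pderiv[OF assms(1,3,4)] Smooth_has_pderiv[OF assms(2,3,4)]])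

section \<open>Formal jets and their algebra\<close>

text \<open>Formally the p-th derivative at t = 0 of f (1 + t x), written out in iterated partial
  derivatives so that no chain rule in several variables is invoked.\<close>

primrec jetc :: "(nat \<Rightarrow> real) \<Rightarrow> nat \<Rightarrow> nat \<Rightarrow> ((nat \<Rightarrow> real) \<Rightarrow> real) \<Rightarrow> real" where
  "jetc x n 0 f = f ones"
| "jetc x n (Suc p) f = (\<Sum>i\<in>{1..n}. x i * jetc x n p (pderiv_i i f))"

definition jet :: "(nat \<Rightarrow> real) \<Rightarrow> nat \<Rightarrow> ((nat \<Rightarrow> real) \<Rightarrow> real) \<Rightarrow> real fps" where
  "jet x n f = Abs_fps (\<lambda>p. jetc x n p f / fact p)"

text \<open>The chain rule along the line, built into \<open>jetc\<close>; identities between jets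
  follow from it by induction on the coefficient.\<close>

lemma fps_deriv_jet: "fps_deriv (jet x n f) = (\<Sum>i\<in>{1..n}. fps_const (x i) * jet x n (pderiv_i i f))"
proof (rule fps_ext)
  fix p
  have "fps_nth (fps_deriv (jet x n f)) p = real (Suc p) * (jetc x n (Suc p) f / fact (Suc p))"
    by (simp add: jet_def del: jetc.simps fact_Suc)
  also have "\<dots> = jetc x n (Suc p) f / fact p"
    by (simp add: fact_Suc del: jetc.simps of_nat_Suc)
  finally show "fps_nth (fps_deriv (jet x n f)) p = fps_nth (\<Sum>i\<in>{1..n}. fps_const (x i) * jet x n (pderiv_i i f)) p"
    by (simp add: jet_def fps_sum_nth sum_divide_distrib)
qed

locale jets =
  fixes N n :: nat and d :: real and x :: "nat \<Rightarrow> real"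
  assumes nN: "n \<le> N" and d: "d > 0"
begin

lemma idx: "i \<in> {1..n} \<Longrightarrow> i \<in> {1..N}" using nN by auto

lemma jetc_cong: "(\<And>v. v \<in> cube N d \<Longrightarrow> f v = g v) \<Longrightarrow> jetc x n p f = jetc x n p g"
proof (induction p arbitrary: f g)
  case 0
  then show ?case using ones_in_cube[OF d] by simp
next
  case (Suc p)
  have "jetc x n p (pderiv_i i f) = jetc x n p (pderiv_i i g)" if "i \<in> {1..n}" for i
    by (rule Suc.IH) (rule pderiv_i_cong[OF Suc.prems _ idx[OF that]])
  then show ?case by simp
qed

lemma jet_cong: "(\<And>v. v \<in> cube N d \<Longrightarrow> f v = g v) \<Longrightarrow> jet x n f = jet x n g"
  unfolding jet_def using jetc_cong[of f g] by simp

lemma jet_add: "Smooth N d f \<Longrightarrow> Smooth N d g \<Longrightarrow> jet x n (\<lambda>u. f u + g u) = jet x n f + jet x n g"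
proof -
  have "jetc x n p (\<lambda>u. f u + g u) = jetc x n p f + jetc x n p g" if "Smooth N d f" "Smooth N d g" for p f g
    using that
  proof (induction p arbitrary: f g)
    case (Suc p)
    have "jetc x n p (pderiv_i i (\<lambda>u. f u + g u)) = jetc x n p (pderiv_i i f) + jetc x n p (pderiv_i i g)"
      if i: "i \<in> {1..n}" for i
    proof -
      have "jetc x n p (pderiv_i i (\<lambda>u. f u + g u)) = jetc x n p (\<lambda>u. pderiv_i i f u + pderiv_i i g u)"
        by (rule jetc_cong) (rule pderiv_i_add[OF Suc.prems idx[OF i]])
      also have "\<dots> = jetc x n p (pderiv_i i f) + jetc x n p (pderiv_i i g)"
        by (intro Suc.IH Smooth_pderiv Suc.prems idx i)
      finally show ?thesis .
    qed
    then show ?case by (simp add: distrib_left sum.distrib)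
  qed simp
  then show "Smooth N d f \<Longrightarrow> Smooth N d g \<Longrightarrow> jet x n (\<lambda>u. f u + g u) = jet x n f + jet x n g"
    by (auto simp: jet_def fps_eq_iff add_divide_distrib)
qed

lemma jet_const: "jet x n (\<lambda>_. c) = fps_const c"
proof -
  have z: "pderiv_i i (\<lambda>_. c) = (\<lambda>_. 0)" for i c by (simp add: fun_eq_iff pderiv_i_def)
  have "jetc x n p (\<lambda>_. 0) = 0" for p by (induction p) (simp_all add: z)
  then have "jetc x n p (\<lambda>_. c) = (if p = 0 then c else 0)" for p by (cases p) (simp_all add: z)
  then show ?thesis by (simp add: jet_def fps_eq_iff)
qed

lemma jet_mult: "Smooth N d f \<Longrightarrow> Smooth N d g \<Longrightarrow> jet x n (\<lambda>u. f u * g u) = jet x n f * jet x n g"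
proof -
  have "fps_nth (jet x n (\<lambda>u. f u * g u)) p = fps_nth (jet x n f * jet x n g) p"
    if "Smooth N d f" "Smooth N d g" for p f g
    using that
  proof (induction p arbitrary: f g)
    case 0
    then show ?case by (simp add: jet_def)
  next
    case (Suc p)
    have D: "fps_nth (jet x n (pderiv_i i (\<lambda>u. f u * g u))) p =
        fps_nth (jet x n f * jet x n (pderiv_i i g) + jet x n g * jet x n (pderiv_i i f)) p" if i: "i \<in> {1..n}" for i
    proof -
      have "jet x n (pderiv_i i (\<lambda>u. f u * g u)) = jet x n (\<lambda>u. f u * pderiv_i i g u + g u * pderiv_i i f u)"
        by (rule jet_cong) (rule pderiv_i_mult[OF Suc.prems idx[OF i]])
      also have "\<dots> = jet x n (\<lambda>u. f u * pderiv_i i g u) + jet x n (\<lambda>u. g u * pderiv_i i f u)"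
        by (intro jet_add Smooth_mult Smooth_pderiv Suc.prems idx i)
      finally show ?thesis
        using Suc.IH[OF Suc.prems(1) Smooth_pderiv[OF Suc.prems(2) idx[OF i]]]
          Suc.IH[OF Suc.prems(2) Smooth_pderiv[OF Suc.prems(1) idx[OF i]]] by simp
    qed
    have "fps_nth (fps_deriv (jet x n (\<lambda>u. f u * g u))) p =
       (\<Sum>i\<in>{1..n}. x i * fps_nth (jet x n f * jet x n (pderiv_i i g) + jet x n g * jet x n (pderiv_i i f)) p)"
      unfolding fps_deriv_jet fps_sum_nth fps_mult_left_const_nth by (intro sum.cong refl) (simp only: D)
    also have "\<dots> = fps_nth (fps_deriv (jet x n f * jet x n g)) p"
    proof -
      have "fps_deriv (jet x n f * jet x n g) =
        (\<Sum>i\<in>{1..n}. fps_const (x i) * (jet x n f * jet x n (pderiv_i i g) + jet x n g * jet x n (pderiv_i i f)))"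
        unfolding fps_deriv_mult fps_deriv_jet sum_distrib_left sum_distrib_right sum.distrib[symmetric]
        by (intro sum.cong refl) (simp add: algebra_simps)
      then show ?thesis by (simp only: fps_sum_nth fps_mult_left_const_nth)
    qed
    finally have "real (Suc p) * fps_nth (jet x n (\<lambda>u. f u * g u)) (Suc p) = real (Suc p) * fps_nth (jet x n f * jet x n g) (Suc p)"
      unfolding fps_deriv_nth by simp
    then show ?case by simp
  qed
  then show "Smooth N d f \<Longrightarrow> Smooth N d g \<Longrightarrow> jet x n (\<lambda>u. f u * g u) = jet x n f * jet x n g"
    by (simp add: fps_eq_iff)
qed

lemma jet_coordinate:
  assumes "i \<in> {1..n}"
  shows "jet x n (\<lambda>u. u i) = 1 + fps_const (x i) * fps_X"
proof -
  have p1: "pderiv_i j (\<lambda>u. u i) = (\<lambda>_. if j = i then 1 else 0)" for j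
    by (auto simp: fun_eq_iff pderiv_i_def)
  have "fps_deriv (jet x n (\<lambda>u. u i)) = fps_const (x i)"
    unfolding fps_deriv_jet p1 jet_const using assms
    by (simp add: if_distrib sum.delta' cong: if_cong)
  also have "\<dots> = fps_deriv (1 + fps_const (x i) * fps_X)" by simp
  finally have "jet x n (\<lambda>u. u i) = fps_const (fps_nth (jet x n (\<lambda>u. u i)) 0 - fps_nth (1 + fps_const (x i) * fps_X) 0) + (1 + fps_const (x i) * fps_X)"
    by (simp only: fps_deriv_eq_iff)
  then show ?thesis by (simp add: jet_def ones_def)
qed

text \<open>The full expansion in the \<open>i\<close>-th coordinate, with jets as coefficients.\<close>

definition ejet :: "nat \<Rightarrow> ((nat \<Rightarrow> real) \<Rightarrow> real) \<Rightarrow> real fps fps" where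
  "ejet i f = Abs_fps (\<lambda>r. fps_const (1 / fact r) * jet x n (pderivs (replicate r i) f))"

lemma pderivs_replicate_Suc: "pderivs (replicate (Suc r) i) f = pderivs (replicate r i) (pderiv_i i f)"
  by (induction r) simp_all

lemma pderivs_cong:
  "(\<And>v. v \<in> cube N d \<Longrightarrow> f v = g v) \<Longrightarrow> set is \<subseteq> {1..N} \<Longrightarrow> u \<in> cube N d \<Longrightarrow> pderivs is f u = pderivs is g u"
  by (induction "is" arbitrary: u) (auto intro!: pderiv_i_cong[of N d])

lemma ejet_cong: "(\<And>v. v \<in> cube N d \<Longrightarrow> f v = g v) \<Longrightarrow> i \<in> {1..N} \<Longrightarrow> ejet i f = ejet i g"
proof -
  assume "\<And>v. v \<in> cube N d \<Longrightarrow> f v = g v" "i \<in> {1..N}"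
  then have "jet x n (pderivs (replicate r i) f) = jet x n (pderivs (replicate r i) g)" for r
    by (intro jet_cong pderivs_cong) (auto simp: set_replicate_conv_if)
  then show ?thesis by (simp add: ejet_def)
qed

lemma fps_deriv_ejet: "fps_deriv (ejet i f) = ejet i (pderiv_i i f)"
proof (rule fps_ext)
  fix r
  have "(of_nat (Suc r) :: real fps) * fps_const (1 / fact (Suc r)) = fps_const (1 / fact r)"
    by (simp add: fps_of_nat[symmetric] del: of_nat_Suc)
  then show "fps_nth (fps_deriv (ejet i f)) r = fps_nth (ejet i (pderiv_i i f)) r"
    unfolding ejet_def fps_deriv_nth fps_nth_Abs_fps Suc_eq_plus1[symmetric] pderivs_replicate_Suc
    by (simp add: mult.assoc[symmetric] del: of_nat_Suc fact_Suc)
qed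

lemma pderivs_add:
  assumes "Smooth N d f" "Smooth N d g" "set is \<subseteq> {1..N}" "u \<in> cube N d"
  shows "pderivs is (\<lambda>u. f u + g u) u = pderivs is f u + pderivs is g u"
  using assms(3,4)
proof (induction "is" arbitrary: u)
  case (Cons i js)
  have "pderiv_i i (pderivs js (\<lambda>u. f u + g u)) u = pderiv_i i (\<lambda>u. pderivs js f u + pderivs js g u) u"
    by (rule pderiv_i_cong[of N d]) (use Cons in auto)
  also have "\<dots> = pderiv_i i (pderivs js f) u + pderiv_i i (pderivs js g) u"
    by (rule pderiv_i_add[of N d]) (use Cons assms Smooth_pderivs in auto)
  finally show ?case by simp
qed simp

lemma ejet_add:
  assumes "Smooth N d f" "Smooth N d g" "i \<in> {1..N}"
  shows "ejet i (\<lambda>u. f u + g u) = ejet i f + ejet i g"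
proof -
  have s: "set (replicate r i) \<subseteq> {1..N}" for r using assms(3) by (auto simp: set_replicate_conv_if)
  have "jet x n (pderivs (replicate r i) (\<lambda>u. f u + g u)) = jet x n (pderivs (replicate r i) f) + jet x n (pderivs (replicate r i) g)" for r
  proof -
    have "jet x n (pderivs (replicate r i) (\<lambda>u. f u + g u)) = jet x n (\<lambda>u. pderivs (replicate r i) f u + pderivs (replicate r i) g u)"
      by (rule jet_cong) (rule pderivs_add[OF assms(1,2) s])
    also have "\<dots> = jet x n (pderivs (replicate r i) f) + jet x n (pderivs (replicate r i) g)"
      by (intro jet_add Smooth_pderivs assms s)
    finally show ?thesis .
  qed
  then show ?thesis by (simp add: ejet_def fps_eq_iff[of "Abs_fps _"] distrib_left)
qed

lemma ejet_mult:
  assumes "Smooth N d f" "Smooth N d g" "i \<in> {1..N}"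
  shows "ejet i (\<lambda>u. f u * g u) = ejet i f * ejet i g"
proof -
  have "fps_nth (ejet i (\<lambda>u. f u * g u)) r = fps_nth (ejet i f * ejet i g) r"
    if "Smooth N d f" "Smooth N d g" for r f g
    using that
  proof (induction r arbitrary: f g)
    case 0
    then show ?case by (simp add: ejet_def jet_mult)
  next
    case (Suc r)
    have "ejet i (pderiv_i i (\<lambda>u. f u * g u)) = ejet i (\<lambda>u. f u * pderiv_i i g u + g u * pderiv_i i f u)"
      by (rule ejet_cong) (use pderiv_i_mult[OF Suc.prems assms(3)] assms(3) in auto)
    also have "\<dots> = ejet i (\<lambda>u. f u * pderiv_i i g u) + ejet i (\<lambda>u. g u * pderiv_i i f u)"
      by (intro ejet_add Smooth_mult Smooth_pderiv Suc.prems assms(3))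
    finally have "fps_nth (fps_deriv (ejet i (\<lambda>u. f u * g u))) r = fps_nth (ejet i f * ejet i (pderiv_i i g) + ejet i g * ejet i (pderiv_i i f)) r"
      unfolding fps_deriv_ejet
      using Suc.IH[OF Suc.prems(1) Smooth_pderiv[OF Suc.prems(2) assms(3)]]
          Suc.IH[OF Suc.prems(2) Smooth_pderiv[OF Suc.prems(1) assms(3)]] by simp
    also have "\<dots> = fps_nth (fps_deriv (ejet i f * ejet i g)) r"
      by (simp only: fps_deriv_mult fps_deriv_ejet mult.commute)
    finally have "(of_nat (Suc r) :: real fps) * fps_nth (ejet i (\<lambda>u. f u * g u)) (Suc r) = of_nat (Suc r) * fps_nth (ejet i f * ejet i g) (Suc r)"
      unfolding fps_deriv_nth by simp
    then show ?case
      by (metis mult_cancel_left of_nat_eq_0_iff nat.distinct(1))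
  qed
  then show ?thesis using assms by (simp add: fps_eq_iff[of "ejet i _"])
qed

text \<open>Comparison of coefficients in S' = S L', read as series in the coordinate i whose
  coefficients are jets along the line.\<close>

lemma jet_log_recursion:
  assumes S: "Smooth N d S" and L: "Smooth N d L" and i: "i \<in> {1..N}"
    and SL: "\<And>u. u \<in> cube N d \<Longrightarrow> pderiv_i i S u = S u * pderiv_i i L u"
  shows "of_nat (Suc r) * fps_nth (ejet i S) (Suc r) =
    (\<Sum>b\<le>r. of_nat (Suc b) * (fps_nth (ejet i L) (Suc b) * fps_nth (ejet i S) (r - b)))"
proof -
  have "fps_deriv (ejet i S) = fps_deriv (ejet i L) * ejet i S"
    unfolding fps_deriv_ejet
    using ejet_cong[OF SL i] ejet_mult[OF S Smooth_pderiv[OF L i] i] by (simp add: mult.commute)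
  then have "fps_nth (fps_deriv (ejet i S)) r = fps_nth (fps_deriv (ejet i L) * ejet i S) r" by simp
  then show ?thesis
    unfolding fps_mult_nth fps_deriv_nth atMost_atLeast0 by (simp add: mult.assoc)
qed

end

subsection \<open>Differentiating expectations of Laurent monomials\<close>

text \<open>With \<theta> = \<phi>^2, one factor \<phi>^k absorbs one power of 1 + k and the other
  is left to the induction.\<close>

lemma poly_geometric_bounded:
  "0 \<le> \<theta> \<Longrightarrow> \<theta> < 1 \<Longrightarrow> \<exists>C\<ge>0. \<forall>k. (1 + real k) ^ d * \<theta> ^ k \<le> C"
proof (induction d arbitrary: \<theta>)
  case 0
  then show ?case by (intro exI[of _ 1]) (auto simp: power_le_one)
next
  case (Suc d)
  define \<phi> where "\<phi> = sqrt \<theta>"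
  have \<phi>: "0 \<le> \<phi>" "\<phi> < 1" "\<phi> * \<phi> = \<theta>" using Suc.prems by (auto simp: \<phi>_def real_sqrt_lt_1_iff)
  obtain C where C: "C \<ge> 0" "\<And>k. (1 + real k) ^ d * \<phi> ^ k \<le> C" using Suc.IH[OF \<phi>(1,2)] by blast
  have "(\<lambda>k. real k * \<phi> ^ k) \<longlonglongrightarrow> 0" using powser_times_n_limit_0[of \<phi>] \<phi> by simp
  then have "Bseq (\<lambda>k. real k * \<phi> ^ k)" by (intro convergent_imp_Bseq convergentI)
  then obtain D where D: "D > 0" "\<And>k. norm (real k * \<phi> ^ k) \<le> D" by (rule BseqE) blast
  have B: "(1 + real k) * \<phi> ^ k \<le> 1 + D" for k
  proof -
    have "\<phi> ^ k \<le> 1" using \<phi> by (simp add: power_le_one)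
    moreover have "real k * \<phi> ^ k \<le> D" using D(2)[of k] \<phi>(1) by simp
    ultimately show ?thesis by (simp add: algebra_simps)
  qed
  have "(1 + real k) ^ Suc d * \<theta> ^ k \<le> C * (1 + D)" for k
  proof -
    have "(1 + real k) ^ Suc d * \<theta> ^ k = ((1 + real k) ^ d * \<phi> ^ k) * ((1 + real k) * \<phi> ^ k)"
      unfolding \<phi>(3)[symmetric] power_mult_distrib by (simp add: mult_ac)
    also have "\<dots> \<le> C * (1 + D)" by (rule mult_mono) (use C B \<phi> in auto)
    finally show ?thesis .
  qed
  then show ?case using C(1) D(1) by (intro exI[of _ "C * (1 + D)"]) auto
qed

text \<open>A larger neighbourhood pays for the polynomial factor: nonnegative n are dominated at 1
  + e2, negative n at 1 - e2.\<close>

lemma power_int_poly_bound: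
  assumes e: "0 < e1" "e1 < e2" "e2 < (1::real)"
  shows "\<exists>C\<ge>0. \<forall>n t. \<bar>t - 1\<bar> \<le> e1 \<longrightarrow>
    (1 + \<bar>real_of_int n\<bar>) ^ d * t powi n \<le> C * ((1 - e2) powi n + (1 + e2) powi n)"
proof -
  obtain C1 where C1: "C1 \<ge> 0" "\<And>k. (1 + real k) ^ d * ((1 + e1) / (1 + e2)) ^ k \<le> C1"
    using poly_geometric_bounded[of "(1 + e1) / (1 + e2)" d] e by (auto simp: field_simps)
  obtain C2 where C2: "C2 \<ge> 0" "\<And>k. (1 + real k) ^ d * ((1 - e2) / (1 - e1)) ^ k \<le> C2"
    using poly_geometric_bounded[of "(1 - e2) / (1 - e1)" d] e by (auto simp: field_simps)
  have "(1 + \<bar>real_of_int n\<bar>) ^ d * t powi n \<le> (C1 + C2) * ((1 - e2) powi n + (1 + e2) powi n)"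
    if t: "\<bar>t - 1\<bar> \<le> e1" for n t
  proof -
    have tp: "t > 0" "t \<le> 1 + e1" "1 - e1 \<le> t" using t e by auto
    have pos: "(1 - e2) powi n > 0" "(1 + e2) powi n > 0" using e by (auto intro: zero_less_power_int)
    show ?thesis
    proof (cases "n \<ge> 0")
      case True
      then obtain k where k: "n = int k" using nonneg_int_cases by blast
      have "(1 + real k) ^ d * t ^ k \<le> (1 + real k) ^ d * (1 + e1) ^ k"
        by (intro mult_left_mono power_mono) (use tp in auto)
      also have "\<dots> = ((1 + real k) ^ d * ((1 + e1) / (1 + e2)) ^ k) * (1 + e2) ^ k"
        using e by (simp add: power_divide)
      also have "\<dots> \<le> C1 * (1 + e2) ^ k" by (intro mult_right_mono C1) (use e in auto)
      also have "\<dots> \<le> (C1 + C2) * ((1 - e2) powi n + (1 + e2) powi n)"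
        using C1 C2 pos k by (intro mult_mono) auto
      finally show ?thesis using k by simp
    next
      case False
      define k where "k = nat (- n)"
      have k: "n = - int k" using False by (simp add: k_def)
      have "(1 + real k) ^ d * inverse t ^ k \<le> (1 + real k) ^ d * inverse (1 - e1) ^ k"
        by (intro mult_left_mono power_mono) (use tp e in \<open>auto intro: le_imp_inverse_le\<close>)
      also have "\<dots> = ((1 + real k) ^ d * ((1 - e2) / (1 - e1)) ^ k) * inverse (1 - e2) ^ k"
        using e by (simp add: power_divide power_inverse divide_simps)
      also have "\<dots> \<le> C2 * inverse (1 - e2) ^ k" by (intro mult_right_mono C2) (use e in auto)
      also have "\<dots> \<le> (C1 + C2) * ((1 - e2) powi n + (1 + e2) powi n)"
        using C1 C2 pos k by (intro mult_mono) (auto simp: power_int_minus power_inverse)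
      finally show ?thesis using k by (simp add: power_int_minus power_inverse)
    qed
  qed
  then show ?thesis using C1(1) C2(1) by (intro exI[of _ "C1 + C2"]) auto
qed

text \<open>The mean value theorem bounds the difference quotients by w, so dominated convergence
  applies along every sequence tending to t0.\<close>

lemma has_derivative_expectation:
  fixes g g' :: "real \<Rightarrow> 'a \<Rightarrow> real" and p :: "'a pmf"
  assumes \<delta>: "\<delta> > 0"
    and int: "\<And>t. \<bar>t - t0\<bar> < \<delta> \<Longrightarrow> integrable (measure_pmf p) (g t)"
    and der: "\<And>t x. \<bar>t - t0\<bar> < \<delta> \<Longrightarrow> ((\<lambda>t. g t x) has_real_derivative g' t x) (at t)"
    and bd: "\<And>t x. \<bar>t - t0\<bar> < \<delta> \<Longrightarrow> \<bar>g' t x\<bar> \<le> w x"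
    and w: "integrable (measure_pmf p) w"
  shows "((\<lambda>t. measure_pmf.expectation p (g t)) has_real_derivative measure_pmf.expectation p (g' t0)) (at t0)"
  unfolding has_field_derivative_iff tendsto_at_iff_sequentially
proof (intro allI impI)
  fix X assume X: "\<forall>i. X i \<in> UNIV - {t0}" "X \<longlonglongrightarrow> t0"
  have "eventually (\<lambda>n. \<bar>X n - t0\<bar> < \<delta>) sequentially"
    using X(2) \<delta> by (auto simp: tendsto_iff dist_real_def)
  then obtain n0 where "\<forall>n\<ge>n0. \<bar>X n - t0\<bar> < \<delta>"
    unfolding eventually_sequentially by blast
  then have n0: "\<And>n. \<bar>X (n + n0) - t0\<bar> < \<delta>" by simp
  define Y where "Y n = X (n + n0)" for n
  have Y: "Y n \<noteq> t0" "\<bar>Y n - t0\<bar> < \<delta>" for n using X(1) n0 by (auto simp: Y_def)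
  have Yl: "Y \<longlonglongrightarrow> t0" unfolding Y_def using X(2) by (rule LIMSEQ_ignore_initial_segment)
  have t0: "\<bar>t0 - t0\<bar> < \<delta>" using \<delta> by simp
  have lim: "(\<lambda>n. measure_pmf.expectation p (\<lambda>x. (g (Y n) x - g t0 x) / (Y n - t0))) \<longlonglongrightarrow> measure_pmf.expectation p (g' t0)"
  proof (rule integral_dominated_convergence[where w = w])
    show "AE x in measure_pmf p. (\<lambda>n. (g (Y n) x - g t0 x) / (Y n - t0)) \<longlonglongrightarrow> g' t0 x"
    proof (rule AE_I2)
      fix x
      have "((\<lambda>t. (g t x - g t0 x) / (t - t0)) \<longlongrightarrow> g' t0 x) (at t0)"
        using der[OF t0] by (simp add: has_field_derivative_iff)
      moreover have "filterlim Y (at t0) sequentially"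
        using Yl Y(1) by (simp add: filterlim_at)
      ultimately show "(\<lambda>n. (g (Y n) x - g t0 x) / (Y n - t0)) \<longlonglongrightarrow> g' t0 x"
        by (rule filterlim_compose)
    qed
    show "AE x in measure_pmf p. norm ((g (Y n) x - g t0 x) / (Y n - t0)) \<le> w x" for n
    proof (rule AE_I2)
      fix x
      have "norm (g (Y n) x - g t0 x) \<le> w x * norm (Y n - t0)"
      proof (rule field_differentiable_bound[where S = "ball t0 \<delta>" and f' = "\<lambda>t. g' t x"])
        fix t assume "t \<in> ball t0 \<delta>"
        then have t: "\<bar>t - t0\<bar> < \<delta>" by (simp add: dist_real_def abs_minus_commute)
        show "((\<lambda>t. g t x) has_field_derivative g' t x) (at t within ball t0 \<delta>)"
          using der[OF t] by (rule has_field_derivative_at_within)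
        show "norm (g' t x) \<le> w x" using bd[OF t] by simp
      qed (use Y \<delta> in \<open>auto simp: dist_real_def abs_minus_commute\<close>)
      then show "norm ((g (Y n) x - g t0 x) / (Y n - t0)) \<le> w x"
        using Y(1)[of n] by (simp add: norm_divide divide_simps mult.commute)
    qed
  qed (use w in auto)
  have eqn: "measure_pmf.expectation p (\<lambda>x. (g (Y n) x - g t0 x) / (Y n - t0)) =
      (measure_pmf.expectation p (g (Y n)) - measure_pmf.expectation p (g t0)) / (Y n - t0)" for n
    using int[OF Y(2)] int[OF t0] by simp
  have "(\<lambda>n. (measure_pmf.expectation p (g (X (n + n0))) - measure_pmf.expectation p (g t0)) / (X (n + n0) - t0)) \<longlonglongrightarrow> measure_pmf.expectation p (g' t0)"
    using lim unfolding eqn unfolding Y_def .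
  from LIMSEQ_offset[OF this]
  show "((\<lambda>t. (measure_pmf.expectation p (g t) - measure_pmf.expectation p (g t0)) / (t - t0)) \<circ> X) \<longlonglongrightarrow> measure_pmf.expectation p (g' t0)"
    by (simp add: comp_def)
qed

section \<open>Expectations of monomials with polynomially bounded weights\<close>

text \<open>A class closed under sums and products that contains the exponents; differentiating a
  monomial multiplies its weight by an exponent and so stays inside.\<close>

definition poly_bounded :: "nat \<Rightarrow> ((nat \<Rightarrow> int) \<Rightarrow> real) \<Rightarrow> bool" where
  "poly_bounded N P \<longleftrightarrow> (\<exists>C d. C \<ge> 0 \<and> (\<forall>\<nu>. \<bar>P \<nu>\<bar> \<le> C * (\<Prod>a\<in>{1..N}. (1 + \<bar>real_of_int (\<nu> a)\<bar>) ^ d)))"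

lemma poly_bounded_const: "poly_bounded N (\<lambda>_. c)"
  unfolding poly_bounded_def by (intro exI[of _ "\<bar>c\<bar>"] exI[of _ 0]) simp

lemma poly_bounded_coordinate:
  assumes "i \<in> {1..N}"
  shows "poly_bounded N (\<lambda>\<nu>. real_of_int (\<nu> i))"
proof -
  have "\<bar>real_of_int (\<nu> i)\<bar> \<le> (\<Prod>a\<in>{1..N}. (1 + \<bar>real_of_int (\<nu> a)\<bar>) ^ 1)" for \<nu>
  proof -
    have "\<bar>real_of_int (\<nu> i)\<bar> \<le> (1 + \<bar>real_of_int (\<nu> i)\<bar>) ^ 1 * 1" by simp
    also have "\<dots> \<le> (1 + \<bar>real_of_int (\<nu> i)\<bar>) ^ 1 * (\<Prod>a\<in>{1..N} - {i}. (1 + \<bar>real_of_int (\<nu> a)\<bar>) ^ 1)"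
      by (intro mult_left_mono prod_ge_1) auto
    also have "\<dots> = (\<Prod>a\<in>{1..N}. (1 + \<bar>real_of_int (\<nu> a)\<bar>) ^ 1)"
      by (rule prod.remove[symmetric]) (use assms in auto)
    finally show ?thesis .
  qed
  then show ?thesis unfolding poly_bounded_def by (intro exI[of _ 1] exI[of _ 1]) simp
qed

lemma poly_bounded_add:
  assumes "poly_bounded N P" "poly_bounded N Q"
  shows "poly_bounded N (\<lambda>\<nu>. P \<nu> + Q \<nu>)"
proof -
  obtain C d where P: "C \<ge> 0" "\<And>\<nu>. \<bar>P \<nu>\<bar> \<le> C * (\<Prod>a\<in>{1..N}. (1 + \<bar>real_of_int (\<nu> a)\<bar>) ^ d)"
    using assms(1) unfolding poly_bounded_def by blast
  obtain C' d' where Q: "C' \<ge> 0" "\<And>\<nu>. \<bar>Q \<nu>\<bar> \<le> C' * (\<Prod>a\<in>{1..N}. (1 + \<bar>real_of_int (\<nu> a)\<bar>) ^ d')"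
    using assms(2) unfolding poly_bounded_def by blast
  let ?p = "\<lambda>d \<nu>. \<Prod>a\<in>{1..N}. (1 + \<bar>real_of_int (\<nu> a)\<bar>) ^ d"
  have mono: "?p d1 \<nu> \<le> ?p (d + d') \<nu>" if "d1 \<le> d + d'" for d1 \<nu>
    by (intro prod_mono conjI power_increasing) (use that in auto)
  have "\<bar>P \<nu> + Q \<nu>\<bar> \<le> (C + C') * ?p (d + d') \<nu>" for \<nu>
  proof -
    have "\<bar>P \<nu> + Q \<nu>\<bar> \<le> C * ?p d \<nu> + C' * ?p d' \<nu>" using P(2)[of \<nu>] Q(2)[of \<nu>] by linarith
    also have "\<dots> \<le> C * ?p (d + d') \<nu> + C' * ?p (d + d') \<nu>"
      by (intro add_mono mult_left_mono mono) (use P Q in auto)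
    finally show ?thesis by (simp add: distrib_right)
  qed
  then show ?thesis using P(1) Q(1) unfolding poly_bounded_def by (intro exI[of _ "C + C'"] exI[of _ "d + d'"]) simp
qed

lemma poly_bounded_mult:
  assumes "poly_bounded N P" "poly_bounded N Q"
  shows "poly_bounded N (\<lambda>\<nu>. P \<nu> * Q \<nu>)"
proof -
  obtain C d where P: "C \<ge> 0" "\<And>\<nu>. \<bar>P \<nu>\<bar> \<le> C * (\<Prod>a\<in>{1..N}. (1 + \<bar>real_of_int (\<nu> a)\<bar>) ^ d)"
    using assms(1) unfolding poly_bounded_def by blast
  obtain C' d' where Q: "C' \<ge> 0" "\<And>\<nu>. \<bar>Q \<nu>\<bar> \<le> C' * (\<Prod>a\<in>{1..N}. (1 + \<bar>real_of_int (\<nu> a)\<bar>) ^ d')"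
    using assms(2) unfolding poly_bounded_def by blast
  let ?p = "\<lambda>d \<nu>. \<Prod>a\<in>{1..N}. (1 + \<bar>real_of_int (\<nu> a)\<bar>) ^ d"
  have "\<bar>P \<nu> * Q \<nu>\<bar> \<le> (C * C') * ?p (d + d') \<nu>" for \<nu>
  proof -
    have "0 \<le> C * ?p d \<nu>" using P(1) by (intro mult_nonneg_nonneg prod_nonneg) auto
    then have "\<bar>P \<nu> * Q \<nu>\<bar> \<le> (C * ?p d \<nu>) * (C' * ?p d' \<nu>)"
      unfolding abs_mult by (intro mult_mono P Q) auto
    then show ?thesis by (simp add: power_add prod.distrib mult_ac)
  qed
  then show ?thesis using P(1) Q(1) unfolding poly_bounded_def by (intro exI[of _ "C * C'"] exI[of _ "d + d'"]) simp
qed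

lemma poly_bounded_sum:
  "(\<And>s. s \<in> A \<Longrightarrow> poly_bounded N (P s)) \<Longrightarrow> poly_bounded N (\<lambda>\<nu>. \<Sum>s\<in>A. P s \<nu>)"
  by (induction A rule: infinite_finite_induct) (auto intro: poly_bounded_add poly_bounded_const)

lemma poly_bounded_gbinomial:
  assumes "i \<in> {1..N}"
  shows "poly_bounded N (\<lambda>\<nu>. real_of_int (\<nu> i) gchoose r)"
proof (induction r)
  case 0
  then show ?case by (simp add: poly_bounded_const)
next
  case (Suc r)
  have "(real_of_int (\<nu> i) gchoose Suc r) = (1 / real (Suc r)) * ((real_of_int (\<nu> i) + (- real r)) * (real_of_int (\<nu> i) gchoose r))" for \<nu>
    using gbinomial_mult_1[of "real_of_int (\<nu> i)" r] by (simp add: field_simps)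
  then show ?case
    by (simp only:) (intro poly_bounded_mult poly_bounded_add poly_bounded_const poly_bounded_coordinate assms Suc)
qed

text \<open>\<open>\<mu> l\<close> lists \<open>nn l\<close> exponent vectors for the signature l.
  With P = 1, \<open>h\<close> will be the normalised Schur function and \<open>F\<close> the Schur
  generating function.\<close>

locale weighted_sums =
  fixes N :: nat and rho :: "int list pmf" and nn :: "int list \<Rightarrow> nat"
    and \<mu> :: "int list \<Rightarrow> nat \<Rightarrow> nat \<Rightarrow> int" and e :: real
begin

definition h :: "((nat \<Rightarrow> int) \<Rightarrow> real) \<Rightarrow> int list \<Rightarrow> (nat \<Rightarrow> real) \<Rightarrow> real" where
  "h P l u = (\<Sum>t<nn l. P (\<mu> l t) * (\<Prod>a\<in>{1..N}. u a powi \<mu> l t a)) / real (nn l)"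

definition F :: "((nat \<Rightarrow> int) \<Rightarrow> real) \<Rightarrow> (nat \<Rightarrow> real) \<Rightarrow> real" where
  "F P u = measure_pmf.expectation rho (\<lambda>l. h P l u)"

end

locale integrable_weighted_sums = weighted_sums +
  assumes e: "0 < e" "e < 1"
    and int1: "\<And>u. u \<in> cube N e \<Longrightarrow> integrable (measure_pmf rho) (\<lambda>l. h (\<lambda>_. 1) l u)"
begin

text \<open>The normalised Schur functions summed over the corners of the cube of half-width e/2.
  Whatever the signs of its exponents, a monomial on a smaller cube is dominated at some
  corner.\<close>

definition bnd :: "int list \<Rightarrow> real" where
  "bnd l = (\<Sum>c\<in>Pi\<^sub>E {1..N} (\<lambda>_. {1 - e / 2, 1 + e / 2}). h (\<lambda>_. 1) l c)"

lemma integrable_bnd: "integrable (measure_pmf rho) bnd"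
proof -
  have "c \<in> cube N e" if "c \<in> Pi\<^sub>E {1..N} (\<lambda>_. {1 - e / 2, 1 + e / 2})" for c
    unfolding cube_def
  proof (intro CollectI ballI)
    fix i assume "i \<in> {1..N}"
    then have "c i \<in> {1 - e / 2, 1 + e / 2}" using that by (rule PiE_mem[rotated])
    then show "\<bar>c i - 1\<bar> < e" using e by auto
  qed
  then show ?thesis unfolding bnd_def by (intro Bochner_Integration.integrable_sum int1)
qed

lemma cube_pos: "u \<in> cube N (e / 3) \<Longrightarrow> a \<in> {1..N} \<Longrightarrow> u a > 1 / 2"
proof -
  assume "u \<in> cube N (e / 3)" "a \<in> {1..N}"
  then have "\<bar>u a - 1\<bar> < e / 3" unfolding cube_def by blast
  then show ?thesis using e by (simp add: abs_if split: if_splits)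
qed

text \<open>The bound in one variable is applied in each coordinate, and the product of two-term
  sums is expanded over the corners; the polynomial factor is paid for by passing from e/3 to
  e/2.\<close>

lemma h_bound:
  assumes "poly_bounded N P"
  shows "\<exists>C\<ge>0. \<forall>u l. u \<in> cube N (e / 3) \<longrightarrow> \<bar>h P l u\<bar> \<le> C * bnd l"
proof -
  obtain C0 d where P: "C0 \<ge> 0" "\<And>\<nu>. \<bar>P \<nu>\<bar> \<le> C0 * (\<Prod>a\<in>{1..N}. (1 + \<bar>real_of_int (\<nu> a)\<bar>) ^ d)"
    using assms unfolding poly_bounded_def by blast
  obtain C1 where C1: "C1 \<ge> 0" "\<And>n t. \<bar>t - 1\<bar> \<le> e / 3 \<Longrightarrow>
    (1 + \<bar>real_of_int n\<bar>) ^ d * t powi n \<le> C1 * ((1 - e / 2) powi n + (1 + e / 2) powi n)"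
    using power_int_poly_bound[of "e / 3" "e / 2" d] e by auto
  let ?C = "Pi\<^sub>E {1..N} (\<lambda>_. {1 - e / 2, 1 + e / 2})"
  have mono: "\<bar>P \<nu>\<bar> * (\<Prod>a\<in>{1..N}. u a powi \<nu> a) \<le> C0 * C1 ^ N * (\<Sum>c\<in>?C. \<Prod>a\<in>{1..N}. c a powi \<nu> a)"
    if u: "u \<in> cube N (e / 3)" for u \<nu>
  proof -
    have pos: "u a > 0" if "a \<in> {1..N}" for a using cube_pos[OF u that] by simp
    have "\<bar>P \<nu>\<bar> * (\<Prod>a\<in>{1..N}. u a powi \<nu> a) \<le> (C0 * (\<Prod>a\<in>{1..N}. (1 + \<bar>real_of_int (\<nu> a)\<bar>) ^ d)) * (\<Prod>a\<in>{1..N}. u a powi \<nu> a)"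
      by (intro mult_right_mono P prod_nonneg) (use pos in \<open>auto intro: less_imp_le zero_le_power_int\<close>)
    also have "\<dots> = C0 * (\<Prod>a\<in>{1..N}. (1 + \<bar>real_of_int (\<nu> a)\<bar>) ^ d * u a powi \<nu> a)"
      by (simp add: prod.distrib)
    also have "\<dots> \<le> C0 * (\<Prod>a\<in>{1..N}. C1 * (\<Sum>y\<in>{1 - e / 2, 1 + e / 2}. y powi \<nu> a))"
    proof (intro mult_left_mono prod_mono conjI P(1))
      fix a assume a: "a \<in> {1..N}"
      show "0 \<le> (1 + \<bar>real_of_int (\<nu> a)\<bar>) ^ d * u a powi \<nu> a"
        using pos[OF a] by (intro mult_nonneg_nonneg) (auto intro: zero_le_power_int)
      have "\<bar>u a - 1\<bar> \<le> e / 3" using u a unfolding cube_def by fastforce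
      from C1(2)[OF this, of "\<nu> a"]
      show "(1 + \<bar>real_of_int (\<nu> a)\<bar>) ^ d * u a powi \<nu> a \<le> C1 * (\<Sum>y\<in>{1 - e / 2, 1 + e / 2}. y powi \<nu> a)"
        using e by simp
    qed
    also have "\<dots> = C0 * C1 ^ N * (\<Prod>a\<in>{1..N}. \<Sum>y\<in>{1 - e / 2, 1 + e / 2}. y powi \<nu> a)"
      by (simp only: prod.distrib prod_constant card_atLeastAtMost mult.assoc) simp
    also have "(\<Prod>a\<in>{1..N}. \<Sum>y\<in>{1 - e / 2, 1 + e / 2}. y powi \<nu> a) = (\<Sum>c\<in>?C. \<Prod>a\<in>{1..N}. c a powi \<nu> a)"
      by (rule prod_sum_PiE) auto
    finally show ?thesis .
  qed
  have "\<bar>h P l u\<bar> \<le> C0 * C1 ^ N * bnd l" if u: "u \<in> cube N (e / 3)" for u l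
  proof -
    have pos: "u a > 0" if "a \<in> {1..N}" for a using cube_pos[OF u that] by simp
    have "\<bar>\<Sum>t<nn l. P (\<mu> l t) * (\<Prod>a\<in>{1..N}. u a powi \<mu> l t a)\<bar> \<le> (\<Sum>t<nn l. \<bar>P (\<mu> l t) * (\<Prod>a\<in>{1..N}. u a powi \<mu> l t a)\<bar>)"
      by (rule sum_abs)
    also have "\<dots> = (\<Sum>t<nn l. \<bar>P (\<mu> l t)\<bar> * (\<Prod>a\<in>{1..N}. u a powi \<mu> l t a))"
    proof (intro sum.cong refl)
      fix t
      have "0 \<le> (\<Prod>a\<in>{1..N}. u a powi \<mu> l t a)"
        by (intro prod_nonneg) (use pos in \<open>auto intro: less_imp_le zero_le_power_int\<close>)
      then show "\<bar>P (\<mu> l t) * (\<Prod>a\<in>{1..N}. u a powi \<mu> l t a)\<bar> = \<bar>P (\<mu> l t)\<bar> * (\<Prod>a\<in>{1..N}. u a powi \<mu> l t a)"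
        by (simp add: abs_mult)
    qed
    also have "\<dots> \<le> (\<Sum>t<nn l. C0 * C1 ^ N * (\<Sum>c\<in>?C. \<Prod>a\<in>{1..N}. c a powi \<mu> l t a))"
      by (intro sum_mono mono u)
    finally have "\<bar>h P l u\<bar> \<le> (\<Sum>t<nn l. C0 * C1 ^ N * (\<Sum>c\<in>?C. \<Prod>a\<in>{1..N}. c a powi \<mu> l t a)) / real (nn l)"
      unfolding h_def abs_divide by (simp add: divide_right_mono)
    also have "\<dots> = C0 * C1 ^ N * bnd l"
      unfolding bnd_def h_def sum_divide_distrib[symmetric] sum_distrib_left[symmetric]
      by (subst sum.swap) simp
    finally show ?thesis .
  qed
  then show ?thesis using P(1) C1(1) by (intro exI[of _ "C0 * C1 ^ N"]) auto
qed

lemma integrable_h: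
  assumes "poly_bounded N P" "u \<in> cube N (e / 3)"
  shows "integrable (measure_pmf rho) (\<lambda>l. h P l u)"
proof -
  obtain C where C: "C \<ge> 0" "\<And>l. \<bar>h P l u\<bar> \<le> C * bnd l" using h_bound[OF assms(1)] assms(2) by blast
  show ?thesis
  proof (rule Bochner_Integration.integrable_bound)
    show "integrable (measure_pmf rho) (\<lambda>l. C * bnd l)" using integrable_bnd by simp
    have "\<bar>h P l u\<bar> \<le> norm (C * bnd l)" for l using C(2)[of l] by simp
    then show "AE l in measure_pmf rho. norm (h P l u) \<le> norm (C * bnd l)" by simp
  qed simp
qed

lemma F_add:
  assumes "poly_bounded N P" "poly_bounded N Q" "u \<in> cube N (e / 3)"
  shows "F (\<lambda>\<nu>. P \<nu> + Q \<nu>) u = F P u + F Q u"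
proof -
  have "h (\<lambda>\<nu>. P \<nu> + Q \<nu>) l u = h P l u + h Q l u" for l
    by (simp add: h_def distrib_right sum.distrib add_divide_distrib)
  then show ?thesis unfolding F_def using integrable_h assms by simp
qed

lemma F_cmult: "F (\<lambda>\<nu>. c * P \<nu>) u = c * F P u"
proof -
  have "h (\<lambda>\<nu>. c * P \<nu>) l u = c * h P l u" for l
    by (simp add: h_def sum_distrib_left mult.assoc)
  then show ?thesis unfolding F_def by simp
qed

lemma F_sum:
  assumes "\<And>s. s \<in> A \<Longrightarrow> poly_bounded N (P s)" "u \<in> cube N (e / 3)"
  shows "F (\<lambda>\<nu>. \<Sum>s\<in>A. P s \<nu>) u = (\<Sum>s\<in>A. F (P s) u)"
proof -
  have 0: "F (\<lambda>_. 0) u = 0" using F_cmult[of 0 "\<lambda>_. 0"] by simp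
  show ?thesis using assms(1)
    by (induction A rule: infinite_finite_induct) (auto simp: 0 F_add poly_bounded_sum assms(2))
qed

text \<open>u_i times the i-th partial derivative multiplies a monomial by its i-th exponent. As u_i
  > 1/2 on the small cube, \<open>bnd\<close> dominates the derivative.\<close>

lemma F_has_pderiv:
  assumes P: "poly_bounded N P" and i: "i \<in> {1..N}" and u: "u \<in> cube N (e / 3)"
  shows "((\<lambda>t. F P (u(i := t))) has_real_derivative inverse (u i) * F (\<lambda>\<nu>. real_of_int (\<nu> i) * P \<nu>) u) (at (u i))"
proof -
  let ?Q = "\<lambda>\<nu>. real_of_int (\<nu> i) * P \<nu>"
  have Q: "poly_bounded N ?Q" by (intro poly_bounded_mult poly_bounded_coordinate P i)
  obtain C where C: "C \<ge> 0" "\<And>u l. u \<in> cube N (e / 3) \<Longrightarrow> \<bar>h ?Q l u\<bar> \<le> C * bnd l" using h_bound[OF Q] by blast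
  define \<delta> where "\<delta> = e / 3 - \<bar>u i - 1\<bar>"
  have \<delta>: "\<delta> > 0" using u i unfolding cube_def \<delta>_def by auto
  have uc: "u(i := t) \<in> cube N (e / 3)" if "\<bar>t - u i\<bar> < \<delta>" for t
    unfolding cube_def
  proof (intro CollectI ballI)
    fix a assume "a \<in> {1..N}"
    then have "\<bar>u a - 1\<bar> < e / 3" using u unfolding cube_def by blast
    moreover have "\<bar>t - 1\<bar> < e / 3" using that unfolding \<delta>_def by linarith
    ultimately show "\<bar>(u(i := t)) a - 1\<bar> < e / 3" by simp
  qed
  have tpos: "t > 1 / 2" if "\<bar>t - u i\<bar> < \<delta>" for t
    using cube_pos[OF uc[OF that] i] by simp
  have "((\<lambda>t. measure_pmf.expectation rho (\<lambda>l. h P l (u(i := t)))) has_real_derivative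
    measure_pmf.expectation rho (\<lambda>l. inverse (u i) * h ?Q l (u(i := u i)))) (at (u i))"
  proof (rule has_derivative_expectation[OF \<delta>, where w = "\<lambda>l. 2 * (C * bnd l)"])
    fix t assume t: "\<bar>t - u i\<bar> < \<delta>"
    show "integrable (measure_pmf rho) (\<lambda>l. h P l (u(i := t)))" by (rule integrable_h[OF P uc[OF t]])
    fix l
    have prod: "(\<Prod>a\<in>{1..N}. (u(i := s)) a powi \<nu> a) = s powi \<nu> i * (\<Prod>a\<in>{1..N} - {i}. u a powi \<nu> a)" for s \<nu>
      by (subst prod.remove[of _ i]) (use i in \<open>auto intro!: prod.cong\<close>)
    have t0: "t \<noteq> 0" using tpos[OF t] by simp
    have hP: "(\<lambda>s. h P l (u(i := s))) = (\<lambda>s. (\<Sum>k<nn l. P (\<mu> l k) * (s powi \<mu> l k i * (\<Prod>a\<in>{1..N} - {i}. u a powi \<mu> l k a))) * inverse (real (nn l)))"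
      unfolding h_def prod divide_inverse ..
    have "((\<lambda>s. (\<Sum>k<nn l. P (\<mu> l k) * (s powi \<mu> l k i * (\<Prod>a\<in>{1..N} - {i}. u a powi \<mu> l k a))) * inverse (real (nn l)))
      has_real_derivative (\<Sum>k<nn l. P (\<mu> l k) * ((real_of_int (\<mu> l k i) * t powi (\<mu> l k i - 1)) * (\<Prod>a\<in>{1..N} - {i}. u a powi \<mu> l k a))) * inverse (real (nn l))) (at t)"
    proof (intro DERIV_cmult_right DERIV_sum DERIV_cmult)
      fix k
      show "((\<lambda>s. s powi \<mu> l k i) has_real_derivative real_of_int (\<mu> l k i) * t powi (\<mu> l k i - 1)) (at t)"
        by (rule DERIV_cong[OF DERIV_power_int[OF DERIV_ident]]) (use t0 in auto)
    qed
    moreover have "(\<Sum>k<nn l. P (\<mu> l k) * ((real_of_int (\<mu> l k i) * t powi (\<mu> l k i - 1)) * (\<Prod>a\<in>{1..N} - {i}. u a powi \<mu> l k a))) * inverse (real (nn l)) =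
      inverse t * h ?Q l (u(i := t))"
      unfolding h_def prod power_int_diff[OF disjI1[OF t0]] divide_inverse sum_distrib_left sum_distrib_right
      by (intro sum.cong refl) (simp add: mult_ac)
    ultimately show "((\<lambda>t. h P l (u(i := t))) has_real_derivative inverse t * h ?Q l (u(i := t))) (at t)"
      unfolding hP by simp
    have "\<bar>inverse t * h ?Q l (u(i := t))\<bar> = inverse t * \<bar>h ?Q l (u(i := t))\<bar>"
      using tpos[OF t] by (simp add: abs_mult)
    also have "\<dots> \<le> 2 * (C * bnd l)"
    proof (rule mult_mono)
      show "inverse t \<le> 2" using tpos[OF t] by (simp add: field_simps)
    qed (use C(2)[OF uc[OF t]] in auto)
    finally show "\<bar>inverse t * h ?Q l (u(i := t))\<bar> \<le> 2 * (C * bnd l)" .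
  qed (use integrable_bnd in simp)
  then show ?thesis unfolding F_def by simp
qed

lemma smooth_coordinate: "smooth N (e / 3) k (\<lambda>u. u i)"
proof (cases k)
  case (Suc k')
  show ?thesis unfolding Suc
    by (rule smooth_SucI[where D = "\<lambda>j _. if j = i then 1 else 0"]) (auto intro: smooth_const)
qed simp

lemma smooth_inverse_coordinate: "i \<in> {1..N} \<Longrightarrow> smooth N (e / 3) k (\<lambda>u. inverse (u i))"
  by (intro smooth_inverse smooth_coordinate) (use cube_pos in fastforce)

lemma smooth_F: "poly_bounded N P \<Longrightarrow> smooth N (e / 3) k (F P)"
proof (induction k arbitrary: P)
  case (Suc k)
  show ?case
  proof (rule smooth_SucI[where D = "\<lambda>i u. inverse (u i) * F (\<lambda>\<nu>. real_of_int (\<nu> i) * P \<nu>) u"])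
    fix i assume i: "i \<in> {1..N}"
    show "smooth N (e / 3) k (\<lambda>u. inverse (u i) * F (\<lambda>\<nu>. real_of_int (\<nu> i) * P \<nu>) u)"
      by (intro smooth_mult smooth_inverse_coordinate i Suc.IH poly_bounded_mult poly_bounded_coordinate Suc.prems)
  qed (rule F_has_pderiv[OF Suc.prems])
qed simp

lemma Smooth_F: "poly_bounded N P \<Longrightarrow> Smooth N (e / 3) (F P)"
  by (simp add: Smooth_def smooth_F)

lemma Smooth_inverse_coordinate: "i \<in> {1..N} \<Longrightarrow> Smooth N (e / 3) (\<lambda>u. inverse (u i))"
  by (simp add: Smooth_def smooth_inverse_coordinate)

text \<open>Each differentiation contributes the next factor of a falling factorial, in total r!
  times a binomial coefficient.\<close>

lemma pderivs_F:
  assumes i: "i \<in> {1..N}" and u: "u \<in> cube N (e / 3)"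
  shows "pderivs (replicate r i) (F (\<lambda>_. 1)) u = inverse (u i) ^ r * F (\<lambda>\<nu>. fact r * (real_of_int (\<nu> i) gchoose r)) u"
  using u
proof (induction r arbitrary: u)
  case (Suc r)
  let ?Q = "\<lambda>\<nu>. fact r * (real_of_int (\<nu> i) gchoose r)"
  have Q: "poly_bounded N ?Q" by (intro poly_bounded_mult poly_bounded_const poly_bounded_gbinomial i)
  have ui: "u i \<noteq> 0" using cube_pos[OF Suc.prems i] by simp
  have "pderivs (replicate (Suc r) i) (F (\<lambda>_. 1)) u = pderiv_i i (\<lambda>u. inverse (u i) ^ r * F ?Q u) u"
    unfolding replicate_Suc pderivs.simps by (rule pderiv_i_cong[OF Suc.IH Suc.prems i])
  also have "\<dots> = inverse (u i) ^ Suc r * F (\<lambda>\<nu>. (real_of_int (\<nu> i) + (- real r)) * ?Q \<nu>) u"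
  proof (rule pderiv_i_eqI)
    have 1: "((\<lambda>t. inverse ((u(i := t)) i) ^ r) has_real_derivative - real r * inverse (u i) ^ Suc r) (at (u i))"
    proof -
      have "((\<lambda>t. inverse t ^ r) has_real_derivative real r * (inverse (u i) ^ (r - 1) * - (inverse (u i) ^ 2))) (at (u i))"
        by (rule DERIV_cong[OF DERIV_power[OF DERIV_inverse[OF ui]]]) (simp add: numeral_2_eq_2)
      moreover have "real r * (inverse (u i) ^ (r - 1) * - (inverse (u i) ^ 2)) = - real r * inverse (u i) ^ Suc r"
        by (cases r) (simp_all add: power2_eq_square algebra_simps)
      ultimately show ?thesis by (simp only: fun_upd_same)
    qed
    have FQ: "F (\<lambda>\<nu>. (real_of_int (\<nu> i) + (- real r)) * ?Q \<nu>) u = F (\<lambda>\<nu>. real_of_int (\<nu> i) * ?Q \<nu>) u - real r * F ?Q u"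
    proof -
      have "(\<lambda>\<nu>. (real_of_int (\<nu> i) + (- real r)) * ?Q \<nu>) = (\<lambda>\<nu>. real_of_int (\<nu> i) * ?Q \<nu> + (- real r) * ?Q \<nu>)"
        by (simp add: fun_eq_iff algebra_simps)
      then have "F (\<lambda>\<nu>. (real_of_int (\<nu> i) + (- real r)) * ?Q \<nu>) u = F (\<lambda>\<nu>. real_of_int (\<nu> i) * ?Q \<nu> + (- real r) * ?Q \<nu>) u"
        by simp
      also have "\<dots> = F (\<lambda>\<nu>. real_of_int (\<nu> i) * ?Q \<nu>) u + F (\<lambda>\<nu>. (- real r) * ?Q \<nu>) u"
        by (intro F_add poly_bounded_mult poly_bounded_coordinate poly_bounded_const poly_bounded_gbinomial i Suc.prems)
      finally show ?thesis using F_cmult[of "- real r" ?Q u] by simp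
    qed
    show "((\<lambda>t. inverse ((u(i := t)) i) ^ r * F ?Q (u(i := t))) has_real_derivative
        inverse (u i) ^ Suc r * F (\<lambda>\<nu>. (real_of_int (\<nu> i) + (- real r)) * ?Q \<nu>) u) (at (u i))"
    proof (rule DERIV_cong[OF DERIV_mult[OF 1 F_has_pderiv[OF Q i Suc.prems]]])
      have "- real r * z ^ Suc r * B + z * A * z ^ r = z ^ Suc r * (A - real r * B)" for z A B :: real
        by (simp add: algebra_simps)
      then show "- real r * inverse (u i) ^ Suc r * F ?Q (u(i := u i)) +
          inverse (u i) * F (\<lambda>\<nu>. real_of_int (\<nu> i) * ?Q \<nu>) u * inverse ((u(i := u i)) i) ^ r =
          inverse (u i) ^ Suc r * F (\<lambda>\<nu>. (real_of_int (\<nu> i) + (- real r)) * ?Q \<nu>) u"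
        unfolding FQ fun_upd_triv .
    qed
  qed
  also have "(\<lambda>\<nu>. (real_of_int (\<nu> i) + (- real r)) * ?Q \<nu>) = (\<lambda>\<nu>. fact (Suc r) * (real_of_int (\<nu> i) gchoose Suc r))"
  proof
    fix \<nu> :: "nat \<Rightarrow> int"
    have "(real_of_int (\<nu> i) - real r) * (real_of_int (\<nu> i) gchoose r) = real (Suc r) * (real_of_int (\<nu> i) gchoose Suc r)"
      using gbinomial_mult_1[of "real_of_int (\<nu> i)" r] by (simp add: algebra_simps)
    then show "(real_of_int (\<nu> i) + (- real r)) * ?Q \<nu> = fact (Suc r) * (real_of_int (\<nu> i) gchoose Suc r)"
      by (simp add: mult.left_commute[of _ "fact r"] mult.assoc del: of_nat_Suc)
  qed
  finally show ?case .
qed simp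

end

section \<open>Jets of expectations\<close>

text \<open>The series (1 + y X)^c.\<close>

definition sbin :: "real \<Rightarrow> real \<Rightarrow> real fps" where
  "sbin c y = fps_binomial c oo (fps_const y * fps_X)"

lemma sbin_nth: "fps_nth (sbin c y) k = y ^ k * (c gchoose k)"
  by (simp add: sbin_def fps_nth_compose_linear)

lemma sbin_mult: "sbin c y * sbin c' y = sbin (c + c') y"
  by (simp add: sbin_def fps_binomial_add_mult fps_compose_mult_distrib)

lemma sbin_0: "sbin 0 y = 1"
  by (simp add: sbin_def)

lemma sbin_1: "sbin 1 y = 1 + fps_const y * fps_X"
  by (simp add: sbin_def fps_binomial_1 fps_compose_add_distrib)

lemma fps_deriv_sbin: "fps_deriv (sbin c y) = fps_const (c * y) * sbin (-1) y * sbin c y"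
proof -
  have "fps_deriv (fps_binomial c) = fps_const c * (fps_binomial (-1) * fps_binomial c)"
    by (simp add: fps_binomial_deriv fps_divide_unit fps_binomial_minus_one mult_ac)
  then show ?thesis unfolding sbin_def
    by (subst fps_compose_deriv) (simp_all add: fps_compose_mult_distrib mult_ac flip: fps_const_mult)
qed

lemma fps_deriv_prod_log:
  fixes f g :: "'a \<Rightarrow> real fps"
  shows "(\<And>a. a \<in> S \<Longrightarrow> fps_deriv (f a) = g a * f a) \<Longrightarrow> fps_deriv (\<Prod>a\<in>S. f a) = (\<Sum>a\<in>S. g a) * (\<Prod>a\<in>S. f a)"
  by (induction S rule: infinite_finite_induct) (auto simp: algebra_simps)

definition mono_fps :: "(nat \<Rightarrow> real) \<Rightarrow> nat \<Rightarrow> (nat \<Rightarrow> int) \<Rightarrow> real fps" where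
  "mono_fps x n \<nu> = (\<Prod>a\<in>{1..n}. sbin (real_of_int (\<nu> a)) (x a))"

lemma mono_fps_0: "fps_nth (mono_fps x n \<nu>) 0 = 1"
proof -
  have "fps_nth (\<Prod>a\<in>S. f a) 0 = (\<Prod>a\<in>S. fps_nth (f a) 0)" for S :: "nat set" and f :: "nat \<Rightarrow> real fps"
    by (induction S rule: infinite_finite_induct) auto
  then show ?thesis by (simp add: mono_fps_def sbin_nth)
qed

text \<open>From the logarithmic derivative of the product. The recursion shows that the
  coefficients grow polynomially in \<nu>, and it matches the one for jets of
  \<open>F\<close>.\<close>

lemma mono_fps_Suc:
  "real (Suc p) * fps_nth (mono_fps x n \<nu>) (Suc p) =
    (\<Sum>i\<in>{1..n}. \<Sum>b\<in>{0..p}. x i * fps_nth (sbin (-1) (x i)) b * (real_of_int (\<nu> i) * fps_nth (mono_fps x n \<nu>) (p - b)))"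
proof -
  have "fps_deriv (mono_fps x n \<nu>) = (\<Sum>i\<in>{1..n}. fps_const (real_of_int (\<nu> i) * x i) * sbin (-1) (x i)) * mono_fps x n \<nu>"
    unfolding mono_fps_def by (rule fps_deriv_prod_log) (rule fps_deriv_sbin)
  then have "fps_nth (fps_deriv (mono_fps x n \<nu>)) p =
     fps_nth (\<Sum>i\<in>{1..n}. fps_const (real_of_int (\<nu> i) * x i) * (sbin (-1) (x i) * mono_fps x n \<nu>)) p"
    by (simp only: sum_distrib_right mult.assoc)
  also have "\<dots> = (\<Sum>i\<in>{1..n}. (real_of_int (\<nu> i) * x i) * fps_nth (sbin (-1) (x i) * mono_fps x n \<nu>) p)"
    by (simp only: fps_sum_nth fps_mult_left_const_nth)
  also have "\<dots> = (\<Sum>i\<in>{1..n}. \<Sum>b\<in>{0..p}. x i * fps_nth (sbin (-1) (x i)) b * (real_of_int (\<nu> i) * fps_nth (mono_fps x n \<nu>) (p - b)))"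
    unfolding fps_mult_nth sum_distrib_left by (simp only: mult_ac)
  finally show ?thesis by simp
qed

lemma poly_bounded_mono_fps:
  assumes "n \<le> N"
  shows "poly_bounded N (\<lambda>\<nu>. fps_nth (mono_fps x n \<nu>) p)"
proof (induction p rule: less_induct)
  case (less p)
  show ?case
  proof (cases p)
    case 0
    then show ?thesis by (simp add: mono_fps_0 poly_bounded_const)
  next
    case (Suc k)
    have "fps_nth (mono_fps x n \<nu>) p = (1 / real (Suc k)) *
      (\<Sum>i\<in>{1..n}. \<Sum>b\<in>{0..k}. x i * fps_nth (sbin (-1) (x i)) b * (real_of_int (\<nu> i) * fps_nth (mono_fps x n \<nu>) (k - b)))" for \<nu>
      unfolding mono_fps_Suc[symmetric] Suc by simp
    moreover have "poly_bounded N (\<lambda>\<nu>. (1 / real (Suc k)) *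
      (\<Sum>i\<in>{1..n}. \<Sum>b\<in>{0..k}. x i * fps_nth (sbin (-1) (x i)) b * (real_of_int (\<nu> i) * fps_nth (mono_fps x n \<nu>) (k - b))))"
      by (intro poly_bounded_mult poly_bounded_sum poly_bounded_const poly_bounded_coordinate less.IH)
         (use Suc assms in auto)
    ultimately show ?thesis by presburger
  qed
qed

context integrable_weighted_sums
begin

lemma e3: "e / 3 > 0" using e by simp

lemma ones_cube: "ones \<in> cube N (e / 3)" by (rule ones_in_cube[OF e3])

text \<open>Jets are multiplicative, so the jet of the inverse coordinate is the inverse of 1 + x_i
  X.\<close>

lemma jet_inverse_power:
  assumes nN: "n \<le> N" and i: "i \<in> {1..n}"
  shows "Smooth N (e / 3) (\<lambda>u. inverse (u i) ^ r)" "jet x n (\<lambda>u. inverse (u i) ^ r) = sbin (- real r) (x i)"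
proof -
  interpret jets N n "e / 3" x by unfold_locales (use nN e3 in auto)
  have iN: "i \<in> {1..N}" by (rule idx[OF i])
  have Sc: "Smooth N (e / 3) (\<lambda>u. u i)" by (simp add: Smooth_def smooth_coordinate)
  have Si: "Smooth N (e / 3) (\<lambda>u. inverse (u i))" by (rule Smooth_inverse_coordinate[OF iN])
  have "jet x n (\<lambda>u. u i) * jet x n (\<lambda>u. inverse (u i)) = jet x n (\<lambda>u. u i * inverse (u i))"
    by (rule jet_mult[OF Sc Si, symmetric])
  also have "\<dots> = jet x n (\<lambda>_. 1)" by (rule jet_cong) (use cube_pos[OF _ iN] in force)
  also have "\<dots> = 1" by (simp add: jet_const)
  finally have "sbin 1 (x i) * jet x n (\<lambda>u. inverse (u i)) = 1" by (simp add: jet_coordinate[OF i] sbin_1)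
  then have "sbin (-1) (x i) * (sbin 1 (x i) * jet x n (\<lambda>u. inverse (u i))) = sbin (-1) (x i)" by simp
  then have inv: "jet x n (\<lambda>u. inverse (u i)) = sbin (-1) (x i)"
    unfolding mult.assoc[symmetric] sbin_mult by (simp add: sbin_0)
  have "Smooth N (e / 3) (\<lambda>u. inverse (u i) ^ r) \<and> jet x n (\<lambda>u. inverse (u i) ^ r) = sbin (- real r) (x i)"
  proof (induction r)
    case 0
    show ?case by (simp add: Smooth_def smooth_const jet_const sbin_0)
  next
    case (Suc r)
    have "jet x n (\<lambda>u. inverse (u i) * inverse (u i) ^ r) = sbin (-1) (x i) * sbin (- real r) (x i)"
      using jet_mult[OF Si] Suc inv by simp
    then show ?case using Suc Smooth_mult[OF Si] by (simp add: sbin_mult)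
  qed
  then show "Smooth N (e / 3) (\<lambda>u. inverse (u i) ^ r)" "jet x n (\<lambda>u. inverse (u i) ^ r) = sbin (- real r) (x i)" by auto
qed

text \<open>Jets commute with the expectation: the recursion for the derivatives of \<open>F\<close>
  is that of \<open>mono_fps_Suc\<close> under the expectation.\<close>

lemma jet_F:
  assumes nN: "n \<le> N"
  shows "poly_bounded N P \<Longrightarrow> fps_nth (jet x n (F P)) p = F (\<lambda>\<nu>. P \<nu> * fps_nth (mono_fps x n \<nu>) p) ones"
proof (induction p arbitrary: P rule: less_induct)
  case (less p)
  interpret jets N n "e / 3" x by unfold_locales (use nN e3 in auto)
  note G = poly_bounded_mono_fps[OF nN, of x]
  show ?case
  proof (cases p)
    case 0
    then show ?thesis by (simp add: jet_def mono_fps_0)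
  next
    case (Suc k)
    let ?P = "\<lambda>i \<nu>. real_of_int (\<nu> i) * P \<nu>"
    have PB: "poly_bounded N (?P i)" if "i \<in> {1..n}" for i
      by (intro poly_bounded_mult poly_bounded_coordinate idx that less.prems)
    have jd: "jet x n (pderiv_i i (F P)) = sbin (-1) (x i) * jet x n (F (?P i))" if i: "i \<in> {1..n}" for i
    proof -
      have "jet x n (pderiv_i i (F P)) = jet x n (\<lambda>u. inverse (u i) ^ 1 * F (?P i) u)"
      proof (rule jet_cong)
        fix v assume "v \<in> cube N (e / 3)"
        from pderiv_i_eqI[of "F P" v i, OF F_has_pderiv[OF less.prems idx[OF i] this]]
        show "pderiv_i i (F P) v = inverse (v i) ^ 1 * F (?P i) v" by simp
      qed
      also have "\<dots> = sbin (-1) (x i) * jet x n (F (?P i))"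
        using jet_mult[OF jet_inverse_power(1)[OF nN i, of 1] Smooth_F[OF PB[OF i]]] jet_inverse_power(2)[OF nN i, of x 1]
        by simp
      finally show ?thesis .
    qed
    have "real (Suc k) * fps_nth (jet x n (F P)) (Suc k) = fps_nth (fps_deriv (jet x n (F P))) k" by simp
    also have "\<dots> = (\<Sum>i\<in>{1..n}. x i * fps_nth (sbin (-1) (x i) * jet x n (F (?P i))) k)"
      unfolding fps_deriv_jet fps_sum_nth fps_mult_left_const_nth by (intro sum.cong refl) (simp only: jd)
    also have "\<dots> = (\<Sum>i\<in>{1..n}. \<Sum>b\<in>{0..k}. x i * fps_nth (sbin (-1) (x i)) b * F (\<lambda>\<nu>. ?P i \<nu> * fps_nth (mono_fps x n \<nu>) (k - b)) ones)"
    proof -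
      have IH: "fps_nth (jet x n (F (?P i))) (k - b) = F (\<lambda>\<nu>. ?P i \<nu> * fps_nth (mono_fps x n \<nu>) (k - b)) ones"
        if "i \<in> {1..n}" for i b by (rule less.IH[OF _ PB[OF that]]) (use Suc in auto)
      have "x i * fps_nth (sbin (-1) (x i) * jet x n (F (?P i))) k =
        (\<Sum>b\<in>{0..k}. x i * fps_nth (sbin (-1) (x i)) b * F (\<lambda>\<nu>. ?P i \<nu> * fps_nth (mono_fps x n \<nu>) (k - b)) ones)"
        if "i \<in> {1..n}" for i
        unfolding fps_mult_nth IH[OF that] sum_distrib_left mult.assoc[of "x i"] ..
      then show ?thesis by (intro sum.cong refl)
    qed
    also have "\<dots> = (\<Sum>i\<in>{1..n}. \<Sum>b\<in>{0..k}. F (\<lambda>\<nu>. x i * fps_nth (sbin (-1) (x i)) b * (?P i \<nu> * fps_nth (mono_fps x n \<nu>) (k - b))) ones)"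
      by (simp only: F_cmult)
    also have "\<dots> = (\<Sum>i\<in>{1..n}. F (\<lambda>\<nu>. \<Sum>b\<in>{0..k}. x i * fps_nth (sbin (-1) (x i)) b * (?P i \<nu> * fps_nth (mono_fps x n \<nu>) (k - b))) ones)"
      by (intro sum.cong refl F_sum[symmetric] ones_cube poly_bounded_mult[OF poly_bounded_const] poly_bounded_mult[OF PB] G)
    also have "\<dots> = F (\<lambda>\<nu>. \<Sum>i\<in>{1..n}. \<Sum>b\<in>{0..k}. x i * fps_nth (sbin (-1) (x i)) b * (?P i \<nu> * fps_nth (mono_fps x n \<nu>) (k - b))) ones"
      by (intro F_sum[symmetric] ones_cube poly_bounded_sum poly_bounded_mult[OF poly_bounded_const] poly_bounded_mult[OF PB] G)
    also have "(\<lambda>\<nu>. \<Sum>i\<in>{1..n}. \<Sum>b\<in>{0..k}. x i * fps_nth (sbin (-1) (x i)) b * (?P i \<nu> * fps_nth (mono_fps x n \<nu>) (k - b))) =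
       (\<lambda>\<nu>. real (Suc k) * (P \<nu> * fps_nth (mono_fps x n \<nu>) (Suc k)))"
    proof
      fix \<nu>
      have "real (Suc k) * (P \<nu> * fps_nth (mono_fps x n \<nu>) (Suc k)) = P \<nu> * (real (Suc k) * fps_nth (mono_fps x n \<nu>) (Suc k))"
        by (simp only: mult.left_commute)
      also have "\<dots> = (\<Sum>i\<in>{1..n}. \<Sum>b\<in>{0..k}. x i * fps_nth (sbin (-1) (x i)) b * (?P i \<nu> * fps_nth (mono_fps x n \<nu>) (k - b)))"
        unfolding mono_fps_Suc sum_distrib_left by (simp only: mult_ac)
      finally show "(\<Sum>i\<in>{1..n}. \<Sum>b\<in>{0..k}. x i * fps_nth (sbin (-1) (x i)) b * (?P i \<nu> * fps_nth (mono_fps x n \<nu>) (k - b))) =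
         real (Suc k) * (P \<nu> * fps_nth (mono_fps x n \<nu>) (Suc k))" by simp
    qed
    also have "F (\<lambda>\<nu>. real (Suc k) * (P \<nu> * fps_nth (mono_fps x n \<nu>) (Suc k))) ones =
       real (Suc k) * F (\<lambda>\<nu>. P \<nu> * fps_nth (mono_fps x n \<nu>) (Suc k)) ones" by (rule F_cmult)
    finally show ?thesis using Suc by simp
  qed
qed

lemma ejet_F:
  assumes nN: "n \<le> N" and i: "i \<in> {1..n}"
  shows "fps_nth (jets.ejet n x i (F (\<lambda>_. 1))) r = sbin (- real r) (x i) * jet x n (F (\<lambda>\<nu>. real_of_int (\<nu> i) gchoose r))"
proof -
  interpret jets N n "e / 3" x by unfold_locales (use nN e3 in auto)
  have iN: "i \<in> {1..N}" by (rule idx[OF i])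
  have PB: "poly_bounded N (\<lambda>\<nu>. real_of_int (\<nu> i) gchoose r)" by (rule poly_bounded_gbinomial[OF iN])
  have "jet x n (pderivs (replicate r i) (F (\<lambda>_. 1))) = jet x n (\<lambda>u. fact r * (inverse (u i) ^ r * F (\<lambda>\<nu>. real_of_int (\<nu> i) gchoose r) u))"
    by (rule jet_cong) (simp only: pderivs_F[OF iN] F_cmult mult.left_commute)
  also have "\<dots> = jet x n (\<lambda>_. fact r) * jet x n (\<lambda>u. inverse (u i) ^ r * F (\<lambda>\<nu>. real_of_int (\<nu> i) gchoose r) u)"
    by (rule jet_mult) (auto simp: Smooth_def smooth_const intro!: smooth_mult smooth_F PB
        jet_inverse_power(1)[OF nN i, unfolded Smooth_def, rule_format])
  also have "jet x n (\<lambda>u. inverse (u i) ^ r * F (\<lambda>\<nu>. real_of_int (\<nu> i) gchoose r) u) =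
      sbin (- real r) (x i) * jet x n (F (\<lambda>\<nu>. real_of_int (\<nu> i) gchoose r))"
    using jet_mult[OF jet_inverse_power(1)[OF nN i] Smooth_F[OF PB]] jet_inverse_power(2)[OF nN i] by simp
  finally show ?thesis by (simp add: ejet_def jet_const mult.assoc[symmetric])
qed

text \<open>The r-th derivative of S carries a factor u_i^(-r), which is compensated by raising the
  exponent s to s + r.\<close>

lemma F_Zf:
  assumes m: "m < N"
  shows "F (\<lambda>\<nu>. fps_nth (Zf m r s \<nu>) p) ones =
    fps_nth (\<Sum>i\<in>{1..Suc m}. fps_const (dd real {1..Suc m} i) *
      (sbin (s + real r) (real i) * fps_nth (jets.ejet (Suc m) real i (F (\<lambda>_. 1))) r)) p"
proof -
  have nN: "Suc m \<le> N" using m by simp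
  have PB: "poly_bounded N (\<lambda>\<nu>. real_of_int (\<nu> i) gchoose r)" if "i \<in> {1..Suc m}" for i
    by (rule poly_bounded_gbinomial) (use that nN in auto)
  have PBG: "poly_bounded N (\<lambda>\<nu>. (real_of_int (\<nu> i) gchoose r) * fps_nth (mono_fps real (Suc m) \<nu>) b)" if "i \<in> {1..Suc m}" for i b
    by (intro poly_bounded_mult PB that poly_bounded_mono_fps nN)
  have Z: "fps_nth (Zf m r s \<nu>) p = (\<Sum>i\<in>{1..Suc m}. \<Sum>b\<in>{0..p}. dd real {1..Suc m} i * fps_nth (sbin s (real i)) b *
      ((real_of_int (\<nu> i) gchoose r) * fps_nth (mono_fps real (Suc m) \<nu>) (p - b)))" for \<nu>
    unfolding Zf_def sbin_def[symmetric] mono_fps_def[symmetric] fps_sum_nth fps_mult_left_const_nth fps_mult_nth[of "sbin s _"]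
      sum_distrib_left by (simp only: mult.assoc)
  have "F (\<lambda>\<nu>. fps_nth (Zf m r s \<nu>) p) ones = (\<Sum>i\<in>{1..Suc m}. F (\<lambda>\<nu>. \<Sum>b\<in>{0..p}. dd real {1..Suc m} i * fps_nth (sbin s (real i)) b *
      ((real_of_int (\<nu> i) gchoose r) * fps_nth (mono_fps real (Suc m) \<nu>) (p - b))) ones)"
    unfolding Z by (intro F_sum ones_cube poly_bounded_sum poly_bounded_mult[OF poly_bounded_const] PBG)
  also have "\<dots> = (\<Sum>i\<in>{1..Suc m}. \<Sum>b\<in>{0..p}. F (\<lambda>\<nu>. dd real {1..Suc m} i * fps_nth (sbin s (real i)) b *
      ((real_of_int (\<nu> i) gchoose r) * fps_nth (mono_fps real (Suc m) \<nu>) (p - b))) ones)"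
    by (intro sum.cong refl F_sum ones_cube poly_bounded_mult[OF poly_bounded_const] PBG)
  also have "\<dots> = (\<Sum>i\<in>{1..Suc m}. \<Sum>b\<in>{0..p}. dd real {1..Suc m} i * fps_nth (sbin s (real i)) b *
      fps_nth (jet real (Suc m) (F (\<lambda>\<nu>. real_of_int (\<nu> i) gchoose r))) (p - b))"
    unfolding F_cmult by (intro sum.cong refl arg_cong2[where f = times] jet_F[symmetric] nN PB)
  also have "\<dots> = (\<Sum>i\<in>{1..Suc m}. dd real {1..Suc m} i * fps_nth (sbin s (real i) * jet real (Suc m) (F (\<lambda>\<nu>. real_of_int (\<nu> i) gchoose r))) p)"
    by (simp only: fps_mult_nth sum_distrib_left mult.assoc)
  also have "\<dots> = (\<Sum>i\<in>{1..Suc m}. dd real {1..Suc m} i * fps_nth (sbin (s + real r) (real i) * fps_nth (jets.ejet (Suc m) real i (F (\<lambda>_. 1))) r) p)"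
  proof (rule sum.cong[OF refl])
    fix i assume i: "i \<in> {1..Suc m}"
    have "sbin (s + real r) (real i) * (sbin (- real r) (real i) * J) = sbin s (real i) * J" for J
      unfolding mult.assoc[symmetric] sbin_mult by simp
    then show "dd real {1..Suc m} i * fps_nth (sbin s (real i) * jet real (Suc m) (F (\<lambda>\<nu>. real_of_int (\<nu> i) gchoose r))) p =
       dd real {1..Suc m} i * fps_nth (sbin (s + real r) (real i) * fps_nth (jets.ejet (Suc m) real i (F (\<lambda>_. 1))) r) p"
      unfolding ejet_F[OF nN i] by (simp only:)
  qed
  finally show ?thesis by (simp only: fps_sum_nth fps_mult_left_const_nth)
qed

end

subsection \<open>First-order asymptotics\<close>

text \<open>The two-term expansion f N = \<alpha> + \<beta>/N + o(1/N).\<close>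

definition first_order :: "(nat \<Rightarrow> real) \<Rightarrow> real \<Rightarrow> real \<Rightarrow> bool" where
  "first_order f \<alpha> \<beta> \<longleftrightarrow> (\<lambda>N. real N * (f N - \<alpha>)) \<longlonglongrightarrow> \<beta>"

lemma eventually_pos_nat: "eventually (\<lambda>N::nat. N > 0) sequentially"
  by (rule eventually_gt_at_top)

lemma first_order_cong:
  assumes "eventually (\<lambda>N. f N = g N) sequentially" "first_order f \<alpha> \<beta>"
  shows "first_order g \<alpha> \<beta>"
proof -
  have "eventually (\<lambda>N. real N * (f N - \<alpha>) = real N * (g N - \<alpha>)) sequentially"
    using assms(1) by eventually_elim simp
  then show ?thesis using assms(2) unfolding first_order_def by (rule Lim_transform_eventually[rotated])
qed

lemma first_order_tendsto:
  assumes "first_order f \<alpha> \<beta>"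
  shows "f \<longlonglongrightarrow> \<alpha>"
proof -
  have "(\<lambda>N. inverse (real N) * (real N * (f N - \<alpha>)) + \<alpha>) \<longlonglongrightarrow> 0 * \<beta> + \<alpha>"
    using assms unfolding first_order_def by (intro tendsto_intros lim_inverse_n)
  moreover have "eventually (\<lambda>N. inverse (real N) * (real N * (f N - \<alpha>)) + \<alpha> = f N) sequentially"
    using eventually_pos_nat by eventually_elim (simp add: field_simps)
  ultimately show ?thesis by (simp add: Lim_transform_eventually)
qed

lemma first_order_const: "first_order (\<lambda>_. c) c 0"
  by (simp add: first_order_def)

lemma first_order_add:
  "first_order f \<alpha> \<beta> \<Longrightarrow> first_order g \<alpha>' \<beta>' \<Longrightarrow> first_order (\<lambda>N. f N + g N) (\<alpha> + \<alpha>') (\<beta> + \<beta>')"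
  unfolding first_order_def by (drule (1) tendsto_add) (simp add: algebra_simps)

lemma first_order_mult:
  assumes "first_order f \<alpha> \<beta>" "first_order g \<alpha>' \<beta>'"
  shows "first_order (\<lambda>N. f N * g N) (\<alpha> * \<alpha>') (\<beta> * \<alpha>' + \<alpha> * \<beta>')"
proof -
  have "(\<lambda>N. (real N * (f N - \<alpha>)) * g N + \<alpha> * (real N * (g N - \<alpha>'))) \<longlonglongrightarrow> \<beta> * \<alpha>' + \<alpha> * \<beta>'"
    using assms first_order_tendsto[OF assms(2)] unfolding first_order_def by (intro tendsto_intros)
  then show ?thesis unfolding first_order_def by (simp add: algebra_simps)
qed

lemma first_order_cmult: "first_order f \<alpha> \<beta> \<Longrightarrow> first_order (\<lambda>N. c * f N) (c * \<alpha>) (c * \<beta>)"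
  using first_order_mult[OF first_order_const, of f \<alpha> \<beta> c] by simp

lemma first_order_sum:
  "(\<And>s. s \<in> A \<Longrightarrow> first_order (f s) (\<alpha> s) (\<beta> s)) \<Longrightarrow>
    first_order (\<lambda>N. \<Sum>s\<in>A. f s N) (\<Sum>s\<in>A. \<alpha> s) (\<Sum>s\<in>A. \<beta> s)"
  by (induction A rule: infinite_finite_induct)
     (auto intro: first_order_add simp: first_order_const)

lemma first_order_div:
  assumes "first_order f \<alpha> \<beta>"
  shows "first_order (\<lambda>N. f N / real N) 0 \<alpha>"
proof -
  have "eventually (\<lambda>N. f N = real N * (f N / real N - 0)) sequentially"
    using eventually_pos_nat by eventually_elim simp
  then show ?thesis unfolding first_order_def
    using first_order_tendsto[OF assms] by (rule Lim_transform_eventually[rotated])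
qed

text \<open>Passing from j to j + 1 multiplies by (1 - j/N)/(j + 1); the corrections 0, 1, ..., j -
  1 add up to j choose 2.\<close>

lemma first_order_binomial:
  "first_order (\<lambda>N. real (N choose j) / real N ^ j) (1 / fact j) (- real (j choose 2) / fact j)"
proof (induction j)
  case 0
  show ?case using first_order_const[of 1] by (simp add: binomial_eq_0)
next
  case (Suc j)
  have d: "first_order (\<lambda>N. 1 / real N) 0 1"
    using first_order_div[OF first_order_const[of 1]] .
  have "first_order (\<lambda>N. 1 + (- real j) * (1 / real N)) (1 + (- real j) * 0) (0 + (- real j) * 1)"
    by (intro first_order_add first_order_cmult d first_order_const)
  from first_order_cmult[OF first_order_mult[OF Suc this], of "1 / real (Suc j)"]
  have f: "first_order (\<lambda>N. 1 / real (Suc j) * (real (N choose j) / real N ^ j * (1 + (- real j) * (1 / real N))))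
     (1 / real (Suc j) * (1 / fact j * (1 + (- real j) * 0)))
     (1 / real (Suc j) * (- real (j choose 2) / fact j * (1 + (- real j) * 0) + 1 / fact j * (0 + (- real j) * 1)))" .
  have a: "1 / real (Suc j) * (1 / fact j * (1 + (- real j) * 0)) = 1 / fact (Suc j)" by simp
  have b: "1 / real (Suc j) * (- real (j choose 2) / fact j * (1 + (- real j) * 0) + 1 / fact j * (0 + (- real j) * 1)) =
      - real (Suc j choose 2) / fact (Suc j)"
  proof -
    have "Suc j choose 2 = j + (j choose 2)" by (simp add: numeral_2_eq_2)
    then show ?thesis by (simp add: field_simps)
  qed
  note f[unfolded a b]
  moreover have "eventually (\<lambda>N. 1 / real (Suc j) * (real (N choose j) / real N ^ j * (1 + (- real j) * (1 / real N))) =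
     real (N choose Suc j) / real N ^ Suc j) sequentially"
    using eventually_ge_at_top[of "Suc j"]
  proof eventually_elim
    case (elim N)
    have "Suc j * (N choose Suc j) = (N - j) * (N choose j)"
      using binomial_absorb_comp[of N j] Suc_times_binomial_eq[of "N - 1" j] elim
      by (cases N) (simp_all del: binomial_Suc_Suc mult_Suc add: mult.commute)
    then have "real (Suc j) * real (N choose Suc j) = real (N - j) * real (N choose j)" by (metis of_nat_mult)
    moreover have "real (N - j) = real N - real j" using elim by simp
    ultimately have "real (N choose Suc j) = 1 / real (Suc j) * (real (N choose j) * (real N - real j))"
      by (simp add: field_simps)
    moreover have "1 + (- real j) * (1 / real N) = (real N - real j) / real N" using elim by (simp add: field_simps)
    ultimately show ?case by (simp add: mult_ac)
  qed
  ultimately show ?case by (rule first_order_cong[rotated])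
qed

section \<open>Two-term expansions of power series at scale N^r\<close>

definition asy :: "nat \<Rightarrow> (nat \<Rightarrow> real fps) \<Rightarrow> real fps \<Rightarrow> real fps \<Rightarrow> bool" where
  "asy r f A B \<longleftrightarrow> (\<forall>p. first_order (\<lambda>N. fps_nth (f N) p / real N ^ r) (fps_nth A p) (fps_nth B p))"

lemma asy_sum:
  "(\<And>s. s \<in> S \<Longrightarrow> asy r (f s) (A s) (B s)) \<Longrightarrow> asy r (\<lambda>N. \<Sum>s\<in>S. f s N) (\<Sum>s\<in>S. A s) (\<Sum>s\<in>S. B s)"
  unfolding asy_def fps_sum_nth sum_divide_distrib by (intro allI first_order_sum) blast

lemma asy_mult:
  assumes "asy r f A B" "asy s g A' B'"
  shows "asy (r + s) (\<lambda>N. f N * g N) (A * A') (B * A' + A * B')"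
  unfolding asy_def
proof
  fix p
  have "first_order (\<lambda>N. \<Sum>i=0..p. (fps_nth (f N) i / real N ^ r) * (fps_nth (g N) (p - i) / real N ^ s))
    (\<Sum>i=0..p. fps_nth A i * fps_nth A' (p - i)) (\<Sum>i=0..p. fps_nth B i * fps_nth A' (p - i) + fps_nth A i * fps_nth B' (p - i))"
    using assms unfolding asy_def by (intro first_order_sum first_order_mult) auto
  then show "first_order (\<lambda>N. fps_nth (f N * g N) p / real N ^ (r + s)) (fps_nth (A * A') p) (fps_nth (B * A' + A * B') p)"
    by (simp add: fps_mult_nth sum_divide_distrib power_add sum.distrib)
qed

lemma asy_const: "asy 0 (\<lambda>_. G) G 0"
  by (simp add: asy_def first_order_const)

lemma asy_cmult: "asy r f A B \<Longrightarrow> asy r (\<lambda>N. G * f N) (G * A) (G * B)"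
  using asy_mult[OF asy_const, of r f A B G] by simp

lemma asy_Suc:
  assumes "asy r f A B"
  shows "asy (Suc r) f 0 A"
  unfolding asy_def
proof
  fix p
  have "first_order (\<lambda>N. fps_nth (f N) p / real N ^ r) (fps_nth A p) (fps_nth B p)"
    using assms unfolding asy_def by blast
  from first_order_div[OF this]
  show "first_order (\<lambda>N. fps_nth (f N) p / real N ^ Suc r) (fps_nth 0 p) (fps_nth A p)"
    by (simp add: mult.commute)
qed

text \<open>Measured two powers of N too high, even the correction term disappears; such
  contributions are below the precision that is kept.\<close>

lemma asy_ge:
  assumes "asy r f A B" "r + 2 \<le> s"
  shows "asy s f 0 0"
proof -
  have "asy (r + 2 + k) f 0 0" for k
  proof (induction k)
    case 0
    show ?case using asy_Suc[OF asy_Suc[OF assms(1)]] by simp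
  next
    case (Suc k)
    then show ?case using asy_Suc by fastforce
  qed
  moreover have "r + 2 + (s - (r + 2)) = s" using assms(2) by simp
  ultimately show ?thesis by metis
qed

lemma asy_cong:
  assumes "eventually (\<lambda>N. f N = g N) sequentially" "asy r f A B"
  shows "asy r g A B"
  unfolding asy_def
proof
  fix p
  have "eventually (\<lambda>N. fps_nth (f N) p / real N ^ r = fps_nth (g N) p / real N ^ r) sequentially"
    using assms(1) by eventually_elim simp
  then show "first_order (\<lambda>N. fps_nth (g N) p / real N ^ r) (fps_nth A p) (fps_nth B p)"
    by (rule first_order_cong) (use assms(2) in \<open>auto simp: asy_def\<close>)
qed

text \<open>\<open>g N r\<close> is the coefficient of order \<open>r\<close> of the exponential of the series with coefficients \<open>\<Lambda> N b\<close>.\<close>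

lemma asy_exp_recursion:
  fixes \<Lambda> g :: "nat \<Rightarrow> nat \<Rightarrow> real fps"
  assumes \<Lambda>: "\<And>b. asy 1 (\<lambda>N. \<Lambda> N (Suc b)) (A (Suc b)) (B (Suc b))"
    and g0: "eventually (\<lambda>N. g N 0 = 1) sequentially"
    and rec: "eventually (\<lambda>N. \<forall>r. of_nat (Suc r) * g N (Suc r) = (\<Sum>b\<le>r. of_nat (Suc b) * (\<Lambda> N (Suc b) * g N (r - b)))) sequentially"
  shows "asy r (\<lambda>N. g N r) (fps_const (1 / fact r) * A 1 ^ r)
    (fps_const (1 / fact r) * (of_nat r * A 1 ^ (r - 1) * B 1 + of_nat (2 * (r choose 2)) * A 1 ^ (r - 2) * A 2))"
proof (induction r rule: less_induct)
  case (less r)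
  define a where "a r = fps_const (1 / fact r) * A 1 ^ r" for r
  define b where "b r = fps_const (1 / fact r) * (of_nat r * A 1 ^ (r - 1) * B 1 + of_nat (2 * (r choose 2)) * A 1 ^ (r - 2) * A 2)" for r
  have IH: "asy k (\<lambda>N. g N k) (a k) (b k)" if "k < r" for k using less.IH[OF that] by (simp add: a_def b_def)
  have "asy r (\<lambda>N. g N r) (a r) (b r)"
  proof (cases r)
    case 0
    have "eventually (\<lambda>N. 1 = g N r) sequentially" using g0 by eventually_elim (simp add: 0)
    moreover have "asy r (\<lambda>N. 1) (a r) (b r)" using asy_const[of 1] by (simp add: a_def b_def 0 binomial_eq_0)
    ultimately show ?thesis by (rule asy_cong)
  next
    case (Suc k)
    \<comment> \<open>The product of \<open>\<Lambda> N (Suc c)\<close> and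
      \<open>g N (k - c)\<close> has size N^(1 + k - c), compared with the scale N^(k + 1): c = 0
      contributes to both orders, c = 1 to the correction only, larger c to neither.\<close>
    define A' where "A' c = (if c = 0 then A 1 * a k else 0)" for c :: nat
    define B' where "B' c = (if c = 0 then B 1 * a k + A 1 * b k else if c = 1 then of_nat 2 * (A 2 * a (k - 1)) else 0)" for c :: nat
    have "asy r (\<lambda>N. of_nat (Suc c) * (\<Lambda> N (Suc c) * g N (k - c))) (A' c) (B' c)" if c: "c \<le> k" for c
    proof -
      have m: "asy (1 + (k - c)) (\<lambda>N. \<Lambda> N (Suc c) * g N (k - c)) (A (Suc c) * a (k - c)) (B (Suc c) * a (k - c) + A (Suc c) * b (k - c))"
        by (intro asy_mult \<Lambda> IH) (use Suc in auto)
      consider "c = 0" | "c = 1" | "c \<ge> 2" by linarith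
      then show ?thesis
      proof cases
        case 1
        then show ?thesis using m Suc by (simp add: A'_def B'_def)
      next
        case 2
        have "asy (Suc (1 + (k - c))) (\<lambda>N. \<Lambda> N (Suc c) * g N (k - c)) 0 (A (Suc c) * a (k - c))"
          by (rule asy_Suc[OF m])
        from asy_cmult[OF this, of "of_nat (Suc c)"] show ?thesis
          using 2 c Suc by (simp add: A'_def B'_def numeral_2_eq_2)
      next
        case 3
        have "asy r (\<lambda>N. \<Lambda> N (Suc c) * g N (k - c)) 0 0"
          by (rule asy_ge[OF m]) (use 3 c Suc in auto)
        from asy_cmult[OF this, of "of_nat (Suc c)"] show ?thesis
          using 3 by (simp add: A'_def B'_def)
      qed
    qed
    then have "asy r (\<lambda>N. \<Sum>c\<le>k. of_nat (Suc c) * (\<Lambda> N (Suc c) * g N (k - c))) (\<Sum>c\<le>k. A' c) (\<Sum>c\<le>k. B' c)"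
      by (intro asy_sum) auto
    from asy_cmult[OF this, of "fps_const (1 / real r)"]
    have "asy r (\<lambda>N. fps_const (1 / real r) * (\<Sum>c\<le>k. of_nat (Suc c) * (\<Lambda> N (Suc c) * g N (k - c))))
       (fps_const (1 / real r) * (\<Sum>c\<le>k. A' c)) (fps_const (1 / real r) * (\<Sum>c\<le>k. B' c))" .
    moreover have "eventually (\<lambda>N. fps_const (1 / real r) * (\<Sum>c\<le>k. of_nat (Suc c) * (\<Lambda> N (Suc c) * g N (k - c))) = g N r) sequentially"
      using rec
    proof eventually_elim
      case (elim N)
      have "fps_const (1 / real r) * (of_nat r * g N r) = g N r"
        unfolding fps_of_nat[symmetric] mult.assoc[symmetric] using Suc by simp
      then show ?case unfolding Suc elim[rule_format, of k, symmetric] .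
    qed
    ultimately have "asy r (\<lambda>N. g N r) (fps_const (1 / real r) * (\<Sum>c\<le>k. A' c)) (fps_const (1 / real r) * (\<Sum>c\<le>k. B' c))"
      by (rule asy_cong[rotated])
    moreover have "fps_const (1 / real r) * (\<Sum>c\<le>k. A' c) = a r"
    proof -
      have "(\<Sum>c\<le>k. A' c) = A 1 * a k" unfolding A'_def by (simp add: sum.delta)
      moreover have "fps_const (1 / real r) * fps_const (1 / fact k) = fps_const (1 / fact r)"
        using Suc by (simp add: field_simps)
      ultimately show ?thesis using Suc by (simp add: a_def mult_ac)
    qed
    moreover have "fps_const (1 / real r) * (\<Sum>c\<le>k. B' c) = b r"
    proof -
      have fc: "fps_const (1 / real r) * fps_const (1 / fact k) = fps_const (1 / fact r)"
        using Suc by (simp add: field_simps)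
      have S: "(\<Sum>c\<le>k. B' c) = B 1 * a k + A 1 * b k + (if k = 0 then 0 else of_nat 2 * (A 2 * a (k - 1)))"
      proof (cases k)
        case 0
        then show ?thesis by (simp add: B'_def)
      next
        case (Suc j)
        have "(\<Sum>c\<le>k. B' c) = (\<Sum>c\<in>{0, 1}. B' c)"
          by (rule sum.mono_neutral_right) (use Suc in \<open>auto simp: B'_def\<close>)
        then show ?thesis using Suc by (simp add: B'_def)
      qed
      have k1: "(if k = 0 then 0 else of_nat 2 * (A 2 * a (k - 1))) = fps_const (1 / fact k) * (of_nat (2 * k) * A 1 ^ (k - 1) * A 2)"
      proof (cases k)
        case (Suc j)
        have "1 / fact j = 1 / fact k * real k" unfolding Suc by (simp del: of_nat_Suc)
        then have "fps_const (1 / fact j) = fps_const (1 / fact k * real k)" by (simp only:)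
        then have "fps_const (1 / fact j :: real) = fps_const (1 / fact k) * of_nat k"
          by (simp only: fps_const_mult[symmetric] fps_of_nat)
        then show ?thesis using Suc by (simp add: a_def mult_ac)
      qed simp
      have P1: "A 1 * (of_nat k * A 1 ^ (k - 1)) = of_nat k * A 1 ^ k" by (cases k) (auto simp: mult_ac)
      have P2: "A 1 * (of_nat (2 * (k choose 2)) * A 1 ^ (k - 2)) = of_nat (2 * (k choose 2)) * A 1 ^ (k - 1)"
      proof (cases "k < 2")
        case False
        then obtain j where "k = Suc (Suc j)" by (metis add_2_eq_Suc le_add_diff_inverse not_less)
        then show ?thesis by (simp add: mult_ac)
      qed (simp add: binomial_eq_0)
      have "A 1 * b k = fps_const (1 / fact k) * ((A 1 * (of_nat k * A 1 ^ (k - 1))) * B 1 + (A 1 * (of_nat (2 * (k choose 2)) * A 1 ^ (k - 2))) * A 2)"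
        unfolding b_def by (simp only: distrib_left distrib_right mult_ac)
      also have "\<dots> = fps_const (1 / fact k) * (of_nat k * A 1 ^ k * B 1 + of_nat (2 * (k choose 2)) * A 1 ^ (k - 1) * A 2)"
        unfolding P1 P2 ..
      finally have "(\<Sum>c\<le>k. B' c) = fps_const (1 / fact k) * (A 1 ^ k * B 1 + (of_nat k * A 1 ^ k * B 1 + of_nat (2 * (k choose 2)) * A 1 ^ (k - 1) * A 2)
          + of_nat (2 * k) * A 1 ^ (k - 1) * A 2)"
        unfolding S k1 unfolding a_def by (simp only: distrib_left mult_ac)
      also have "A 1 ^ k * B 1 + (of_nat k * A 1 ^ k * B 1 + of_nat (2 * (k choose 2)) * A 1 ^ (k - 1) * A 2) + of_nat (2 * k) * A 1 ^ (k - 1) * A 2 =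
         of_nat r * A 1 ^ (r - 1) * B 1 + of_nat (2 * (r choose 2)) * A 1 ^ (r - 2) * A 2"
      proof -
        have "2 * (r choose 2) = 2 * (k choose 2) + 2 * k" using Suc by (simp add: numeral_2_eq_2)
        then have e: "(of_nat (2 * (r choose 2)) :: real fps) = of_nat (2 * (k choose 2)) + of_nat (2 * k)" by (simp only: of_nat_add)
        have "(of_nat r :: real fps) = 1 + of_nat k" "r - 1 = k" "r - 2 = k - 1" using Suc by auto
        then show ?thesis unfolding e by (simp only: distrib_right mult_1_left add_ac)
      qed
      finally have "fps_const (1 / real r) * (\<Sum>c\<le>k. B' c) = (fps_const (1 / real r) * fps_const (1 / fact k)) *
         (of_nat r * A 1 ^ (r - 1) * B 1 + of_nat (2 * (r choose 2)) * A 1 ^ (r - 2) * A 2)" by (simp only: mult.assoc)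
      then show ?thesis unfolding fc b_def .
    qed
    ultimately show ?thesis by simp
  qed
  then show ?case by (simp only: a_def b_def)
qed

text \<open>\<open>M N j d\<close> stands for a moment of the j-th falling factorial times a d-th
  power, and the recursion is y (y)_j = (y)_(j+1) + j (y)_j. The last term is smaller by one power
  of N, so only its leading part enters the correction; the factors 0, ..., k - 1 add up to k choose
  2.\<close>

lemma power_moments_from_factorial_moments:
  fixes M :: "nat \<Rightarrow> nat \<Rightarrow> nat \<Rightarrow> real"
  assumes T: "\<And>k. first_order (\<lambda>N. M N k 0 / real N ^ (k + 1)) (\<alpha> k) (\<beta> k)"
    and rec: "eventually (\<lambda>N. \<forall>j d. M N j (Suc d) = M N (Suc j) d + real j * M N j d) sequentially"
  shows "first_order (\<lambda>N. M N 0 k / real N ^ (k + 1)) (\<alpha> k) (\<beta> k + real (k choose 2) * \<alpha> (k - 1))"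
proof -
  have gen: "first_order (\<lambda>N. M N j d / real N ^ (j + d + 1)) (\<alpha> (j + d)) (\<beta> (j + d) + (\<Sum>t<d. real (j + t)) * \<alpha> (j + d - 1))" for j d
  proof (induction d arbitrary: j)
    case 0
    show ?case using T[of j] by simp
  next
    case (Suc d)
    define s where "s = (\<Sum>t<d. real (Suc j + t))"
    have "first_order (\<lambda>N. M N (Suc j) d / real N ^ (Suc j + d + 1) + real j * (M N j d / real N ^ (j + d + 1) / real N))
      (\<alpha> (Suc j + d) + real j * 0) (\<beta> (Suc j + d) + s * \<alpha> (Suc j + d - 1) + real j * \<alpha> (j + d))"
      unfolding s_def by (intro first_order_add first_order_cmult first_order_div[OF Suc] Suc)
    moreover have "(\<Sum>t<Suc d. real (j + t)) = real j + s"
      unfolding s_def sum.lessThan_Suc_shift by simp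
    moreover have "\<alpha> (Suc j + d) + real j * 0 = \<alpha> (j + Suc d)" by simp
    moreover have "\<beta> (Suc j + d) + s * \<alpha> (Suc j + d - 1) + real j * \<alpha> (j + d) = \<beta> (j + Suc d) + (real j + s) * \<alpha> (j + Suc d - 1)"
      by (simp add: algebra_simps)
    ultimately have "first_order (\<lambda>N. M N (Suc j) d / real N ^ (Suc j + d + 1) + real j * (M N j d / real N ^ (j + d + 1) / real N))
      (\<alpha> (j + Suc d)) (\<beta> (j + Suc d) + (\<Sum>t<Suc d. real (j + t)) * \<alpha> (j + Suc d - 1))"
      by (simp only:)
    moreover have "eventually (\<lambda>N. M N (Suc j) d / real N ^ (Suc j + d + 1) + real j * (M N j d / real N ^ (j + d + 1) / real N) =
       M N j (Suc d) / real N ^ (j + Suc d + 1)) sequentially"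
      using rec by eventually_elim (simp add: add_divide_distrib mult_ac)
    ultimately show ?case by (rule first_order_cong[rotated])
  qed
  have "(\<Sum>t<k. real (0 + t)) = real (k choose 2)"
    by (induction k) (simp_all add: numeral_2_eq_2)
  with gen[of 0 k] show ?thesis by simp
qed

subsection \<open>The exact moment formula\<close>

lemma decreasing_upto_signature:
  assumes "l \<in> sigs N"
  shows "decreasing_upto N (\<lambda>j. l ! (j - 1) + int N - int j)"
  unfolding decreasing_upto_def
proof (intro allI impI)
  fix i j :: nat assume ij: "1 \<le> i" "i < j" "j \<le> N"
  have "l ! (j - 1) \<le> l ! (i - 1)"
    using assms ij sorted_wrt_nth_less[of "(\<ge>)" l "i - 1" "j - 1"] by (auto simp: sigs_def)
  then show "l ! (j - 1) + int N - int j < l ! (i - 1) + int N - int i" using ij by simp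
qed

section \<open>Schur functions at points with equal coordinates\<close>

lemma tendsto_coordinate: "((\<lambda>v. v a) \<longlongrightarrow> u a) (at u within D)" for u :: "nat \<Rightarrow> real"
proof -
  have "isCont (\<lambda>v :: nat \<Rightarrow> real. v a) u"
    using continuous_on_product_coordinates[of a] continuous_on_eq_continuous_at[OF open_UNIV] by blast
  then show ?thesis unfolding isCont_def by (rule tendsto_within_subset) simp
qed

lemma distinct_pts_eq: "distinct_pts N = {u. inj_on u {1..N}}"
  by (auto simp: distinct_pts_def inj_on_def)

text \<open>Moving u in the direction (1, 2, 3, ...) separates all coordinates for small e. So the
  limit that defines \<open>schur\<close> is taken along a proper filter and is unique.\<close>

lemma at_within_distinct_pts_not_bot:
  assumes u: "u \<notin> distinct_pts N"
  shows "at u within distinct_pts N \<noteq> bot"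
proof
  assume bot: "at u within distinct_pts N = bot"
  define \<gamma> where "\<gamma> e = (\<lambda>i. u i + e * real i)" for e :: real
  have "continuous_on UNIV \<gamma>"
    unfolding \<gamma>_def by (intro continuous_on_coordinatewise_then_product continuous_intros)
  then have "isCont \<gamma> 0" using continuous_on_eq_continuous_at[OF open_UNIV] by blast
  then have lim: "(\<gamma> \<longlongrightarrow> u) (at 0)" unfolding isCont_def by (simp add: \<gamma>_def)
  have "eventually (\<lambda>e. \<forall>i\<in>{1..N}. \<forall>j\<in>{1..N}. i \<noteq> j \<longrightarrow> \<gamma> e i \<noteq> \<gamma> e j) (at 0)"
  proof (intro eventually_ball_finite ballI)
    fix i j assume "i \<in> {1..N}" "j \<in> {1..N}"
    show "eventually (\<lambda>e. i \<noteq> j \<longrightarrow> \<gamma> e i \<noteq> \<gamma> e j) (at 0)"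
    proof (cases "u i = u j")
      case True
      have "eventually (\<lambda>e::real. e \<noteq> 0) (at 0)" by (simp add: eventually_at_filter)
      then show ?thesis by eventually_elim (use True in \<open>auto simp: \<gamma>_def\<close>)
    next
      case False
      have "((\<lambda>e. \<gamma> e i - \<gamma> e j) \<longlongrightarrow> (u i + 0 * real i) - (u j + 0 * real j)) (at 0)"
        unfolding \<gamma>_def by (intro tendsto_intros)
      then have "eventually (\<lambda>e. \<gamma> e i - \<gamma> e j \<noteq> 0) (at 0)"
        by (rule tendsto_imp_eventually_ne) (use False in simp)
      then show ?thesis by eventually_elim auto
    qed
  qed auto
  then have "eventually (\<lambda>e. \<gamma> e \<in> distinct_pts N \<and> \<gamma> e \<noteq> u) (at 0)"
    by eventually_elim (use u in \<open>auto simp: distinct_pts_def\<close>)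
  then have "filterlim \<gamma> (at u within distinct_pts N) (at 0)"
    using lim by (simp add: filterlim_at)
  then have "filterlim \<gamma> bot (at (0::real))" using bot by simp
  from this[unfolded filterlim_iff, rule_format, of "\<lambda>_. False"] show False by simp
qed

text \<open>Where coordinates coincide, \<open>schur\<close> is a limit, and a Laurent polynomial is
  continuous at positive points.\<close>

lemma schur_eq_monomial_sum:
  assumes A: "\<And>u :: nat \<Rightarrow> real. (\<forall>i\<in>{1..N}. u i > 0) \<Longrightarrow> inj_on u {1..N} \<Longrightarrow>
      detN N (\<lambda>i j. u i powi (l ! (j - 1) + int N - int j)) =
      (\<Prod>i\<in>{1..N}. \<Prod>j\<in>{i<..N}. (u i - u j)) * (K * (\<Sum>t<n. \<Prod>i\<in>{1..N}. u i powi \<mu> t i))"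
    and u: "\<forall>i\<in>{1..N}. u i > 0"
  shows "schur N l u = K * (\<Sum>t<n. \<Prod>i\<in>{1..N}. u i powi \<mu> t i)"
proof -
  have ratio: "schur_ratio N l v = K * (\<Sum>t<n. \<Prod>i\<in>{1..N}. v i powi \<mu> t i)"
    if v: "\<forall>i\<in>{1..N}. v i > 0" and inj: "v \<in> distinct_pts N" for v
  proof -
    have inj': "inj_on v {1..N}" using inj by (simp add: distinct_pts_eq)
    have "(\<Prod>i\<in>{1..N}. \<Prod>j\<in>{i<..N}. (v i - v j)) \<noteq> 0"
      unfolding vdm_sign using vdm_nonzero[OF inj'] by simp
    then show ?thesis unfolding schur_ratio_def A[OF v inj'] by simp
  qed
  show ?thesis
  proof (cases "u \<in> distinct_pts N")
    case True
    then show ?thesis using ratio[OF u True] by (simp add: schur_def)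
  next
    case False
    let ?F = "at u within distinct_pts N"
    have ui: "u i \<noteq> 0" if "i \<in> {1..N}" for i using u that by fastforce
    have lim: "((\<lambda>v. K * (\<Sum>t<n. \<Prod>i\<in>{1..N}. v i powi \<mu> t i)) \<longlongrightarrow> K * (\<Sum>t<n. \<Prod>i\<in>{1..N}. u i powi \<mu> t i)) ?F"
      by (intro tendsto_mult tendsto_const tendsto_sum tendsto_prod tendsto_power_int tendsto_coordinate ui)
    have "eventually (\<lambda>v. \<forall>i\<in>{1..N}. v i > 0) ?F"
      by (intro eventually_ball_finite ballI order_tendstoD(1)[OF tendsto_coordinate]) (use u in auto)
    moreover have "eventually (\<lambda>v. v \<in> distinct_pts N) ?F" by (simp add: eventually_at_filter)
    ultimately have "eventually (\<lambda>v. K * (\<Sum>t<n. \<Prod>i\<in>{1..N}. v i powi \<mu> t i) = schur_ratio N l v) ?F"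
      by eventually_elim (rule ratio[symmetric])
    with lim have "(schur_ratio N l \<longlongrightarrow> K * (\<Sum>t<n. \<Prod>i\<in>{1..N}. u i powi \<mu> t i)) ?F"
      by (rule Lim_transform_eventually)
    from tendsto_Lim[OF at_within_distinct_pts_not_bot[OF False] this] show ?thesis
      using False by (simp add: schur_def)
  qed
qed

text \<open>N times the integral of the k-th binomial polynomial of N t against the Perelomov-Popov
  measure.\<close>

definition factorial_pp_moment :: "nat \<Rightarrow> real \<Rightarrow> nat \<Rightarrow> int list \<Rightarrow> real" where
  "factorial_pp_moment N q k l = (\<Sum>c\<in>{1..N}. (real_of_int (l ! (c - 1) + int N - int c) gchoose k) *
     (\<Prod>j\<in>{1..N} - {c}. (real_of_int (l ! (c - 1) + int N - int c) - real_of_int (l ! (j - 1) + int N - int j) - q) /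
        (real_of_int (l ! (c - 1) + int N - int c) - real_of_int (l ! (j - 1) + int N - int j))))"

text \<open>The expansions are chosen for all signatures at once, so that the exponent vectors
  become functions of l, as \<open>weighted_sums\<close> requires.\<close>

lemma weights_of_signatures:
  "\<exists>nn \<mu>. \<forall>l\<in>sigs N. nn l > 0 \<and>
     (\<forall>u. (\<forall>i\<in>{1..N}. u i > 0) \<longrightarrow> schur N l u / schur N l ones = weighted_sums.h N nn \<mu> (\<lambda>_. 1) l u) \<and>
     (\<forall>k q. factorial_pp_moment N q k l =
        (\<Sum>m\<le>k. real (N choose Suc m) * weighted_sums.h N nn \<mu> (\<lambda>\<nu>. fps_nth (Zf m (k - m) (real m - q) \<nu>) m) l ones)) \<and>
     (\<forall>m r s p. m < N \<longrightarrow> p < m \<longrightarrow> weighted_sums.h N nn \<mu> (\<lambda>\<nu>. fps_nth (Zf m r s \<nu>) p) l ones = 0)"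
proof -
  let ?ok = "\<lambda>l w. fst w > 0 \<and> snd (snd w) \<noteq> 0 \<and>
    (\<forall>u :: nat \<Rightarrow> real. (\<forall>i\<in>{1..N}. u i > 0) \<longrightarrow> inj_on u {1..N} \<longrightarrow>
      detN N (\<lambda>i j. u i powi (l ! (j - 1) + int N - int j)) =
      (\<Prod>i\<in>{1..N}. \<Prod>j\<in>{i<..N}. (u i - u j)) * (snd (snd w) * (\<Sum>t<fst w. \<Prod>i\<in>{1..N}. u i powi fst (snd w) t i))) \<and>
    (\<forall>k q. factorial_pp_moment N q k l =
      (\<Sum>m\<le>k. real (N choose Suc m) * ((\<Sum>t<fst w. fps_nth (Zf m (k - m) (real m - q) (fst (snd w) t)) m) / real (fst w)))) \<and>
    (\<forall>m r s p. m < N \<longrightarrow> p < m \<longrightarrow> (\<Sum>t<fst w. fps_nth (Zf m r s (fst (snd w) t)) p) = 0)"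
  have "\<exists>w :: nat \<times> (nat \<Rightarrow> nat \<Rightarrow> int) \<times> real. ?ok l w" if l: "l \<in> sigs N" for l
  proof -
    obtain n \<mu> K where "?ok l (n, \<mu>, K)"
      using schur_operator_formula[OF decreasing_upto_signature[OF l]]
      unfolding factorial_pp_moment_def fst_conv snd_conv by blast
    then show ?thesis by blast
  qed
  then have "\<forall>l\<in>sigs N. \<exists>w :: nat \<times> (nat \<Rightarrow> nat \<Rightarrow> int) \<times> real. ?ok l w" by blast
  from bchoice[OF this] obtain W :: "int list \<Rightarrow> nat \<times> (nat \<Rightarrow> nat \<Rightarrow> int) \<times> real"
    where W: "\<And>l. l \<in> sigs N \<Longrightarrow> ?ok l (W l)" by blast
  define nn where "nn l = fst (W l)" for l
  define \<mu> where "\<mu> l = fst (snd (W l))" for l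
  define K where "K l = snd (snd (W l))" for l
  have ones1: "weighted_sums.h N nn \<mu> P l ones = (\<Sum>t<nn l. P (\<mu> l t)) / real (nn l)" for P l
    by (simp add: weighted_sums.h_def ones_def)
  show ?thesis
  proof (intro exI[of _ nn] exI[of _ \<mu>] ballI)
    fix l assume l: "l \<in> sigs N"
    note ok = W[OF l, folded nn_def \<mu>_def K_def]
    have sch: "schur N l u = K l * (\<Sum>t<nn l. \<Prod>i\<in>{1..N}. u i powi \<mu> l t i)" if "\<forall>i\<in>{1..N}. u i > 0" for u
      by (rule schur_eq_monomial_sum[OF _ that]) (use ok in blast)
    have "schur N l ones = K l * real (nn l)"
      by (subst sch) (simp_all add: ones_def)
    then have "schur N l u / schur N l ones = weighted_sums.h N nn \<mu> (\<lambda>_. 1) l u" if "\<forall>i\<in>{1..N}. u i > 0" for u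
      using sch[OF that] ok by (simp add: weighted_sums.h_def)
    then show "nn l > 0 \<and>
     (\<forall>u. (\<forall>i\<in>{1..N}. u i > 0) \<longrightarrow> schur N l u / schur N l ones = weighted_sums.h N nn \<mu> (\<lambda>_. 1) l u) \<and>
     (\<forall>k q. factorial_pp_moment N q k l =
        (\<Sum>m\<le>k. real (N choose Suc m) * weighted_sums.h N nn \<mu> (\<lambda>\<nu>. fps_nth (Zf m (k - m) (real m - q) \<nu>) m) l ones)) \<and>
     (\<forall>m r s p. m < N \<longrightarrow> p < m \<longrightarrow> weighted_sums.h N nn \<mu> (\<lambda>\<nu>. fps_nth (Zf m r s \<nu>) p) l ones = 0)"
      using ok unfolding ones1 by auto
  qed
qed

text \<open>For nonnegative terms the unconditional sum is absolute, which gives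
  integrability.\<close>

lemma pmf_has_sum_expectation:
  fixes p :: "'a pmf" and f :: "'a \<Rightarrow> real"
  assumes sub: "set_pmf p \<subseteq> A" and nonneg: "\<And>x. x \<in> A \<Longrightarrow> f x \<ge> 0"
    and hs: "((\<lambda>x. pmf p x * f x) has_sum s) A"
  shows "integrable (measure_pmf p) f" "measure_pmf.expectation p f = s"
proof -
  have hs': "((\<lambda>x. pmf p x * f x) has_sum s) UNIV"
    using hs by (rule has_sum_cong_neutral[THEN iffD1, rotated -1]) (use sub in \<open>auto simp: set_pmf_eq\<close>)
  have nn: "pmf p x * f x \<ge> 0" for x
    using nonneg sub by (cases "x \<in> set_pmf p") (auto simp: set_pmf_eq)
  have "(\<lambda>x. norm (pmf p x * f x)) summable_on UNIV"
    using hs' nn by (auto simp: summable_on_def)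
  then have abs: "Infinite_Set_Sum.abs_summable_on (\<lambda>x. pmf p x * f x) UNIV"
    using abs_summable_equivalent by blast
  then have "integrable (count_space UNIV) (\<lambda>x. pmf p x * f x)"
    by (simp add: Infinite_Set_Sum.abs_summable_on_def)
  then show "integrable (measure_pmf p) f"
    unfolding measure_pmf_eq_density by (subst integrable_density) auto
  have "measure_pmf.expectation p f = infsetsum (\<lambda>x. pmf p x * f x) UNIV" by (rule pmf_expectation_eq_infsetsum)
  also have "\<dots> = infsum (\<lambda>x. pmf p x * f x) UNIV" by (rule infsetsum_infsum[OF abs])
  also have "\<dots> = s" using hs' by (rule infsumI)
  finally show "measure_pmf.expectation p f = s" .
qed

section \<open>From the generating function to expected factorial moments\<close>

text \<open>Coefficients of the exponential of the series \<Lambda> without its constant term: the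
  recursion of \<open>jet_log_recursion\<close>, started at 1 instead of at the jet of S.\<close>

fun grec :: "(nat \<Rightarrow> real fps) \<Rightarrow> nat \<Rightarrow> real fps" where
  "grec \<Lambda> 0 = 1"
| "grec \<Lambda> (Suc r) = fps_const (1 / real (Suc r)) * (\<Sum>b\<in>{..r}. of_nat (Suc b) * (\<Lambda> (Suc b) * grec \<Lambda> (r - b)))"

declare grec.simps(2) [simp del]

definition log_jet :: "nat \<Rightarrow> int list pmf \<Rightarrow> nat \<Rightarrow> nat \<Rightarrow> nat \<Rightarrow> real fps" where
  "log_jet N rho m i b = fps_const (1 / fact b) * jet real (Suc m) (pderivs (replicate b i) (\<lambda>u. ln (SGF N rho u)))"

text \<open>The expected \<open>Zf\<close> with the jet of S divided out. The exponent k - q is (m -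
  q) + (k - m), by the compensation in \<open>F_Zf\<close>.\<close>

definition Zs :: "nat \<Rightarrow> int list pmf \<Rightarrow> real \<Rightarrow> nat \<Rightarrow> nat \<Rightarrow> real fps" where
  "Zs N rho q k m = (\<Sum>i\<in>{1..Suc m}. fps_const (dd real {1..Suc m} i) *
     (sbin (real k - q) (real i) * grec (log_jet N rho m i) (k - m)))"

text \<open>Z is the inverse of J times J Z; that inverse has constant term 1 and J Z starts at
  order m. This is where the vanishing of the lower coefficients is used.\<close>

lemma fps_nth_mult_leading:
  fixes J Z :: "real fps"
  assumes "fps_nth J 0 = 1" "\<And>p. p < m \<Longrightarrow> fps_nth (J * Z) p = 0"
  shows "fps_nth (J * Z) m = fps_nth Z m"
proof -
  have "Z = inverse J * (J * Z)"
    using assms(1) by (simp add: mult.assoc[symmetric] inverse_mult_eq_1)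
  then have "fps_nth Z m = fps_nth (inverse J * (J * Z)) m" by (rule arg_cong)
  also have "\<dots> = (\<Sum>i=0..m. fps_nth (inverse J) i * fps_nth (J * Z) (m - i))" by (rule fps_mult_nth)
  also have "\<dots> = (\<Sum>i\<in>{0}. fps_nth (inverse J) i * fps_nth (J * Z) (m - i))"
    by (rule sum.mono_neutral_right) (use assms(2) in auto)
  also have "\<dots> = fps_nth (J * Z) m" using assms(1) by simp
  finally show ?thesis by simp
qed

lemma poly_bounded_Zf:
  assumes m: "m < N"
  shows "poly_bounded N (\<lambda>\<nu>. fps_nth (Zf m r s \<nu>) p)"
proof -
  have nN: "Suc m \<le> N" using m by simp
  have Z: "fps_nth (Zf m r s \<nu>) p = (\<Sum>i\<in>{1..Suc m}. \<Sum>b\<in>{0..p}. dd real {1..Suc m} i * fps_nth (sbin s (real i)) b *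
      ((real_of_int (\<nu> i) gchoose r) * fps_nth (mono_fps real (Suc m) \<nu>) (p - b)))" for \<nu>
    unfolding Zf_def sbin_def[symmetric] mono_fps_def[symmetric] fps_sum_nth fps_mult_left_const_nth fps_mult_nth[of "sbin s _"]
      sum_distrib_left by (simp only: mult.assoc)
  show ?thesis unfolding Z
    by (intro poly_bounded_sum poly_bounded_mult poly_bounded_const poly_bounded_gbinomial poly_bounded_mono_fps nN)
       (use nN in auto)
qed

text \<open>Under the expectation the weights of the monomials become derivatives of the generating
  function S. Each of these is S times a polynomial in derivatives of ln S, so S survives only as
  the factor \<open>?J\<close>, which does not affect the coefficient of order m.\<close>

lemma expected_factorial_moment:
  assumes sig: "set_pmf rho \<subseteq> sigs N" and conv: "SGF_unif_conv N rho"
  shows "integrable (measure_pmf rho) (factorial_pp_moment N q k)"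
    and "measure_pmf.expectation rho (factorial_pp_moment N q k) =
      (\<Sum>m\<le>k. real (N choose Suc m) * fps_nth (Zs N rho q k m) m)"
proof -
  obtain nn \<mu> where ok: "\<forall>l\<in>sigs N. nn l > 0 \<and>
     (\<forall>u. (\<forall>i\<in>{1..N}. u i > 0) \<longrightarrow> schur N l u / schur N l ones = weighted_sums.h N nn \<mu> (\<lambda>_. 1) l u) \<and>
     (\<forall>k q. factorial_pp_moment N q k l =
        (\<Sum>m\<le>k. real (N choose Suc m) * weighted_sums.h N nn \<mu> (\<lambda>\<nu>. fps_nth (Zf m (k - m) (real m - q) \<nu>) m) l ones)) \<and>
     (\<forall>m r s p. m < N \<longrightarrow> p < m \<longrightarrow> weighted_sums.h N nn \<mu> (\<lambda>\<nu>. fps_nth (Zf m r s \<nu>) p) l ones = 0)"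
    using weights_of_signatures[of N] by (elim exE) (rule that)
  note ok' = bspec[OF ok]
  note W1 = ok'[THEN conjunct1]
  note W2 = ok'[THEN conjunct2, THEN conjunct1, THEN spec, THEN mp]
  note W3 = ok'[THEN conjunct2, THEN conjunct2, THEN conjunct1, THEN spec, THEN spec]
  note W4 = ok'[THEN conjunct2, THEN conjunct2, THEN conjunct2, THEN spec, THEN spec, THEN spec, THEN spec, THEN mp, THEN mp]
  obtain e0 where e0: "e0 > 0" and ul: "uniform_limit (cube N e0)
       (\<lambda>F u. \<Sum>l\<in>F. schur_term N rho u l) (SGF N rho) (finite_subsets_at_top (sigs N))"
    using conv unfolding SGF_unif_conv_def cube_def by blast
  \<comment> \<open>The bound 1/2 keeps all coordinates on the cube positive.\<close>
  define e where "e = min e0 (1 / 2)"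
  have e: "0 < e" "e < 1" "e \<le> e0" using e0 by (auto simp: e_def)
  interpret weighted_sums N rho nn \<mu> e .
  have pos: "u i > 0" if "u \<in> cube N e" "i \<in> {1..N}" for u i
  proof -
    have "\<bar>u i - 1\<bar> < e" using that unfolding cube_def by blast
    then show ?thesis using e by linarith
  qed
  have hpos: "h (\<lambda>_. 1) l u > 0" if "u \<in> cube N e" "l \<in> sigs N" for u l
    unfolding h_def using pos[OF that(1)] W1[OF that(2)]
    by (intro divide_pos_pos sum_pos mult_pos_pos prod_pos) (auto intro: zero_less_power_int)
  have SGF: "integrable (measure_pmf rho) (\<lambda>l. h (\<lambda>_. 1) l u)" "F (\<lambda>_. 1) u = SGF N rho u" if u: "u \<in> cube N e" for u
  proof -
    have "u \<in> cube N e0" using u e(3) unfolding cube_def by fastforce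
    from tendsto_uniform_limitI[OF ul this]
    have "(schur_term N rho u has_sum SGF N rho u) (sigs N)" by (simp add: has_sum_def)
    moreover have "schur_term N rho u l = pmf rho l * h (\<lambda>_. 1) l u" if "l \<in> sigs N" for l
      using W2[OF that, of u] pos[OF u] by (simp add: schur_term_def flip: times_divide_eq_right)
    ultimately have hs: "((\<lambda>l. pmf rho l * h (\<lambda>_. 1) l u) has_sum SGF N rho u) (sigs N)"
      using has_sum_cong[of "sigs N" "schur_term N rho u" "\<lambda>l. pmf rho l * h (\<lambda>_. 1) l u"] by simp
    show "integrable (measure_pmf rho) (\<lambda>l. h (\<lambda>_. 1) l u)" "F (\<lambda>_. 1) u = SGF N rho u"
      unfolding F_def using pmf_has_sum_expectation[OF sig _ hs] hpos[OF u] by (auto intro: less_imp_le)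
  qed
  interpret integrable_weighted_sums N rho nn \<mu> e
    by unfold_locales (use e SGF in auto)
  have sub: "cube N (e / 3) \<subseteq> cube N e" using e unfolding cube_def by fastforce
  let ?S = "F (\<lambda>_. 1)"
  let ?L = "\<lambda>u. ln (SGF N rho u)"
  have PB1: "poly_bounded N (\<lambda>_. 1)" by (rule poly_bounded_const)
  \<comment> \<open>A single signature of positive mass already contributes a positive
    amount.\<close>
  have Spos: "?S u > 0" if u: "u \<in> cube N (e / 3)" for u
  proof -
    obtain l0 where l0: "l0 \<in> set_pmf rho" using set_pmf_not_empty[of rho] by blast
    have uc: "u \<in> cube N e" using u sub by blast
    have "0 < pmf rho l0 * h (\<lambda>_. 1) l0 u" using l0 sig hpos[OF uc] by (auto simp: pmf_positive)
    also have "\<dots> = measure_pmf.expectation rho (\<lambda>l. indicator {l0} l * h (\<lambda>_. 1) l0 u)"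
      by (simp add: measure_pmf_single)
    also have "\<dots> \<le> ?S u" unfolding F_def
    proof (rule integral_mono_AE)
      show "AE l in measure_pmf rho. indicator {l0} l * h (\<lambda>_. 1) l0 u \<le> h (\<lambda>_. 1) l u"
        using sig hpos[OF uc] by (auto simp: AE_measure_pmf_iff indicator_def intro: less_imp_le)
      show "integrable (measure_pmf rho) (\<lambda>l. indicator {l0} l * h (\<lambda>_. 1) l0 u)"
        by (rule measure_pmf.integrable_const_bound[where B = "\<bar>h (\<lambda>_. 1) l0 u\<bar>"]) (auto simp: indicator_def)
    qed (rule integrable_h[OF PB1 u])
    finally show ?thesis .
  qed
  have SL: "?L u = ln (?S u)" if "u \<in> cube N (e / 3)" for u using SGF(2) that sub by auto
  have SmS: "Smooth N (e / 3) ?S" by (rule Smooth_F[OF PB1])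
  have SmL: "Smooth N (e / 3) ?L"
    unfolding Smooth_def
  proof
    fix n
    show "smooth N (e / 3) n ?L"
      by (rule smooth_cong[OF _ smooth_ln[of N "e / 3" ?S n]]) (use Spos SL smooth_F[OF PB1] in auto)
  qed
  have dL: "pderiv_i i ?S u = ?S u * pderiv_i i ?L u" if i: "i \<in> {1..N}" and u: "u \<in> cube N (e / 3)" for i u
  proof -
    have "pderiv_i i ?L u = pderiv_i i (\<lambda>u. ln (?S u)) u" by (rule pderiv_i_cong[OF SL u i])
    also have "\<dots> = pderiv_i i ?S u * inverse (?S u)"
      by (rule pderiv_i_eqI) (rule ln_has_pderiv[OF Spos[OF u] Smooth_has_pderiv[OF SmS i u]])
    finally show ?thesis using Spos[OF u] by simp
  qed
  have S1: "?S ones = 1"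
  proof -
    have "h (\<lambda>_. 1) l ones = 1" if "l \<in> sigs N" for l
      using W1[OF that] by (simp add: h_def ones_def)
    then have "?S ones = measure_pmf.expectation rho (\<lambda>_. 1)"
      unfolding F_def using sig by (intro integral_cong_AE) (auto simp: AE_measure_pmf_iff)
    then show ?thesis by simp
  qed
  have main: "F (\<lambda>\<nu>. fps_nth (Zf m (k - m) (real m - q) \<nu>) m) ones = fps_nth (Zs N rho q k m) m" if m: "m < N" "m \<le> k" for m
  proof -
    interpret jets N "Suc m" "e / 3" real by unfold_locales (use m e in auto)
    let ?J = "jet real (Suc m) ?S"
    have Lam: "fps_nth (ejet i ?L) b = log_jet N rho m i b" for i b by (simp add: ejet_def log_jet_def)
    \<comment> \<open>Both sides obey the same recursion, which is linear in the starting value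
      \<open>?J\<close>.\<close>
    have gr: "fps_nth (ejet i ?S) r = ?J * grec (log_jet N rho m i) r" if i: "i \<in> {1..Suc m}" for i r
    proof (induction r rule: less_induct)
      case (less r)
      show ?case
      proof (cases r)
        case 0
        then show ?thesis by (simp add: ejet_def)
      next
        case (Suc r')
        have iN: "i \<in> {1..N}" by (rule idx[OF i])
        have "of_nat r * fps_nth (ejet i ?S) r = (\<Sum>b\<le>r'. of_nat (Suc b) * (log_jet N rho m i (Suc b) * fps_nth (ejet i ?S) (r' - b)))"
          using jet_log_recursion[OF SmS SmL iN dL[OF iN], of r'] unfolding Lam Suc .
        also have "\<dots> = (\<Sum>b\<le>r'. of_nat (Suc b) * (log_jet N rho m i (Suc b) * (?J * grec (log_jet N rho m i) (r' - b))))"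
        proof (rule sum.cong[OF refl])
          fix b
          have "fps_nth (ejet i ?S) (r' - b) = ?J * grec (log_jet N rho m i) (r' - b)" by (rule less.IH) (simp add: Suc)
          then show "of_nat (Suc b) * (log_jet N rho m i (Suc b) * fps_nth (ejet i ?S) (r' - b)) =
            of_nat (Suc b) * (log_jet N rho m i (Suc b) * (?J * grec (log_jet N rho m i) (r' - b)))" by simp
        qed
        also have "\<dots> = ?J * (\<Sum>b\<le>r'. of_nat (Suc b) * (log_jet N rho m i (Suc b) * grec (log_jet N rho m i) (r' - b)))"
          unfolding sum_distrib_left by (simp only: mult_ac)
        finally have "fps_const (1 / real r) * (of_nat r * fps_nth (ejet i ?S) r) = ?J * grec (log_jet N rho m i) r"
          unfolding Suc grec.simps by (simp only: mult_ac)
        moreover have "fps_const (1 / real r) * (of_nat r * G) = G" for G :: "real fps"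
          unfolding fps_of_nat[symmetric] mult.assoc[symmetric] using Suc by simp
        ultimately show ?thesis by simp
      qed
    qed
    have JZ: "F (\<lambda>\<nu>. fps_nth (Zf m (k - m) (real m - q) \<nu>) p) ones = fps_nth (?J * Zs N rho q k m) p" for p
    proof -
      have s: "real m - q + real (k - m) = real k - q" using m by simp
      have "F (\<lambda>\<nu>. fps_nth (Zf m (k - m) (real m - q) \<nu>) p) ones =
        fps_nth (\<Sum>i\<in>{1..Suc m}. fps_const (dd real {1..Suc m} i) *
          (sbin (real k - q) (real i) * (?J * grec (log_jet N rho m i) (k - m)))) p"
        unfolding F_Zf[OF m(1)] s by (rule arg_cong[where f = "\<lambda>z. fps_nth z p"], rule sum.cong[OF refl]) (simp only: gr)
      also have "(\<Sum>i\<in>{1..Suc m}. fps_const (dd real {1..Suc m} i) *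
          (sbin (real k - q) (real i) * (?J * grec (log_jet N rho m i) (k - m)))) = ?J * Zs N rho q k m"
        unfolding Zs_def sum_distrib_left by (simp only: mult_ac)
      finally show ?thesis .
    qed
    \<comment> \<open>The coefficients below m vanish for every single signature, before the
      expectation is taken.\<close>
    have low: "F (\<lambda>\<nu>. fps_nth (Zf m (k - m) (real m - q) \<nu>) p) ones = 0" if "p < m" for p
    proof -
      have "F (\<lambda>\<nu>. fps_nth (Zf m (k - m) (real m - q) \<nu>) p) ones = measure_pmf.expectation rho (\<lambda>_. 0)"
        unfolding F_def using sig W4[OF _ m(1) that] by (intro integral_cong_AE) (auto simp: AE_measure_pmf_iff)
      then show ?thesis by simp
    qed
    show ?thesis unfolding JZ
      by (rule fps_nth_mult_leading) (use low JZ S1 in \<open>auto simp: jet_def\<close>)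
  qed
  \<comment> \<open>Jets in m + 1 variables need m < N; for larger m the factor
    \<open>N choose Suc m\<close> is 0.\<close>
  let ?A = "{m. m \<le> k \<and> m < N}"
  let ?f = "\<lambda>l. \<Sum>m\<in>?A. real (N choose Suc m) * h (\<lambda>\<nu>. fps_nth (Zf m (k - m) (real m - q) \<nu>) m) l ones"
  have finA: "finite ?A" by simp
  have restr: "(\<Sum>m\<le>k. real (N choose Suc m) * c m) = (\<Sum>m\<in>?A. real (N choose Suc m) * c m)" for c
    by (rule sum.mono_neutral_right) (auto simp: binomial_eq_0)
  have eq: "factorial_pp_moment N q k l = ?f l" if "l \<in> sigs N" for l
    unfolding W3[OF that] by (rule restr)
  have intf: "integrable (measure_pmf rho) ?f"
    by (intro Bochner_Integration.integrable_sum Bochner_Integration.integrable_mult_right integrable_h poly_bounded_Zf ones_cube) auto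
  have AE: "AE l in measure_pmf rho. factorial_pp_moment N q k l = ?f l"
    using sig eq by (auto simp: AE_measure_pmf_iff)
  show "integrable (measure_pmf rho) (factorial_pp_moment N q k)"
    using integrable_cong_AE[OF _ _ AE] intf by simp
  have "measure_pmf.expectation rho (factorial_pp_moment N q k) = measure_pmf.expectation rho ?f"
    by (rule integral_cong_AE[OF _ _ AE]) auto
  also have "\<dots> = (\<Sum>m\<in>?A. measure_pmf.expectation rho (\<lambda>l. real (N choose Suc m) * h (\<lambda>\<nu>. fps_nth (Zf m (k - m) (real m - q) \<nu>) m) l ones))"
    by (intro Bochner_Integration.integral_sum Bochner_Integration.integrable_mult_right integrable_h poly_bounded_Zf ones_cube) auto
  also have "\<dots> = (\<Sum>m\<in>?A. real (N choose Suc m) * F (\<lambda>\<nu>. fps_nth (Zf m (k - m) (real m - q) \<nu>) m) ones)"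
    by (simp add: F_def)
  also have "\<dots> = (\<Sum>m\<in>?A. real (N choose Suc m) * fps_nth (Zs N rho q k m) m)"
    by (intro sum.cong refl) (simp add: main)
  finally show "measure_pmf.expectation rho (factorial_pp_moment N q k) = (\<Sum>m\<le>k. real (N choose Suc m) * fps_nth (Zs N rho q k m) m)"
    unfolding restr .
qed

subsection \<open>Asymptotics of the moments\<close>

lemma deriv_shift_one: "deriv (\<lambda>v. f (1 + v)) = (\<lambda>v. deriv f (1 + v))" for f :: "real \<Rightarrow> real"
proof -
  have "((\<lambda>v. f (1 + v)) has_real_derivative D) (at v) \<longleftrightarrow> (f has_real_derivative D) (at (1 + v))" for D v
    using DERIV_shift[where f=f and x=v and z=1 and y=D] by (simp only: add.commute)
  then show ?thesis by (simp add: fun_eq_iff deriv_def)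
qed

text \<open>The expansion at 1 of the derivative of \<open>egf_at1 a\<close>.\<close>

definition dfps :: "(nat \<Rightarrow> real) \<Rightarrow> real fps" where
  "dfps a = Abs_fps (\<lambda>p. a (Suc p) / fact p)"

lemma deriv_egf_expansion:
  assumes "\<exists>r>0. \<forall>z. \<bar>z - 1\<bar> < r \<longrightarrow> summable (\<lambda>k. a k * (z - 1) ^ k / fact k)"
  shows "(\<lambda>v. deriv (egf_at1 a) (1 + v)) has_fps_expansion dfps a"
proof -
  obtain r where r: "r > 0" "\<And>z. \<bar>z - 1\<bar> < r \<Longrightarrow> summable (\<lambda>k. a k * (z - 1) ^ k / fact k)" using assms by blast
  have "(\<lambda>v. egf_at1 a (1 + v)) has_fps_expansion Abs_fps (\<lambda>k. a k / fact k)"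
  proof (rule has_fps_expansionI)
    have "eventually (\<lambda>v. v \<in> ball 0 r) (nhds 0)" using r(1) by (intro eventually_nhds_in_open) auto
    then show "eventually (\<lambda>v. (\<lambda>n. fps_nth (Abs_fps (\<lambda>k. a k / fact k)) n * v ^ n) sums egf_at1 a (1 + v)) (nhds 0)"
    proof eventually_elim
      case (elim v)
      have "summable (\<lambda>k. a k * (1 + v - 1) ^ k / fact k)" by (rule r(2)) (use elim in simp)
      then show ?case unfolding egf_at1_def by (simp add: summable_sums)
    qed
  qed
  from has_fps_expansion_deriv[OF this, unfolded deriv_shift_one]
  have "(\<lambda>v. deriv (egf_at1 a) (1 + v)) has_fps_expansion fps_deriv (Abs_fps (\<lambda>k. a k / fact k))" .
  also have "fps_deriv (Abs_fps (\<lambda>k. a k / fact k)) = dfps a"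
    by (rule fps_ext) (simp add: dfps_def del: of_nat_Suc)
  finally show ?thesis .
qed

lemma fps_expansion_power:
  fixes f :: "real \<Rightarrow> real"
  shows "f has_fps_expansion F \<Longrightarrow> (\<lambda>v. f v ^ n) has_fps_expansion F ^ n"
  by (induction n) (auto intro: has_fps_expansion_mult)

text \<open>Each m-th derivative at 1 is m! times a coefficient, and m!/(m + 1)! leaves the 1/(m +
  1) of \<open>mom\<close>.\<close>

lemma mom_eq_derivatives:
  assumes "(\<lambda>v. f (1 + v)) has_fps_expansion P"
  shows "(\<Sum>m\<le>k. real (k choose m) / fact (m + 1) *
     (deriv ^^ m) (\<lambda>u. u powr (real k - q) * f u ^ (k - m)) 1) = mom P q k"
proof -
  have "(deriv ^^ m) (\<lambda>u. u powr (real k - q) * f u ^ (k - m)) 1 = fact m * fps_nth (fps_binomial (real k - q) * P ^ (k - m)) m" for m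
    by (rule higher_deriv_fps_expansion) (intro has_fps_expansion_mult powr_fps_expansion fps_expansion_power assms)
  moreover have "fact m / fact (m + 1) = 1 / real (m + 1)" for m by simp
  ultimately show ?thesis unfolding mom_def
    by (intro sum.cong refl) (simp add: divide_inverse mult_ac)
qed

lemma mom'_eq_derivatives:
  assumes f: "(\<lambda>v. f (1 + v)) has_fps_expansion P" and g: "(\<lambda>v. g (1 + v)) has_fps_expansion Q"
  shows "(\<Sum>m<k. real (k choose (m + 1)) / fact m *
     (deriv ^^ m) (\<lambda>u. u powr (real k - q) * (g u - (1 - q) / (2 * u)) * f u ^ (k - m - 1)) 1) = mom' P Q q k"
proof -
  have inv: "(\<lambda>v. (1 - q) / (2 * (1 + v))) has_fps_expansion fps_const ((1 - q) / 2) * fps_binomial (-1)"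
  proof -
    have "(\<lambda>v::real. inverse (1 + v)) has_fps_expansion inverse (1 + fps_X)"
      by (intro has_fps_expansion_inverse has_fps_expansion_add has_fps_expansion_fps_X has_fps_expansion_1) simp
    then have "(\<lambda>v::real. (1 - q) / 2 * inverse (1 + v)) has_fps_expansion fps_const ((1 - q) / 2) * fps_binomial (-1)"
      unfolding fps_binomial_minus_one by (rule has_fps_expansion_cmult_left)
    moreover have "(\<lambda>v. (1 - q) / 2 * inverse (1 + v)) = (\<lambda>v. (1 - q) / (2 * (1 + v)))" by (simp only: divide_inverse inverse_mult_distrib mult_ac)
    ultimately show ?thesis by simp
  qed
  have "(deriv ^^ m) (\<lambda>u. u powr (real k - q) * (g u - (1 - q) / (2 * u)) * f u ^ (k - m - 1)) 1 =
     fact m * fps_nth (fps_binomial (real k - q) * (Q - fps_const ((1 - q) / 2) * fps_binomial (-1)) * P ^ (k - m - 1)) m" for m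
    by (rule higher_deriv_fps_expansion)
       (intro has_fps_expansion_mult has_fps_expansion_diff powr_fps_expansion fps_expansion_power f g inv)
  then show ?thesis unfolding mom'_def by simp
qed

section \<open>Two-term limits of the moments under the hypotheses\<close>

locale asymptotic_data =
  fixes rho :: "nat \<Rightarrow> int list pmf" and a b :: "nat \<Rightarrow> real"
  assumes rho_sig: "\<And>N. set_pmf (rho N) \<subseteq> sigs N"
    and rho_conv: "\<And>N. SGF_unif_conv N (rho N)"
    and lim_diag: "\<And>k i0. k \<ge> 1 \<Longrightarrow> i0 \<ge> 1 \<Longrightarrow>
        (\<lambda>N. pderivs (replicate k i0) (\<lambda>u. ln (SGF N (rho N) u)) ones - real N * a k) \<longlonglongrightarrow> b k"
    and lim_mixed: "\<And>is. (\<forall>i\<in>set is. i \<ge> 1) \<Longrightarrow> card (set is) \<ge> 2 \<Longrightarrow>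
        (\<lambda>N. pderivs is (\<lambda>u. ln (SGF N (rho N) u)) ones) \<longlonglongrightarrow> 0"
begin

abbreviation "L N \<equiv> (\<lambda>u. ln (SGF N (rho N) u))"

text \<open>Further differentiation along the line puts indices in front of the list, so at least
  two distinct ones remain.\<close>

lemma jetc_mixed:
  assumes "\<forall>i\<in>set is. i \<ge> 1" "card (set is) \<ge> 2"
  shows "(\<lambda>N. jetc x n p (pderivs is (L N))) \<longlonglongrightarrow> 0"
  using assms
proof (induction p arbitrary: "is")
  case 0
  then show ?case using lim_mixed by simp
next
  case (Suc p)
  have "(\<lambda>N. x i * jetc x n p (pderivs (i # is) (L N))) \<longlonglongrightarrow> x i * 0" if "i \<in> {1..n}" for i
  proof (intro tendsto_mult tendsto_const Suc.IH)
    show "\<forall>j\<in>set (i # is). j \<ge> 1" using Suc.prems that by auto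
    have "card (set is) \<le> card (set (i # is))" by (intro card_mono) auto
    then show "card (set (i # is)) \<ge> 2" using Suc.prems by linarith
  qed
  then have "(\<lambda>N. \<Sum>i\<in>{1..n}. x i * jetc x n p (pderivs (i # is) (L N))) \<longlonglongrightarrow> (\<Sum>i\<in>{1..n}. x i * 0)"
    by (rule tendsto_sum)
  then show ?case by simp
qed

text \<open>Of all directions only i keeps the derivative unmixed, contributing a factor x_i per
  step; the others tend to 0 by \<open>jetc_mixed\<close>.\<close>

lemma jetc_diag:
  assumes "i \<in> {1..n}" "k \<ge> 1"
  shows "(\<lambda>N. jetc x n p (pderivs (replicate k i) (L N)) - real N * (x i ^ p * a (k + p))) \<longlonglongrightarrow> x i ^ p * b (k + p)"
  using assms(2)
proof (induction p arbitrary: k)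
  case 0
  then show ?case using lim_diag[of k i] assms(1) by simp
next
  case (Suc p)
  have off: "(\<lambda>N. \<Sum>j\<in>{1..n} - {i}. x j * jetc x n p (pderivs (j # replicate k i) (L N))) \<longlonglongrightarrow> (\<Sum>j\<in>{1..n} - {i}. x j * 0)"
  proof (intro tendsto_sum tendsto_mult tendsto_const jetc_mixed)
    fix j assume j: "j \<in> {1..n} - {i}"
    have s: "set (j # replicate k i) = {j, i}" using Suc.prems by (cases k) auto
    show "\<forall>l\<in>set (j # replicate k i). l \<ge> 1" unfolding s using j assms(1) by auto
    show "card (set (j # replicate k i)) \<ge> 2" unfolding s using j by auto
  qed
  have "(\<lambda>N. x i * (jetc x n p (pderivs (replicate (Suc k) i) (L N)) - real N * (x i ^ p * a (Suc k + p)))) \<longlonglongrightarrow> x i * (x i ^ p * b (Suc k + p))"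
    by (intro tendsto_mult tendsto_const Suc.IH) simp
  from tendsto_add[OF this off]
  have "(\<lambda>N. x i * (jetc x n p (pderivs (replicate (Suc k) i) (L N)) - real N * (x i ^ p * a (Suc k + p))) +
     (\<Sum>j\<in>{1..n} - {i}. x j * jetc x n p (pderivs (j # replicate k i) (L N)))) \<longlonglongrightarrow> x i ^ Suc p * b (k + Suc p)"
    by (simp add: mult.assoc)
  moreover have "x i * (jetc x n p (pderivs (replicate (Suc k) i) (L N)) - real N * (x i ^ p * a (Suc k + p))) +
     (\<Sum>j\<in>{1..n} - {i}. x j * jetc x n p (pderivs (j # replicate k i) (L N))) =
     jetc x n (Suc p) (pderivs (replicate k i) (L N)) - real N * (x i ^ Suc p * a (k + Suc p))" for N
  proof -
    have "jetc x n (Suc p) (pderivs (replicate k i) (L N)) = (\<Sum>j\<in>{1..n}. x j * jetc x n p (pderivs (j # replicate k i) (L N)))"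
      by simp
    also have "\<dots> = x i * jetc x n p (pderivs (replicate (Suc k) i) (L N)) + (\<Sum>j\<in>{1..n} - {i}. x j * jetc x n p (pderivs (j # replicate k i) (L N)))"
      unfolding replicate_Suc by (rule sum.remove) (use assms in auto)
    finally show ?thesis by (simp add: algebra_simps del: jetc.simps pderivs.simps)
  qed
  ultimately show ?case by (simp only:)
qed

abbreviation "sc y G \<equiv> G oo (fps_const (y::real) * fps_X)"

text \<open>At this precision ln S behaves like a sum of N \<Psi> + \<Phi> over the variables, so
  the jet is that of a derivative of one summand at 1 + i X.\<close>

lemma log_jet_asy:
  assumes "i \<in> {1..Suc m}"
  shows "asy 1 (\<lambda>N. log_jet N (rho N) m i (Suc c))
    (Abs_fps (\<lambda>p. real i ^ p * a (Suc c + p) / (fact (Suc c) * fact p)))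
    (Abs_fps (\<lambda>p. real i ^ p * b (Suc c + p) / (fact (Suc c) * fact p)))"
  unfolding asy_def
proof
  fix p
  let ?J = "\<lambda>N. jetc real (Suc m) p (pderivs (replicate (Suc c) i) (L N))"
  let ?c = "1 / (fact (Suc c) * fact p) :: real"
  have "(\<lambda>N. ?c * (?J N - real N * (real i ^ p * a (Suc c + p)))) \<longlonglongrightarrow> ?c * (real i ^ p * b (Suc c + p))"
    by (intro tendsto_mult tendsto_const jetc_diag assms) simp
  moreover have "eventually (\<lambda>N. ?c * (?J N - real N * (real i ^ p * a (Suc c + p))) =
     real N * (fps_nth (log_jet N (rho N) m i (Suc c)) p / real N ^ 1 - real i ^ p * a (Suc c + p) / (fact (Suc c) * fact p))) sequentially"
    using eventually_pos_nat
  proof eventually_elim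
    case (elim N)
    have "k1 * (J - n * A) = n * (k1 * J / n ^ 1 - A * k1)" if "n > 0" for k1 J n A :: real
      using that by (simp add: field_simps)
    from this[of "real N" ?c "?J N" "real i ^ p * a (Suc c + p)"] elim show ?case
      by (simp add: log_jet_def jet_def del: jetc.simps pderivs.simps replicate_Suc fact_Suc)
  qed
  ultimately have "(\<lambda>N. real N * (fps_nth (log_jet N (rho N) m i (Suc c)) p / real N ^ 1 - real i ^ p * a (Suc c + p) / (fact (Suc c) * fact p)))
     \<longlonglongrightarrow> ?c * (real i ^ p * b (Suc c + p))" by (rule Lim_transform_eventually)
  then show "first_order (\<lambda>N. fps_nth (log_jet N (rho N) m i (Suc c)) p / real N ^ 1)
     (fps_nth (Abs_fps (\<lambda>p. real i ^ p * a (Suc c + p) / (fact (Suc c) * fact p))) p)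
     (fps_nth (Abs_fps (\<lambda>p. real i ^ p * b (Suc c + p) / (fact (Suc c) * fact p))) p)"
    unfolding first_order_def by (simp del: fact_Suc)
qed

text \<open>r! times the correction term of the exponential recursion; its factor 2 is absorbed
  because the second coefficient is \<Psi>''/2.\<close>

definition Br :: "nat \<Rightarrow> real fps" where
  "Br r = of_nat r * dfps a ^ (r - 1) * dfps b + of_nat (r choose 2) * dfps a ^ (r - 2) * fps_deriv (dfps a)"

text \<open>\<open>sc (real i)\<close> substitutes i X for X, because the i-th coordinate of the
  line is 1 + i X.\<close>

lemma grec_asy:
  assumes i: "i \<in> {1..Suc m}"
  shows "asy r (\<lambda>N. grec (log_jet N (rho N) m i) r)
    (sc (real i) (fps_const (1 / fact r) * dfps a ^ r)) (sc (real i) (fps_const (1 / fact r) * Br r))"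
proof -
  define A where "A c = Abs_fps (\<lambda>p. real i ^ p * a (c + p) / (fact c * fact p))" for c
  define B where "B c = Abs_fps (\<lambda>p. real i ^ p * b (c + p) / (fact c * fact p))" for c
  have rec: "of_nat (Suc r) * grec \<Lambda> (Suc r) = (\<Sum>b\<le>r. of_nat (Suc b) * (\<Lambda> (Suc b) * grec \<Lambda> (r - b)))" for \<Lambda> r
  proof -
    have "(of_nat (Suc r) :: real fps) * (fps_const (1 / real (Suc r)) * G) = G" for G
      unfolding fps_of_nat[symmetric] mult.assoc[symmetric] by simp
    then show ?thesis unfolding grec.simps(2) .
  qed
  have main: "asy r (\<lambda>N. grec (log_jet N (rho N) m i) r) (fps_const (1 / fact r) * A 1 ^ r)
    (fps_const (1 / fact r) * (of_nat r * A 1 ^ (r - 1) * B 1 + of_nat (2 * (r choose 2)) * A 1 ^ (r - 2) * A 2))"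
    by (rule asy_exp_recursion[where \<Lambda> = "\<lambda>N. log_jet N (rho N) m i"])
       (use log_jet_asy[OF i] rec in \<open>auto simp: A_def B_def\<close>)
  have X0: "fps_nth (fps_const (real i) * fps_X) 0 = 0" by simp
  have A1: "A 1 = sc (real i) (dfps a)" and B1: "B 1 = sc (real i) (dfps b)"
    by (simp_all add: fps_eq_iff A_def B_def dfps_def fps_nth_compose_linear)
  have A2: "of_nat (2 * c) * G * A 2 = sc (real i) (of_nat c) * G * sc (real i) (fps_deriv (dfps a))" for c G
  proof -
    have e1: "A 2 = fps_const (1 / 2) * sc (real i) (fps_deriv (dfps a))"
    proof (rule fps_ext)
      fix n
      have L: "fps_nth (A 2) n = real i ^ n * a (Suc (Suc n)) / (2 * fact n)" by (simp add: A_def)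
      have R: "fps_nth (fps_const (1 / 2) * sc (real i) (fps_deriv (dfps a))) n =
          1 / 2 * (real i ^ n * (real (Suc n) * (a (Suc (Suc n)) / fact (Suc n))))"
        by (simp add: dfps_def fps_nth_compose_linear)
      show "fps_nth (A 2) n = fps_nth (fps_const (1 / 2) * sc (real i) (fps_deriv (dfps a))) n"
        unfolding L R by (simp add: field_simps del: of_nat_Suc)
    qed
    have e2: "(of_nat (2 * c) :: real fps) * fps_const (1 / 2) = sc (real i) (of_nat c)"
      by (simp add: fps_of_nat[symmetric])
    have "of_nat (2 * c) * G * (fps_const (1 / 2) * sc (real i) (fps_deriv (dfps a))) =
        (of_nat (2 * c) * fps_const (1 / 2)) * G * sc (real i) (fps_deriv (dfps a))" by (simp only: mult_ac)
    then show ?thesis unfolding e1 e2 .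
  qed
  have on: "sc (real i) (of_nat c) = of_nat c" for c by (simp add: fps_of_nat[symmetric])
  have "sc (real i) (fps_const (1 / fact r) * dfps a ^ r) = fps_const (1 / fact r) * A 1 ^ r"
    unfolding A1 by (simp add: fps_compose_mult_distrib[OF X0] fps_compose_power[OF X0])
  moreover have "sc (real i) (fps_const (1 / fact r) * Br r) = fps_const (1 / fact r) * (of_nat r * A 1 ^ (r - 1) * B 1 + of_nat (2 * (r choose 2)) * A 1 ^ (r - 2) * A 2)"
    unfolding A2 A1 B1 Br_def fps_compose_mult_distrib[OF X0] fps_compose_add_distrib fps_compose_power[OF X0] on fps_const_compose ..
  ultimately show ?thesis using main by simp
qed

text \<open>The summands are one series with X replaced by i X, so the coefficient of order m
  acquires i^m; the weighted sum of the i^m is 1 and the divided difference collapses.\<close>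

lemma Zs_first_order:
  assumes "m \<le> k"
  shows "first_order (\<lambda>N. fps_nth (Zs N (rho N) q k m) m / real N ^ (k - m))
    (1 / fact (k - m) * fps_nth (fps_binomial (real k - q) * dfps a ^ (k - m)) m)
    (1 / fact (k - m) * fps_nth (fps_binomial (real k - q) * Br (k - m)) m)"
proof -
  let ?I = "{1..Suc m}" and ?bin = "fps_binomial (real k - q)"
  have "asy (k - m) (\<lambda>N. Zs N (rho N) q k m)
    (\<Sum>i\<in>?I. fps_const (dd real ?I i) * (sbin (real k - q) (real i) * sc (real i) (fps_const (1 / fact (k - m)) * dfps a ^ (k - m))))
    (\<Sum>i\<in>?I. fps_const (dd real ?I i) * (sbin (real k - q) (real i) * sc (real i) (fps_const (1 / fact (k - m)) * Br (k - m))))"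
    unfolding Zs_def by (intro asy_sum asy_cmult grec_asy)
  then have "first_order (\<lambda>N. fps_nth (Zs N (rho N) q k m) m / real N ^ (k - m))
    (fps_nth (\<Sum>i\<in>?I. fps_const (dd real ?I i) * (sbin (real k - q) (real i) * sc (real i) (fps_const (1 / fact (k - m)) * dfps a ^ (k - m)))) m)
    (fps_nth (\<Sum>i\<in>?I. fps_const (dd real ?I i) * (sbin (real k - q) (real i) * sc (real i) (fps_const (1 / fact (k - m)) * Br (k - m)))) m)"
    unfolding asy_def by blast
  moreover have "fps_nth (\<Sum>i\<in>?I. fps_const (dd real ?I i) * (sbin (real k - q) (real i) * sc (real i) (fps_const c * G))) m =
     c * fps_nth (?bin * G) m" for c and G :: "real fps"
  proof -
    have X0: "fps_nth (fps_const (real i) * fps_X) 0 = 0" for i by simp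
    have "sbin (real k - q) (real i) * sc (real i) (fps_const c * G) = sc (real i) (?bin * (fps_const c * G))" for i
      unfolding sbin_def by (rule fps_compose_mult_distrib[OF X0, symmetric])
    then have "fps_nth (\<Sum>i\<in>?I. fps_const (dd real ?I i) * (sbin (real k - q) (real i) * sc (real i) (fps_const c * G))) m =
      (\<Sum>i\<in>?I. dd real ?I i * (real i ^ m * fps_nth (?bin * (fps_const c * G)) m))"
      by (simp only: fps_sum_nth fps_mult_left_const_nth fps_nth_compose_linear)
    also have "\<dots> = (\<Sum>i\<in>?I. real i ^ m * dd real ?I i) * fps_nth (?bin * (fps_const c * G)) m"
      unfolding sum_distrib_right by (simp only: mult_ac)
    also have "(\<Sum>i\<in>?I. real i ^ m * dd real ?I i) = 1"
      by (subst dd_power_sum[where m = m]) (auto simp: inj_on_def)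
    also have "?bin * (fps_const c * G) = fps_const c * (?bin * G)" by (simp only: mult.left_commute)
    finally show ?thesis by simp
  qed
  ultimately show ?thesis by (simp only:)
qed

text \<open>Interpolates between the factorial moments (d = 0), for which there is an exact formula,
  and the power moments (j = 0), which are wanted.\<close>

definition gmoment :: "real \<Rightarrow> nat \<Rightarrow> nat \<Rightarrow> nat \<Rightarrow> int list \<Rightarrow> real" where
  "gmoment q N j d l = (\<Sum>c\<in>{1..N}. fact j * (real_of_int (l ! (c - 1) + int N - int c) gchoose j) * real_of_int (l ! (c - 1) + int N - int c) ^ d *
     (\<Prod>j\<in>{1..N} - {c}. (real_of_int (l ! (c - 1) + int N - int c) - real_of_int (l ! (j - 1) + int N - int j) - q) /
        (real_of_int (l ! (c - 1) + int N - int c) - real_of_int (l ! (j - 1) + int N - int j))))"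

lemma gmoment_0: "gmoment q N j 0 = (\<lambda>l. fact j * factorial_pp_moment N q j l)"
  by (simp add: gmoment_def factorial_pp_moment_def sum_distrib_left mult.assoc fun_eq_iff)

lemma gmoment_Suc: "gmoment q N j (Suc d) = (\<lambda>l. gmoment q N (Suc j) d l + real j * gmoment q N j d l)"
proof
  fix l
  have "fact j * (y gchoose j) * y ^ Suc d * w = fact (Suc j) * (y gchoose Suc j) * y ^ d * w + real j * (fact j * (y gchoose j) * y ^ d * w)" for y w :: real
  proof -
    have "fact j * (y gchoose j) * y ^ Suc d * w = fact j * (y * (y gchoose j)) * y ^ d * w" by simp
    also have "y * (y gchoose j) = real j * (y gchoose j) + real (Suc j) * (y gchoose Suc j)" by (rule gbinomial_mult_1)
    finally show ?thesis by (simp add: algebra_simps)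
  qed
  then show "gmoment q N j (Suc d) l = gmoment q N (Suc j) d l + real j * gmoment q N j d l"
    unfolding gmoment_def sum_distrib_left sum.distrib[symmetric] by (intro sum.cong refl)
qed

lemma integrable_gmoment: "integrable (measure_pmf (rho N)) (gmoment q N j d)"
proof (induction d arbitrary: j)
  case 0
  show ?case unfolding gmoment_0 using expected_factorial_moment(1)[OF rho_sig rho_conv] by simp
next
  case (Suc d)
  show ?case unfolding gmoment_Suc using Suc by simp
qed

definition M :: "real \<Rightarrow> nat \<Rightarrow> nat \<Rightarrow> nat \<Rightarrow> real" where
  "M q N j d = measure_pmf.expectation (rho N) (gmoment q N j d)"

lemma M_Suc: "M q N j (Suc d) = M q N (Suc j) d + real j * M q N j d"
  unfolding M_def gmoment_Suc using integrable_gmoment by simp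

text \<open>The expansions of \<open>N choose Suc m\<close> and \<open>Zs\<close> are multiplied; as
  (m + 1) + (k - m) = k + 1, all terms share one scale. The correction becomes \<open>mom'\<close>
  up to the term that the passage to powers restores.\<close>

lemma M_first_order:
  "first_order (\<lambda>N. M q N k 0 / real N ^ (k + 1)) (mom (dfps a) q k)
    (mom' (dfps a) (dfps b) q k - real (k choose 2) * mom (dfps a) q (k - 1))"
proof -
  let ?X = "\<lambda>m. fps_nth (fps_binomial (real k - q) * dfps a ^ (k - m)) m"
  let ?Y = "\<lambda>m. fps_nth (fps_binomial (real k - q) * Br (k - m)) m"
  have M0: "M q N k 0 = fact k * (\<Sum>m\<le>k. real (N choose Suc m) * fps_nth (Zs N (rho N) q k m) m)" for N
    unfolding M_def gmoment_0 by (simp add: expected_factorial_moment(2)[OF rho_sig rho_conv])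
  have fo: "first_order (\<lambda>N. fact k * (\<Sum>m\<le>k. real (N choose Suc m) / real N ^ Suc m * (fps_nth (Zs N (rho N) q k m) m / real N ^ (k - m))))
    (fact k * (\<Sum>m\<le>k. 1 / fact (Suc m) * (1 / fact (k - m) * ?X m)))
    (fact k * (\<Sum>m\<le>k. - real (Suc m choose 2) / fact (Suc m) * (1 / fact (k - m) * ?X m) + 1 / fact (Suc m) * (1 / fact (k - m) * ?Y m)))"
    by (intro first_order_cmult first_order_sum first_order_mult first_order_binomial Zs_first_order) simp
  have eq: "fact k * (\<Sum>m\<le>k. real (N choose Suc m) / real N ^ Suc m * (fps_nth (Zs N (rho N) q k m) m / real N ^ (k - m))) = M q N k 0 / real N ^ (k + 1)" for N
  proof -
    have "real (N choose Suc m) / real N ^ Suc m * (z / real N ^ (k - m)) = real (N choose Suc m) * z / real N ^ (k + 1)" if "m \<le> k" for m z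
    proof -
      have "k + 1 = Suc m + (k - m)" using that by simp
      then have "real N ^ (k + 1) = real N ^ (Suc m + (k - m))" by (rule arg_cong)
      then have "real N ^ (k + 1) = real N ^ Suc m * real N ^ (k - m)" unfolding power_add[of _ "Suc m"] .
      then show ?thesis by (simp only: times_divide_times_eq)
    qed
    then have "(\<Sum>m\<le>k. real (N choose Suc m) / real N ^ Suc m * (fps_nth (Zs N (rho N) q k m) m / real N ^ (k - m))) =
      (\<Sum>m\<le>k. real (N choose Suc m) * fps_nth (Zs N (rho N) q k m) m / real N ^ (k + 1))" by (intro sum.cong refl) auto
    then show ?thesis unfolding M0 sum_divide_distrib[symmetric] by simp
  qed
  have bf: "fact k / (fact m * fact (k - m)) = real (k choose m)" if "m \<le> k" for m
    using binomial_fact[OF that, where 'a = real] by simp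
  have \<alpha>: "fact k * (\<Sum>m\<le>k. 1 / fact (Suc m) * (1 / fact (k - m) * ?X m)) = mom (dfps a) q k"
    unfolding mom_def sum_distrib_left
  proof (rule sum.cong[OF refl])
    fix m assume "m \<in> {..k}"
    then have "real (k choose m) = fact k / (fact m * fact (k - m))" using bf by simp
    then show "fact k * (1 / fact (Suc m) * (1 / fact (k - m) * ?X m)) = real (k choose m) / real (m + 1) * ?X m"
      by (simp add: mult_ac)
  qed
  have \<beta>: "fact k * (\<Sum>m\<le>k. - real (Suc m choose 2) / fact (Suc m) * (1 / fact (k - m) * ?X m) + 1 / fact (Suc m) * (1 / fact (k - m) * ?Y m)) =
     (\<Sum>m\<le>k. real (k choose m) * (1 / real (m + 1) * ?Y m - real m / 2 * ?X m))"
    unfolding sum_distrib_left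
  proof (rule sum.cong[OF refl])
    fix m assume "m \<in> {..k}"
    then have c: "real (k choose m) = fact k / (fact m * fact (k - m))" using bf by simp
    have "2 * (Suc m choose 2) = Suc m * m" by (simp add: choose_two)
    then have "2 * real (Suc m choose 2) = real (Suc m) * real m" by (metis of_nat_mult of_nat_numeral)
    then have c2: "real (Suc m choose 2) = real (Suc m) * (real m / 2)" by simp
    have f: "fact (Suc m) = real (Suc m) * fact m" by simp
    have gen: "K * (- (s * t) / (s * F) * (1 / G * X) + 1 / (s * F) * (1 / G * Y)) = K / (F * G) * (1 / s * Y - t * X)"
      if "s \<noteq> 0" "F \<noteq> 0" "G \<noteq> 0" for K s t F G X Y :: real
      using that by (simp add: field_simps)
    have "fact k * (- (real (Suc m) * (real m / 2)) / (real (Suc m) * fact m) * (1 / fact (k - m) * ?X m) + 1 / (real (Suc m) * fact m) * (1 / fact (k - m) * ?Y m)) =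
       fact k / (fact m * fact (k - m)) * (1 / real (Suc m) * ?Y m - real m / 2 * ?X m)"
      by (rule gen) auto
    then show "fact k * (- real (Suc m choose 2) / fact (Suc m) * (1 / fact (k - m) * ?X m) + 1 / fact (Suc m) * (1 / fact (k - m) * ?Y m)) =
       real (k choose m) * (1 / real (m + 1) * ?Y m - real m / 2 * ?X m)"
      unfolding c c2 f Suc_eq_plus1[symmetric] .
  qed
  have "(\<Sum>m\<le>k. real (k choose m) * (1 / real (m + 1) * ?Y m - real m / 2 * ?X m)) =
     mom' (dfps a) (dfps b) q k - real (k choose 2) * mom (dfps a) q (k - 1)"
    using mom'_integration_by_parts[of k q "dfps a" "dfps b"] unfolding Br_def by simp
  then show ?thesis using fo unfolding eq \<alpha> \<beta> by simp
qed

lemma moment_first_order: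
  "first_order (\<lambda>N. M q N 0 k / real N ^ (k + 1)) (mom (dfps a) q k) (mom' (dfps a) (dfps b) q k)"
  using power_moments_from_factorial_moments[of "M q" "mom (dfps a) q"
    "\<lambda>k. mom' (dfps a) (dfps b) q k - real (k choose 2) * mom (dfps a) q (k - 1)" k, OF M_first_order] M_Suc by simp

text \<open>The exponent k + 1 collects the k rescalings of the atom and the 1/N in front of the
  measure.\<close>

lemma pp_integral_monom:
  assumes "N > 0"
  shows "pp_integral N q l (monom 1 k) = complex_of_real (gmoment q N 0 k l / real N ^ (k + 1))"
proof -
  have "pp_integral N q l (monom 1 k) = complex_of_real (\<Sum>c\<in>{1..N}. pp_weight N q l c * pp_atom N l c ^ k)"
    by (simp add: pp_integral_def poly_monom)
  also have "(\<Sum>c\<in>{1..N}. pp_weight N q l c * pp_atom N l c ^ k) = gmoment q N 0 k l / real N ^ (k + 1)"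
    unfolding gmoment_def sum_divide_distrib
  proof (rule sum.cong[OF refl])
    fix c
    let ?l = "\<lambda>c. real_of_int (l ! (c - 1) + int N - int c)"
    have at: "pp_atom N l c = ?l c / real N" by (simp add: pp_atom_def)
    have "pp_weight N q l c = 1 / real N * (\<Prod>j\<in>{1..N} - {c}. (?l c - ?l j - q) / (?l c - ?l j))"
      unfolding pp_weight_def
      by (intro arg_cong2[where f = times] prod.cong refl arg_cong2[where f = "(/)"]) simp_all
    then show "pp_weight N q l c * pp_atom N l c ^ k =
      fact 0 * (?l c gchoose 0) * ?l c ^ k * (\<Prod>j\<in>{1..N} - {c}. (?l c - ?l j - q) / (?l c - ?l j)) / real N ^ (k + 1)"
      unfolding at by (simp add: power_divide)
  qed
  finally show ?thesis .
qed

lemma phiN_eq: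
  assumes "N > 0"
  shows "phiN rho q N P = (\<Sum>k\<le>degree P. coeff P k * complex_of_real (M q N 0 k / real N ^ (k + 1)))"
proof -
  have "pp_integral N q l P = (\<Sum>k\<le>degree P. coeff P k * complex_of_real (gmoment q N 0 k l / real N ^ (k + 1)))" for l
  proof -
    have "pp_integral N q l P = (\<Sum>k\<le>degree P. coeff P k * pp_integral N q l (monom 1 k))"
      unfolding pp_integral_def poly_altdef[of P] poly_monom sum_distrib_left
      by (subst sum.swap) (simp add: mult_ac)
    then show ?thesis by (simp only: pp_integral_monom[OF assms])
  qed
  then have "phiN rho q N P = (\<Sum>k\<le>degree P. measure_pmf.expectation (rho N) (\<lambda>l. coeff P k * complex_of_real (gmoment q N 0 k l / real N ^ (k + 1))))"
    unfolding phiN_def using integrable_gmoment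
    by (simp only:) (intro Bochner_Integration.integral_sum Bochner_Integration.integrable_mult_right integrable_of_real integrable_divide)
  also have "\<dots> = (\<Sum>k\<le>degree P. coeff P k * complex_of_real (M q N 0 k / real N ^ (k + 1)))"
    by (simp only: integral_mult_right_zero integral_complex_of_real) (simp add: M_def)
  finally show ?thesis .
qed

definition phi_lim :: "real \<Rightarrow> complex poly \<Rightarrow> complex" where
  "phi_lim q P = (\<Sum>k\<le>degree P. coeff P k * complex_of_real (mom (dfps a) q k))"

definition phi_lim' :: "real \<Rightarrow> complex poly \<Rightarrow> complex" where
  "phi_lim' q P = (\<Sum>k\<le>degree P. coeff P k * complex_of_real (mom' (dfps a) (dfps b) q k))"

lemma sum_coeff_monom: "(\<Sum>k\<le>degree (monom (1::complex) n). coeff (monom 1 n) k * f k) = f n"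
  for f :: "nat \<Rightarrow> complex"
proof -
  have "(\<Sum>k\<le>n. coeff (monom (1::complex) n) k * f k) = (\<Sum>k\<in>{n}. coeff (monom 1 n) k * f k)"
    by (rule sum.mono_neutral_right) auto
  then show ?thesis by (simp add: degree_monom_eq)
qed

lemma phi_lim_monom: "phi_lim q (monom 1 k) = complex_of_real (mom (dfps a) q k)"
  unfolding phi_lim_def by (rule sum_coeff_monom)

lemma phi_lim'_monom: "phi_lim' q (monom 1 k) = complex_of_real (mom' (dfps a) (dfps b) q k)"
  unfolding phi_lim'_def by (rule sum_coeff_monom)

lemma phiN_tendsto: "(\<lambda>N. phiN rho q N P) \<longlonglongrightarrow> phi_lim q P"
proof -
  have "(\<lambda>N. \<Sum>k\<le>degree P. coeff P k * complex_of_real (M q N 0 k / real N ^ (k + 1))) \<longlonglongrightarrow> phi_lim q P"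
    unfolding phi_lim_def
    by (intro tendsto_sum tendsto_mult tendsto_const tendsto_of_real first_order_tendsto[OF moment_first_order])
  moreover have "eventually (\<lambda>N. (\<Sum>k\<le>degree P. coeff P k * complex_of_real (M q N 0 k / real N ^ (k + 1))) = phiN rho q N P) sequentially"
    using eventually_pos_nat by eventually_elim (rule phiN_eq[symmetric])
  ultimately show ?thesis by (rule Lim_transform_eventually)
qed

lemma phiN_first_order: "(\<lambda>N. of_nat N * (phiN rho q N P - phi_lim q P)) \<longlonglongrightarrow> phi_lim' q P"
proof -
  have "(\<lambda>N. \<Sum>k\<le>degree P. coeff P k * complex_of_real (real N * (M q N 0 k / real N ^ (k + 1) - mom (dfps a) q k))) \<longlonglongrightarrow> phi_lim' q P"
    unfolding phi_lim'_def
    by (intro tendsto_sum tendsto_mult tendsto_const tendsto_of_real moment_first_order[unfolded first_order_def])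
  moreover have "eventually (\<lambda>N. (\<Sum>k\<le>degree P. coeff P k * complex_of_real (real N * (M q N 0 k / real N ^ (k + 1) - mom (dfps a) q k))) =
      of_nat N * (phiN rho q N P - phi_lim q P)) sequentially"
    using eventually_pos_nat
  proof eventually_elim
    case (elim N)
    show ?case unfolding phiN_eq[OF elim] phi_lim_def sum_subtractf[symmetric] sum_distrib_left
      by (intro sum.cong refl) (simp add: algebra_simps)
  qed
  ultimately show ?thesis by (rule Lim_transform_eventually)
qed

end

section \<open>Transfer to complex coefficients and conclusion\<close>

definition fps_complex :: "real fps \<Rightarrow> complex fps" where
  "fps_complex G = Abs_fps (\<lambda>n. complex_of_real (fps_nth G n))"

lemma fps_complex_add: "fps_complex (G + H) = fps_complex G + fps_complex H"
  by (simp add: fps_complex_def fps_eq_iff)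

lemma fps_complex_mult: "fps_complex (G * H) = fps_complex G * fps_complex H"
  by (simp add: fps_complex_def fps_eq_iff fps_mult_nth)

lemma fps_complex_const: "fps_complex (fps_const c) = fps_const (complex_of_real c)"
  by (simp add: fps_complex_def fps_eq_iff)

lemma fps_complex_power: "fps_complex (G ^ n) = fps_complex G ^ n"
proof (induction n)
  case 0
  show ?case by (simp add: fps_complex_def fps_eq_iff)
qed (simp add: fps_complex_mult)

lemma fps_complex_compose: "fps_complex (G oo H) = fps_complex G oo fps_complex H"
proof (rule fps_ext)
  fix n
  have "fps_nth (fps_complex H ^ i) n = complex_of_real (fps_nth (H ^ i) n)" for i
    unfolding fps_complex_power[symmetric] by (simp add: fps_complex_def)
  then show "fps_nth (fps_complex (G oo H)) n = fps_nth (fps_complex G oo fps_complex H) n"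
    by (simp add: fps_compose_nth) (simp add: fps_complex_def fps_compose_nth)
qed

lemma fps_complex_exp: "fps_complex (fps_exp 1) = fps_exp 1"
  by (simp add: fps_complex_def fps_eq_iff)

theorem theorem3:
  fixes rho :: "nat \<Rightarrow> int list pmf"
    and a b :: "nat \<Rightarrow> real"
  assumes rho_sig: "\<And>N. set_pmf (rho N) \<subseteq> sigs N"
    and rho_conv: "\<And>N. SGF_unif_conv N (rho N)"
    and lim_diag: "\<And>k i0. k \<ge> 1 \<Longrightarrow> i0 \<ge> 1 \<Longrightarrow>
        (\<lambda>N. pderivs (replicate k i0) (\<lambda>u. ln (SGF N (rho N) u)) ones - real N * a k)
          \<longlonglongrightarrow> b k"
    and lim_mixed: "\<And>is. (\<forall>i\<in>set is. i \<ge> 1) \<Longrightarrow> card (set is) \<ge> 2 \<Longrightarrow>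
        (\<lambda>N. pderivs is (\<lambda>u. ln (SGF N (rho N) u)) ones) \<longlonglongrightarrow> 0"
    and Psi_conv: "\<exists>r>0. \<forall>z. \<bar>z - 1\<bar> < r \<longrightarrow> summable (\<lambda>k. a k * (z - 1) ^ k / fact k)"
    and Phi_conv: "\<exists>r>0. \<forall>z. \<bar>z - 1\<bar> < r \<longrightarrow> summable (\<lambda>k. b k * (z - 1) ^ k / fact k)"
  shows "\<exists>\<phi> \<phi>' :: real \<Rightarrow> complex poly \<Rightarrow> complex.
    (\<forall>q\<in>{-1..1}. \<forall>P.
        (\<lambda>N. phiN rho q N P) \<longlonglongrightarrow> \<phi> q P \<and>
        (\<lambda>N. of_nat N * (phiN rho q N P - \<phi> q P)) \<longlonglongrightarrow> \<phi>' q P) \<and>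
    (\<forall>q\<in>{-1..1}. \<forall>k.
        \<phi> q (monom 1 k) = of_real (\<Sum>m\<le>k. real (k choose m) / fact (m + 1) *
          (deriv ^^ m) (\<lambda>u. u powr (real k - q) * (deriv (egf_at1 a) u) ^ (k - m)) 1) \<and>
        \<phi>' q (monom 1 k) = of_real (\<Sum>m<k. real (k choose (m + 1)) / fact m *
          (deriv ^^ m) (\<lambda>u. u powr (real k - q) * (deriv (egf_at1 b) u - (1 - q) / (2 * u)) *
                                (deriv (egf_at1 a) u) ^ (k - m - 1)) 1)) \<and>
    (\<forall>q\<in>{-1..1}.
        (fps_exp 1 oo (fps_const (of_real q) *
            Abs_fps (\<lambda>n. if n = 0 then 0 else \<phi> 0 (monom 1 (n - 1))))) *
          Abs_fps (\<lambda>n. if n = 0 then 0 else \<phi>' q (monom 1 (n - 1)))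
        = Abs_fps (\<lambda>n. if n = 0 then 0 else \<phi>' 0 (monom 1 (n - 1))) +
          fps_const (of_real q / 2) *
            Abs_fps (\<lambda>n. if n < 2 then 0 else of_nat (n - 1) * \<phi> 0 (monom 1 (n - 2))))"
proof -
  interpret asymptotic_data rho a b
    by unfold_locales (fact rho_sig rho_conv lim_diag lim_mixed)+
  note exp_a = deriv_egf_expansion[OF Psi_conv] and exp_b = deriv_egf_expansion[OF Phi_conv]
  have ident: "(fps_exp 1 oo (fps_const (of_real q) *
            Abs_fps (\<lambda>n. if n = 0 then 0 else phi_lim 0 (monom 1 (n - 1))))) *
          Abs_fps (\<lambda>n. if n = 0 then 0 else phi_lim' q (monom 1 (n - 1)))
        = Abs_fps (\<lambda>n. if n = 0 then 0 else phi_lim' 0 (monom 1 (n - 1))) +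
          fps_const (of_real q / 2) *
            Abs_fps (\<lambda>n. if n < 2 then 0 else of_nat (n - 1) * phi_lim 0 (monom 1 (n - 2)))" for q
  proof -
    \<comment> \<open>All the series have real coefficients, so the identity proved over the reals
      is carried over by the ring homomorphism \<open>fps_complex\<close>.\<close>
    have 1: "Abs_fps (\<lambda>n. if n = 0 then 0 else complex_of_real (f (n - 1))) = fps_complex (Abs_fps (\<lambda>n. if n = 0 then 0 else f (n - 1)))" for f
      by (simp add: fps_complex_def fps_eq_iff)
    have 2: "Abs_fps (\<lambda>n. if n < 2 then 0 else of_nat (n - 1) * complex_of_real (f (n - 2))) =
        fps_complex (Abs_fps (\<lambda>n. if n < 2 then 0 else real (n - 1) * f (n - 2)))" for f
      by (simp add: fps_complex_def fps_eq_iff)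
    have q2: "fps_const (of_real q / 2) = fps_complex (fps_const (q / 2))" by (simp add: fps_complex_const)
    show ?thesis
      unfolding phi_lim_monom phi_lim'_monom 1 2 q2 fps_complex_const[symmetric] fps_complex_exp[symmetric]
        fps_complex_mult[symmetric] fps_complex_compose[symmetric] fps_complex_add[symmetric]
      by (simp only: exp_mom_generating_identity)
  qed
  show ?thesis
  proof (intro exI conjI ballI allI)
    fix q :: real and P :: "complex poly" and k :: nat
    show "(\<lambda>N. phiN rho q N P) \<longlonglongrightarrow> phi_lim q P" by (rule phiN_tendsto)
    show "(\<lambda>N. of_nat N * (phiN rho q N P - phi_lim q P)) \<longlonglongrightarrow> phi_lim' q P" by (rule phiN_first_order)
    show "phi_lim q (monom 1 k) = of_real (\<Sum>m\<le>k. real (k choose m) / fact (m + 1) *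
          (deriv ^^ m) (\<lambda>u. u powr (real k - q) * (deriv (egf_at1 a) u) ^ (k - m)) 1)"
      unfolding mom_eq_derivatives[OF exp_a] by (rule phi_lim_monom)
    show "phi_lim' q (monom 1 k) = of_real (\<Sum>m<k. real (k choose (m + 1)) / fact m *
          (deriv ^^ m) (\<lambda>u. u powr (real k - q) * (deriv (egf_at1 b) u - (1 - q) / (2 * u)) *
                                (deriv (egf_at1 a) u) ^ (k - m - 1)) 1)"
      unfolding mom'_eq_derivatives[OF exp_a exp_b] by (rule phi_lim'_monom)
    show "(fps_exp 1 oo (fps_const (of_real q) *
            Abs_fps (\<lambda>n. if n = 0 then 0 else phi_lim 0 (monom 1 (n - 1))))) *
          Abs_fps (\<lambda>n. if n = 0 then 0 else phi_lim' q (monom 1 (n - 1)))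
        = Abs_fps (\<lambda>n. if n = 0 then 0 else phi_lim' 0 (monom 1 (n - 1))) +
          fps_const (of_real q / 2) *
            Abs_fps (\<lambda>n. if n < 2 then 0 else of_nat (n - 1) * phi_lim 0 (monom 1 (n - 2)))"
      by (rule ident)
  qed
qed

end
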